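(* Let $Y_1'(\tilde z)=A_1(z)Y_1(\tilde z)$ and $Y_2'(\tilde z)=A_2(z)Y_2(\tilde z)$ be two $n\times n$ systems of standard form with the same admissible data and the same singularities $a_1,\dots,a_m\in\mathbb C$. Then the indices corresponding to both systems coincide. Moreover, if the indices are given by $\overline{\varkappa}_1,\dots,\overline{\varkappa}_1,\overline{\varkappa}_2,\dots,\overline{\varkappa}_2,\dots,\overline{\varkappa}_k,\dots,\overline{\varkappa}_k$, where $\overline{\varkappa}_j$ occurs exactly $l_j$ times, $\overline{\varkappa}_1>\overline{\varkappa}_2>\dots>\overline{\varkappa}_k$, $l_1,\dots,l_k\in\{1,2,\dots\}$, $l_1+\dots+l_k=n$, then both systems are related to each other by $$A_2(z)=V'(z)V^{-1}(z)+V(z)A_1(z)V^{-1}(z),\qquad z\in S\setminus\{\infty\},$$ or, equivalently, by $$Y_2(\tilde z)=V(z)Y_1(\tilde z)C,\qquad \tilde z\in\tilde S^*,$$ where $C\in G\mathbb C^{n\times n}$ and $V:\mathbb C\to G\mathbb C^{n\times n}$ is a rational matrix function of the block form $$V(z)=\begin{pmatrix}V_{11}&V_{12}(z)&\dots&V_{1k}(z)\\0&V_{22}&&V_{2k}(z)\\\vdots&&\ddots&\vdots\\0&0&\dots&V_{kk}\end{pmatrix}$$ with $V_{jj}\in G\mathbb C^{l_j\times l_j}$ and $V_{ij}(z)=\sum_{r=0}^{\overline{\varkappa}_i-\overline{\varkappa}_j}V_{ij}^{(r)}z^r$, $V_{ij}^{(r)}\in\mathbb C^{l_i\times l_j}$,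 for $i<j$.
   Context: $\dot{\mathbb C}=\mathbb C\cup\{\infty\}$; $G\mathbb C^{n\times n}$ is the group of invertible complex $n\times n$ matrices; for single matrices $M\sim M'$ means similarity. The distinct points $a_1,\dots,a_m\in\mathbb C$ lie in this order on a fixed smooth (simple) closed positively oriented curve $\Gamma\subset\mathbb C$ (indices cyclic). Let $S=\dot{\mathbb C}\setminus\{a_1,\dots,a_m\}$, $\rho:\tilde S\to S$ its universal covering, write $z=\rho(\tilde z)$ for $\tilde z\in\tilde S$, and $\tilde S^*=\tilde S\setminus\rho^{-1}(\infty)$. For small $\delta>0$, $D_a=\{0<|z-a|<\delta\}$ ($a\in\mathbb C$), $D_\infty=\{|z|>1/\delta\}$, $\tilde D_a$ is the universal covering of $D_a$, and $(\tilde z-a)^E=\exp(E\ln(\tilde z-a))$ on $\tilde D_a$. Solutions of systems are always analytic functions with values in $G\mathbb C^{n\times n}$. Fix $\tilde z_0\in\tilde S$ with $\rho(\tilde z_0)$ inside $\Gamma$; for each $k$ let $\tilde z_k$ be the endpoint of a simple path in $\tilde S$ starting at $\tilde z_0$ whose projection is a closed curve based at $\rho(\tilde z_0)$ meeting $\Gamma$ exactly twice, first on the subarc joining $a_{k-1}$ and $a_k$, then on the subarc joining $a_k$ and $a_{k+1}$ (so it goes once around $a_k$ in the positive direction), and let $\sigma_k$ be the deck transformation of $\tilde S$ with $\sigma_k(\tilde z_0)=\tilde z_k$. For a solution $Y:\tilde S^*\to G\mathbb C^{n\times n}$ of a linear system $Y'(\tilde z)=A(z)Y(\tilde z)$, the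 matrices $\chi(\sigma)$ are defined by $Y(\tilde z)=Y(\sigma(\tilde z))\chi(\sigma)$. Two $m$-tuples of matrices are equivalent if they are simultaneously similar; $[\cdot]_\sim$ is the equivalence class. The monodromy of the system is $[\chi(\sigma_1),\dots,\chi(\sigma_m)]_\sim$. A matrix is non-resonant if no two of its eigenvalues differ by a nonzero integer. Tuples $[M_1,\dots,M_m]$, $[E_1,\dots,E_m]$ of $n\times n$ matrices are admissible data if $M_1\cdots M_m=I$, $M_k\sim\exp(-2\pi iE_k)$ for each $k$, and all $E_k$ are non-resonant. The system $Y'(\tilde z)=A(z)Y(\tilde z)$ is of standard form with respect to these admissible data, with singularities $a_1,\dots,a_m$ and indices $\varkappa_1\ge\dots\ge\varkappa_n$ (integers) if: (i) it has singularities only at $a_1,\dots,a_m$ and at infinity (i.e. $A$ is analytic on $\mathbb C\setminus\{a_1,\dots,a_m\}$), the singularity at infinity being apparent (solutions have no branching there); (ii) its monodromy is $[M_1,\dots,M_m]_\sim$; (iii) for each $k$ the solutions on $\tilde D_{a_k}$ can be written $Y(\tilde z)=Z_k(z)(\tilde z-a_k)^{E_k}C$ with $Z_k:D_{a_k}\cup\{a_k\}\to G\mathbb C^{n\times n}$ analytic and $C\in G\mathbb C^{n\times n}$; (iv) the solutions on $D_\infty$ can be written $Y(z)=\mathrm{diag}(z^{\varkappa_1},\dots,z^{\varkappa_n})Z_\infty(z)C$ with $Z_\infty:D_\infty\cup\{\infty\}\to G\mathbb C^{n\times n}$ analytic and $C\in G\mathbb C^{n\times n}$. *)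

theory Defs
  imports "HOL-Complex_Analysis.Complex_Analysis"
begin

unbundle no fps_syntax

section \<open>Complex square matrices\<close>

text \<open>
  An \<open>n \<times> n\<close> matrix is an element of \<open>complex^'n^'n\<close>, abbreviated \<open>'n cmat\<close>; where the order
  of rows and columns matters, \<open>'n\<close> is a finite linear order, i.e. a copy of \<open>{1, \<dots>, n}\<close>.
  Tuples indexed by \<open>1, \<dots>, m\<close> are functions on \<open>nat\<close> of which only the values on \<open>{1..m}\<close> are
  used.
\<close>

type_synonym 'n cmat = "((complex, 'n) vec, 'n) vec"

definition cscale :: "complex \<Rightarrow> ('n::finite) cmat \<Rightarrow> 'n cmat" where
  "cscale c A = (\<chi> i j. c * A $ i $ j)"

primrec matpow :: "('n::finite) cmat \<Rightarrow> nat \<Rightarrow> 'n cmat" where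
  "matpow A 0 = mat 1"
| "matpow A (Suc k) = A ** matpow A k"

text \<open>The multiplication of type class \<open>times\<close> on \<open>'n cmat\<close> is componentwise, so the
  generic \<open>exp\<close> is not the matrix exponential.\<close>

definition mat_exp :: "('n::finite) cmat \<Rightarrow> 'n cmat" where
  "mat_exp A = (\<Sum>k. (1 / fact k) *\<^sub>R matpow A k)"

definition eigenvalue_of :: "('n::finite) cmat \<Rightarrow> complex \<Rightarrow> bool" where
  "eigenvalue_of A c \<longleftrightarrow> (\<exists>v. v \<noteq> 0 \<and> A *v v = c *s v)"

definition nonresonant :: "('n::finite) cmat \<Rightarrow> bool" where
  "nonresonant A \<longleftrightarrow>
     (\<forall>c d (k::int). eigenvalue_of A c \<longrightarrow> eigenvalue_of A d \<longrightarrow> k \<noteq> 0 \<longrightarrow> c - d \<noteq> of_int k)"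

definition similar :: "('n::finite) cmat \<Rightarrow> 'n cmat \<Rightarrow> bool" where
  "similar A B \<longleftrightarrow> (\<exists>P. invertible P \<and> B = matrix_inv P ** A ** P)"

definition tuple_equiv ::
  "nat \<Rightarrow> (nat \<Rightarrow> ('n::finite) cmat) \<Rightarrow> (nat \<Rightarrow> 'n cmat) \<Rightarrow> bool" where
  "tuple_equiv m M N \<longleftrightarrow>
     (\<exists>P. invertible P \<and> (\<forall>k\<in>{1..m}. N k = matrix_inv P ** M k ** P))"

definition mat_analytic :: "(complex \<Rightarrow> ('n::finite) cmat) \<Rightarrow> complex set \<Rightarrow> bool" where
  "mat_analytic F D \<longleftrightarrow> (\<forall>i j. (\<lambda>z. F z $ i $ j) analytic_on D)"

definition mat_deriv :: "(complex \<Rightarrow> ('n::finite) cmat) \<Rightarrow> complex \<Rightarrow> 'n cmat" where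
  "mat_deriv F z = (\<chi> i j. deriv (\<lambda>w. F w $ i $ j) z)"

definition admissible_data ::
  "nat \<Rightarrow> (nat \<Rightarrow> ('n::finite) cmat) \<Rightarrow> (nat \<Rightarrow> 'n cmat) \<Rightarrow> bool" where
  "admissible_data m M E \<longleftrightarrow>
     foldr (**) (map M [1..<Suc m]) (mat 1) = mat 1 \<and>
     (\<forall>k\<in>{1..m}. similar (M k) (mat_exp (cscale (- 2 * of_real pi * \<i>) (E k)))) \<and>
     (\<forall>k\<in>{1..m}. nonresonant (E k))"


section \<open>The punctured Riemann sphere and its universal covering\<close>

text \<open>
  The Riemann sphere is the unit sphere of \<open>complex \<times> real\<close>; \<open>to_sphere\<close> is the inverse
  stereographic projection from the north pole, which represents \<open>\<infinity>\<close>.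
\<close>

definition sphere_inf :: "complex \<times> real" where
  "sphere_inf = (0, 1)"

definition to_sphere :: "complex \<Rightarrow> complex \<times> real" where
  "to_sphere z = (of_real (2 / ((cmod z)\<^sup>2 + 1)) * z, ((cmod z)\<^sup>2 - 1) / ((cmod z)\<^sup>2 + 1))"

text \<open>The stereographic projection (its value at \<open>sphere_inf\<close> is irrelevant).\<close>

definition from_sphere :: "complex \<times> real \<Rightarrow> complex" where
  "from_sphere x = fst x / of_real (1 - snd x)"

definition punctured_sphere :: "nat \<Rightarrow> (nat \<Rightarrow> complex) \<Rightarrow> (complex \<times> real) set" where
  "punctured_sphere m a = sphere 0 1 - to_sphere ` a ` {1..m}"

definition universal_covering ::
  "'u::real_normed_vector set \<Rightarrow> ('u \<Rightarrow> complex \<times> real) \<Rightarrow> (complex \<times> real) set \<Rightarrow> bool" where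
  "universal_covering T \<rho> S \<longleftrightarrow> covering_space T \<rho> S \<and> simply_connected T"

definition deck_transformation ::
  "'u::real_normed_vector set \<Rightarrow> ('u \<Rightarrow> complex \<times> real) \<Rightarrow> ('u \<Rightarrow> 'u) \<Rightarrow> bool" where
  "deck_transformation T \<rho> f \<longleftrightarrow> (\<exists>g. homeomorphism T T f g) \<and> (\<forall>t\<in>T. \<rho> (f t) = \<rho> t)"

text \<open>The part of the covering space lying over the finite plane.\<close>

definition finite_part ::
  "'u::real_normed_vector set \<Rightarrow> ('u \<Rightarrow> complex \<times> real) \<Rightarrow> 'u set" where
  "finite_part T \<rho> = {t \<in> T. \<rho> t \<noteq> sphere_inf}"


section \<open>The curve through the singularities\<close>

text \<open>Smoothness is understood as having a regular \<open>C\<^sup>1\<close> parametrisation as a closed curve.\<close>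

definition smooth_closed_curve :: "(real \<Rightarrow> complex) \<Rightarrow> bool" where
  "smooth_closed_curve \<gamma> \<longleftrightarrow>
     simple_path \<gamma> \<and> pathfinish \<gamma> = pathstart \<gamma> \<and>
     (\<exists>\<gamma>'. continuous_on {0..1} \<gamma>' \<and> \<gamma>' 1 = \<gamma>' 0 \<and>
        (\<forall>t\<in>{0..1}. \<gamma>' t \<noteq> 0 \<and> (\<gamma> has_vector_derivative \<gamma>' t) (at t within {0..1})))"

definition positively_oriented :: "(real \<Rightarrow> complex) \<Rightarrow> bool" where
  "positively_oriented \<gamma> \<longleftrightarrow> (\<forall>z\<in>inside (path_image \<gamma>). winding_number \<gamma> z = 1)"

definition in_order_on_curve ::
  "nat \<Rightarrow> (nat \<Rightarrow> complex) \<Rightarrow> (real \<Rightarrow> complex) \<Rightarrow> (nat \<Rightarrow> real) \<Rightarrow> bool" where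
  "in_order_on_curve m a \<gamma> \<tau> \<longleftrightarrow>
     strict_mono_on {1..m} \<tau> \<and> (\<forall>k\<in>{1..m}. 0 \<le> \<tau> k \<and> \<tau> k < 1 \<and> a k = \<gamma> (\<tau> k))"

text \<open>The subarc from \<open>a k\<close> to \<open>a (k + 1)\<close>.  Indices are cyclic: both \<open>k = 0\<close> and \<open>k = m\<close>
  give the subarc from \<open>a m\<close> to \<open>a 1\<close>, which passes through the start point of \<open>\<gamma>\<close>.\<close>

definition subarc :: "nat \<Rightarrow> (real \<Rightarrow> complex) \<Rightarrow> (nat \<Rightarrow> real) \<Rightarrow> nat \<Rightarrow> complex set" where
  "subarc m \<gamma> \<tau> k =
     (if 1 \<le> k \<and> k < m then \<gamma> ` {\<tau> k..\<tau> (Suc k)} else \<gamma> ` ({\<tau> m..1} \<union> {0..\<tau> 1}))"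

text \<open>
  A simple path in the covering space whose projection starts and ends at the same point, inside
  the curve, and meets the curve exactly at the parameters \<open>s1 < s2\<close>.  Between them it is not
  inside the curve: it crosses the curve at both parameters, rather than touching it from inside,
  and so goes around \<open>a k\<close> in the positive direction.
\<close>

definition path_around ::
  "'u::real_normed_vector set \<Rightarrow> ('u \<Rightarrow> complex \<times> real) \<Rightarrow> nat \<Rightarrow> (real \<Rightarrow> complex) \<Rightarrow> (nat \<Rightarrow> real)
     \<Rightarrow> 'u \<Rightarrow> nat \<Rightarrow> (real \<Rightarrow> 'u) \<Rightarrow> bool" where
  "path_around T \<rho> m \<gamma> \<tau> t\<^sub>0 k p \<longleftrightarrow>
     simple_path p \<and> path_image p \<subseteq> T \<and> pathstart p = t\<^sub>0 \<and>
     \<rho> (pathfinish p) = \<rho> t\<^sub>0 \<and>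
     (\<exists>s1 s2. s1 < s2 \<and>
        {s \<in> {0..1}. \<rho> (p s) \<in> to_sphere ` path_image \<gamma>} = {s1, s2} \<and>
        \<rho> (p s1) \<in> to_sphere ` subarc m \<gamma> \<tau> (k - 1) \<and>
        \<rho> (p s2) \<in> to_sphere ` subarc m \<gamma> \<tau> k \<and>
        (\<forall>s\<in>{s1<..<s2}. \<rho> (p s) \<notin> to_sphere ` inside (path_image \<gamma>)))"


section \<open>Solutions and monodromy\<close>

text \<open>
  \<open>Y\<close> is a solution of \<open>Y' = A(z) Y\<close> with invertible values on a surface \<open>T\<close> spread over the plane
  by \<open>z = \<pi> t\<close>; the derivative is the one with respect to the local coordinate \<open>z\<close>.  As \<open>\<pi>\<close> is a
  local homeomorphism wherever this is used, \<open>\<pi> s \<noteq> \<pi> t\<close> for \<open>s \<noteq> t\<close> close to \<open>t\<close>, and solutions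
  are analytic in \<open>z\<close>.
\<close>

definition is_solution ::
  "(complex \<Rightarrow> ('n::finite) cmat) \<Rightarrow> 'u::topological_space set \<Rightarrow> ('u \<Rightarrow> complex)
     \<Rightarrow> ('u \<Rightarrow> 'n cmat) \<Rightarrow> bool" where
  "is_solution A T \<pi> Y \<longleftrightarrow>
     (\<forall>t\<in>T. invertible (Y t) \<and>
        ((\<lambda>s. cscale (1 / (\<pi> s - \<pi> t)) (Y s - Y t)) \<longlongrightarrow> A (\<pi> t) ** Y t) (at t within T))"

definition is_global_solution ::
  "'u::real_normed_vector set \<Rightarrow> ('u \<Rightarrow> complex \<times> real) \<Rightarrow> (complex \<Rightarrow> ('n::finite) cmat)
     \<Rightarrow> ('u \<Rightarrow> 'n cmat) \<Rightarrow> bool" where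
  "is_global_solution T \<rho> A Y \<longleftrightarrow> is_solution A (finite_part T \<rho>) (\<lambda>t. from_sphere (\<rho> t)) Y"

text \<open>The monodromy class of the system, computed from any one solution, is that of \<open>M\<close>.\<close>

definition has_monodromy ::
  "'u::real_normed_vector set \<Rightarrow> ('u \<Rightarrow> complex \<times> real) \<Rightarrow> (nat \<Rightarrow> 'u \<Rightarrow> 'u) \<Rightarrow> nat
     \<Rightarrow> (complex \<Rightarrow> ('n::finite) cmat) \<Rightarrow> (nat \<Rightarrow> 'n cmat) \<Rightarrow> bool" where
  "has_monodromy T \<rho> \<sigma> m A M \<longleftrightarrow>
     (\<exists>Y \<chi>M. is_global_solution T \<rho> A Y \<and>
        (\<forall>k\<in>{1..m}. \<forall>t\<in>finite_part T \<rho>. Y t = Y (\<sigma> k t) ** \<chi>M k) \<and>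
        tuple_equiv m \<chi>M M)"


section \<open>Standard form\<close>

text \<open>
  The universal covering of \<open>{z. 0 < |z - a| < \<delta>}\<close> is the half plane \<open>Re w < ln \<delta>\<close> with projection
  \<open>z = a + exp w\<close>, so that \<open>ln (z - a)\<close> is the coordinate \<open>w\<close> and \<open>(z - a)\<^sup>E = exp (w E)\<close>.
\<close>

definition local_form_at ::
  "nat \<Rightarrow> (nat \<Rightarrow> complex) \<Rightarrow> (nat \<Rightarrow> ('n::finite) cmat) \<Rightarrow> (complex \<Rightarrow> 'n cmat) \<Rightarrow> nat \<Rightarrow> bool" where
  "local_form_at m a E A k \<longleftrightarrow>
     (\<exists>\<delta>>0. (\<forall>j\<in>{1..m}. j \<noteq> k \<longrightarrow> \<delta> \<le> dist (a j) (a k)) \<and>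
       (\<forall>Y. is_solution A {w. Re w < ln \<delta>} (\<lambda>w. a k + exp w) Y \<longrightarrow>
         (\<exists>Z C. mat_analytic Z (ball (a k) \<delta>) \<and> (\<forall>z\<in>ball (a k) \<delta>. invertible (Z z)) \<and>
            invertible C \<and>
            (\<forall>w. Re w < ln \<delta> \<longrightarrow> Y w = Z (a k + exp w) ** mat_exp (cscale w (E k)) ** C))))"

text \<open>Solutions on the universal covering of \<open>{z. |z| > 1/\<delta>}\<close>, the half plane \<open>Re w > - ln \<delta>\<close> with
  projection \<open>z = exp w\<close>, have no branching.\<close>

definition apparent_at_inf ::
  "nat \<Rightarrow> (nat \<Rightarrow> complex) \<Rightarrow> (complex \<Rightarrow> ('n::finite) cmat) \<Rightarrow> bool" where
  "apparent_at_inf m a A \<longleftrightarrow>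
     (\<exists>\<delta>>0. (\<forall>j\<in>{1..m}. cmod (a j) \<le> 1 / \<delta>) \<and>
       (\<forall>Y. is_solution A {w. Re w > - ln \<delta>} exp Y \<longrightarrow>
         (\<forall>w. Re w > - ln \<delta> \<longrightarrow> Y (w + 2 * of_real pi * \<i>) = Y w)))"

definition diag_powers :: "('n::finite \<Rightarrow> int) \<Rightarrow> complex \<Rightarrow> 'n cmat" where
  "diag_powers \<kappa> z = (\<chi> i j. if i = j then z powi \<kappa> i else 0)"

text \<open>\<open>W\<close> is \<open>Z\<^sub>\<infinity>\<close> in the local coordinate \<open>1/z\<close> at infinity.\<close>

definition local_form_at_inf ::
  "nat \<Rightarrow> (nat \<Rightarrow> complex) \<Rightarrow> ('n \<Rightarrow> int) \<Rightarrow> (complex \<Rightarrow> ('n::finite) cmat) \<Rightarrow> bool" where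
  "local_form_at_inf m a \<kappa> A \<longleftrightarrow>
     (\<exists>\<delta>>0. (\<forall>j\<in>{1..m}. cmod (a j) \<le> 1 / \<delta>) \<and>
       (\<forall>Y. is_solution A {z. cmod z > 1 / \<delta>} (\<lambda>z. z) Y \<longrightarrow>
         (\<exists>W C. mat_analytic W (ball 0 \<delta>) \<and> (\<forall>u\<in>ball 0 \<delta>. invertible (W u)) \<and>
            invertible C \<and>
            (\<forall>z. cmod z > 1 / \<delta> \<longrightarrow> Y z = diag_powers \<kappa> z ** W (1 / z) ** C))))"

definition standard_form ::
  "'u::real_normed_vector set \<Rightarrow> ('u \<Rightarrow> complex \<times> real) \<Rightarrow> (nat \<Rightarrow> 'u \<Rightarrow> 'u) \<Rightarrow> nat
     \<Rightarrow> (nat \<Rightarrow> complex) \<Rightarrow> (nat \<Rightarrow> 'n cmat) \<Rightarrow> (nat \<Rightarrow> 'n cmat)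
     \<Rightarrow> ('n::{finite,linorder} \<Rightarrow> int) \<Rightarrow> (complex \<Rightarrow> 'n cmat) \<Rightarrow> bool" where
  "standard_form T \<rho> \<sigma> m a M E \<kappa> A \<longleftrightarrow>
     antimono \<kappa> \<and>
     mat_analytic A (- a ` {1..m}) \<and> apparent_at_inf m a A \<and>
     has_monodromy T \<rho> \<sigma> m A M \<and>
     (\<forall>k\<in>{1..m}. local_form_at m a E A k) \<and>
     local_form_at_inf m a \<kappa> A"


section \<open>Block structure\<close>

text \<open>The decreasing sequence \<open>\<kappa>\<close> consists of \<open>\<kappa>b 1 > \<dots> > \<kappa>b K\<close>, where \<open>\<kappa>b j\<close> occurs
  exactly \<open>l j\<close> times.\<close>

definition index_blocks ::
  "('n::finite \<Rightarrow> int) \<Rightarrow> nat \<Rightarrow> (nat \<Rightarrow> int) \<Rightarrow> (nat \<Rightarrow> nat) \<Rightarrow> bool" where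
  "index_blocks \<kappa> K \<kappa>b l \<longleftrightarrow>
     (\<forall>i\<in>{1..K}. \<forall>j\<in>{1..K}. i < j \<longrightarrow> \<kappa>b i > \<kappa>b j) \<and>
     (\<forall>j\<in>{1..K}. l j \<ge> 1 \<and> card {p. \<kappa> p = \<kappa>b j} = l j) \<and>
     (\<Sum>j=1..K. l j) = CARD('n)"

definition block_invertible :: "'n set \<Rightarrow> ('n::finite) cmat \<Rightarrow> bool" where
  "block_invertible B D \<longleftrightarrow>
     (\<exists>W::'n cmat. \<forall>p\<in>B. \<forall>q\<in>B.
        (\<Sum>s\<in>B. D $ p $ s * W $ s $ q) = (if p = q then 1 else 0) \<and>
        (\<Sum>s\<in>B. W $ p $ s * D $ s $ q) = (if p = q then 1 else 0))"

text \<open>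
  \<open>{p. \<kappa> p = \<kappa>b i}\<close> is the set of row (or column) indices of the \<open>i\<close>-th block.  The constant
  diagonal blocks are the diagonal blocks of one matrix \<open>D\<close>, and the \<open>r\<close>-th coefficients of all the
  blocks above the diagonal are blocks of one matrix \<open>Q r\<close>.
\<close>

definition block_form ::
  "('n::finite \<Rightarrow> int) \<Rightarrow> nat \<Rightarrow> (nat \<Rightarrow> int) \<Rightarrow> (complex \<Rightarrow> 'n cmat) \<Rightarrow> bool" where
  "block_form \<kappa> K \<kappa>b V \<longleftrightarrow>
     (\<forall>z. invertible (V z)) \<and>
     (\<exists>D Q. (\<forall>j\<in>{1..K}. block_invertible {p. \<kappa> p = \<kappa>b j} D) \<and>
        (\<forall>z. \<forall>i\<in>{1..K}. \<forall>j\<in>{1..K}. \<forall>p q. \<kappa> p = \<kappa>b i \<longrightarrow> \<kappa> q = \<kappa>b j \<longrightarrow>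
           V z $ p $ q =
             (if i = j then D $ p $ q
              else if i < j then (\<Sum>r=0..nat (\<kappa>b i - \<kappa>b j). Q r $ p $ q * z ^ r)
              else 0)))"

end

(*
  Normalise global solutions X1, X2 of the two systems so that both have monodromy matrices M_k.
  Then X2 X1^{-1} is invariant under every sigma_k.  Instead of proving that the sigma_k generate
  the deck group, cut the sphere along the curve without its k-th open arc: the complement is
  simply connected, so it lifts to a sheet through t_0.  All these sheets agree inside the curve,
  and the path p_k shows that outside it the sheets number k - 1 and k differ by sigma_k.  Hence
  X2 X1^{-1} descends to a function U on the plane without a_1, ..., a_m.  Near a_k it has the form
  Z_2 (z - a_k)^E C (z - a_k)^{-E} Z_1^{-1}; single-valuedness forces C to commute with
  exp(2 pi i E), hence with E by non-resonance, so U extends holomorphically and invertibly to the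
  whole plane.  Near infinity U = diag(z^kappa2) H(1/z) diag(z^{-kappa1}), so by Liouville every
  entry U_ij is a polynomial of degree at most kappa2_i - kappa1_j.  If kappa2_p < kappa1_p for
  some p, the entries with i >= p >= j vanish and det U = 0; this and the same argument for the
  inverse of U give kappa1 = kappa2, and the degree bounds are the block form.
*)
theory Submission
  imports Defs
begin

text \<open>Solutions live on the covering, whereas the gauge matrix must be a function of z; all
  calculus is therefore done along continuous sections over plane domains, where a solution is an
  ordinary matrix function. Two features of the covering shape the argument. \<open>T\<close>
  contains points above infinity, at which no solution is defined, so constancy has to be carried
  across them: it is proved on a dense part of the connected space \<open>T\<close>. And lifting
  needs simply connected plane sets. As every truncated curve contains a_1, the coordinate u = 1/(z
  - a_1) turns its complement on the sphere into an open plane set, with infinity at u = 0, and the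
  truncated curve into a set running off to infinity, so that no bounded hole remains. At a
  singularity C is treated through the operator ad E: its eigenvalues are the differences of
  eigenvalues of E, the period 2 pi i admits only integral ones and no nilpotent part, and
  non-resonance leaves only 0. The normalised solutions serve to construct U; for arbitrary Y1, Y2
  the matrix (U Y1)^{-1} Y2 is constant, and this is the C of the theorem.\<close>

no_notation fps_nth (infixl \<open>$\<close> 75)

section \<open>Matrix-valued functions and linear systems\<close>

lemma matrix_inv_left_right:
  fixes A :: "('n::finite) cmat"
  assumes "invertible A"
  shows matrix_inv_left: "matrix_inv A ** A = mat 1" and matrix_inv_right: "A ** matrix_inv A = mat 1"
proof -
  have "\<exists>A'. A ** A' = mat 1 \<and> A' ** A = mat 1"
    using assms unfolding invertible_def by blast
  from someI_ex[OF this] show "matrix_inv A ** A = mat 1" "A ** matrix_inv A = mat 1"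
    unfolding matrix_inv_def by blast+
qed

lemma matrix_inv_unique:
  fixes A :: "('n::finite) cmat"
  assumes "A ** B = mat 1"
  shows "matrix_inv A = B"
proof -
  have "invertible A" using assms by (metis invertible_def matrix_left_right_inverse)
  then have "matrix_inv A ** (A ** B) = B" by (simp add: matrix_mul_assoc matrix_inv_left)
  then show ?thesis using assms by simp
qed

lemma invertible_mat_inv:
  fixes A :: "('n::finite) cmat"
  assumes "invertible A" shows "invertible (matrix_inv A)"
  using matrix_inv_left_right[OF assms] unfolding invertible_def by blast

lemma invertible_mat_mult:
  fixes A B :: "('n::finite) cmat"
  shows "invertible A \<Longrightarrow> invertible B \<Longrightarrow> invertible (A ** B)"
  by (simp add: invertible_det_nz det_mul)

lemma matrix_inv_mult:
  fixes A B :: "('n::finite) cmat"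
  assumes "invertible A" "invertible B"
  shows "matrix_inv (A ** B) = matrix_inv B ** matrix_inv A"
proof (rule matrix_inv_unique)
  have "A ** B ** (matrix_inv B ** matrix_inv A) = A ** (B ** matrix_inv B) ** matrix_inv A"
    by (simp add: matrix_mul_assoc)
  then show "A ** B ** (matrix_inv B ** matrix_inv A) = mat 1"
    using assms by (simp add: matrix_inv_right)
qed

lemma matrix_cancel:
  fixes A :: "('n::finite) cmat"
  assumes "invertible A"
  shows "matrix_inv A ** (A ** X) = X" "A ** (matrix_inv A ** X) = X"
    "(X ** A) ** matrix_inv A = X" "(X ** matrix_inv A) ** A = X"
  using matrix_inv_left_right[OF assms]
  by (simp_all add: matrix_mul_assoc) (simp_all add: matrix_mul_assoc[symmetric])

lemma matrix_mult_minus: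
  fixes A :: "('n::finite) cmat"
  shows "(- A) ** B = - (A ** B)" "A ** (- B) = - (A ** B)"
  by (simp_all add: matrix_matrix_mult_def vec_eq_iff sum_negf)

lemma matrix_mult_diff:
  fixes A :: "('n::finite) cmat"
  shows "(A - C) ** B = A ** B - C ** B" "A ** (B - C) = A ** B - A ** C"
  by (simp_all add: matrix_matrix_mult_def vec_eq_iff sum_subtractf algebra_simps)

lemma matrix_mult_add:
  fixes A :: "('n::finite) cmat"
  shows "(A + C) ** B = A ** B + C ** B" "A ** (B + C) = A ** B + A ** C"
  by (simp_all add: matrix_matrix_mult_def vec_eq_iff sum.distrib algebra_simps)

lemma matrix_mult_zero:
  fixes A :: "('n::finite) cmat"
  shows "0 ** A = 0" "A ** 0 = 0"
  by (simp_all add: matrix_matrix_mult_def vec_eq_iff)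

lemma cscale_mult:
  fixes A :: "('n::finite) cmat"
  shows "cscale c A ** B = cscale c (A ** B)" "A ** cscale c B = cscale c (A ** B)"
  by (simp_all add: cscale_def matrix_matrix_mult_def vec_eq_iff sum_distrib_left mult_ac)

section \<open>Entrywise analytic matrix functions\<close>

lemma mat_analytic_nth: "mat_analytic F S \<Longrightarrow> (\<lambda>z. F z $ i $ j) analytic_on S"
  by (simp add: mat_analytic_def)

lemma mat_analytic_subset: "mat_analytic F S \<Longrightarrow> S' \<subseteq> S \<Longrightarrow> mat_analytic F S'"
  unfolding mat_analytic_def using analytic_on_subset by blast

lemma mat_analytic_const: "mat_analytic (\<lambda>z. C) S"
  by (simp add: mat_analytic_def)

lemma mat_analytic_mult:
  assumes "mat_analytic F S" "mat_analytic G S"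
  shows "mat_analytic (\<lambda>z. F z ** G z) S"
  using assms unfolding mat_analytic_def matrix_matrix_mult_def
  by (auto intro!: analytic_intros)

lemma mat_analytic_det:
  assumes "\<And>i j. (\<lambda>z. F z $ i $ j) analytic_on S"
  shows "(\<lambda>z. det (F z)) analytic_on S"
  unfolding det_def by (intro analytic_intros assms)

text \<open>Cramer's rule, applied to the j-th column of the inverse as the solution of A x = e_j.
  It exhibits the entries of the inverse as quotients of determinants, which is how analyticity
  passes to the inverse.\<close>

lemma matrix_inv_nth:
  fixes A :: "('n::finite) cmat"
  assumes "invertible A"
  shows "matrix_inv A $ i $ j = det (\<chi> r s. if s = i then axis j 1 $ r else A $ r $ s) / det A"
proof -
  let ?x = "matrix_inv A *v axis j 1"
  have "A *v ?x = axis j 1"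
    using matrix_inv_right[OF assms] by (simp add: matrix_vector_mul_assoc)
  then have "?x = (\<chi> k. det (\<chi> r s. if s = k then axis j 1 $ r else A $ r $ s) / det A)"
    using cramer[of A ?x "axis j 1"] assms invertible_det_nz by blast
  moreover have "?x $ i = matrix_inv A $ i $ j"
    by (simp add: matrix_vector_mult_def axis_def if_distrib cong: if_cong)
  ultimately show ?thesis by (metis (no_types, lifting) vec_lambda_beta)
qed

lemma mat_analytic_inv:
  assumes "mat_analytic F S" "open S" "\<And>z. z \<in> S \<Longrightarrow> invertible (F z)"
  shows "mat_analytic (\<lambda>z. matrix_inv (F z)) S"
  unfolding mat_analytic_def
proof (intro allI)
  fix i j
  have num: "(\<lambda>z. (\<chi> r s. if s = i then axis j 1 $ r else F z $ r $ s) $ r $ s) analytic_on S" for r s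
    using mat_analytic_nth[OF assms(1)] by (cases "s = i") auto
  have "(\<lambda>z. det (\<chi> r s. if s = i then axis j 1 $ r else F z $ r $ s) / det (F z)) analytic_on S"
    using assms(3) invertible_det_nz mat_analytic_nth[OF assms(1)]
    by (intro analytic_on_divide mat_analytic_det num) auto
  then show "(\<lambda>z. matrix_inv (F z) $ i $ j) analytic_on S"
    unfolding analytic_on_open[OF \<open>open S\<close>]
    by (rule holomorphic_transform) (simp add: matrix_inv_nth[OF assms(3)])
qed

text \<open>A relation rather than a function: \<open>mat_deriv\<close> is built from the total
  operator \<open>deriv\<close> and so does not itself assert differentiability.\<close>

definition has_mat_deriv :: "(complex \<Rightarrow> ('n::finite) cmat) \<Rightarrow> 'n cmat \<Rightarrow> complex \<Rightarrow> bool" where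
  "has_mat_deriv F F' z \<longleftrightarrow>
     (\<forall>i j. ((\<lambda>w. F w $ i $ j) has_field_derivative F' $ i $ j) (at z))"

lemma has_mat_deriv_const: "has_mat_deriv (\<lambda>w. C) 0 z"
  by (simp add: has_mat_deriv_def)

lemma has_mat_deriv_mult:
  assumes "has_mat_deriv F F' z" "has_mat_deriv G G' z"
  shows "has_mat_deriv (\<lambda>w. F w ** G w) (F' ** G z + F z ** G') z"
  unfolding has_mat_deriv_def
proof (intro allI)
  fix i j
  have "((\<lambda>w. F w $ i $ k * G w $ k $ j) has_field_derivative
      F' $ i $ k * G z $ k $ j + G' $ k $ j * F z $ i $ k) (at z)" for k
    using assms by (intro DERIV_mult) (simp_all add: has_mat_deriv_def)
  then have "((\<lambda>w. \<Sum>k\<in>UNIV. F w $ i $ k * G w $ k $ j) has_field_derivative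
      (\<Sum>k\<in>UNIV. F' $ i $ k * G z $ k $ j + G' $ k $ j * F z $ i $ k)) (at z)"
    by (rule DERIV_sum)
  then show "((\<lambda>w. (F w ** G w) $ i $ j) has_field_derivative (F' ** G z + F z ** G') $ i $ j) (at z)"
    by (simp add: matrix_matrix_mult_def sum.distrib mult.commute)
qed

lemma has_mat_deriv_unique:
  assumes "has_mat_deriv F F' z" "has_mat_deriv F F'' z"
  shows "F' = F''"
  unfolding vec_eq_iff
proof (intro allI)
  fix i j
  show "F' $ i $ j = F'' $ i $ j"
    by (rule DERIV_unique[of "\<lambda>w. F w $ i $ j" _ z]) (use assms in \<open>simp_all add: has_mat_deriv_def\<close>)
qed

lemma has_mat_deriv_imp_mat_deriv: "has_mat_deriv F F' z \<Longrightarrow> mat_deriv F z = F'"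
  by (simp add: has_mat_deriv_def mat_deriv_def vec_eq_iff DERIV_imp_deriv)

lemma has_mat_deriv_transform:
  assumes "has_mat_deriv F F' z" "open D" "z \<in> D" "\<And>w. w \<in> D \<Longrightarrow> F w = G w"
  shows "has_mat_deriv G F' z"
  unfolding has_mat_deriv_def
proof (intro allI)
  fix i j
  show "((\<lambda>w. G w $ i $ j) has_field_derivative F' $ i $ j) (at z)"
    by (rule has_field_derivative_transform_within_open[where f = "\<lambda>w. F w $ i $ j" and S = D])
       (use assms in \<open>auto simp: has_mat_deriv_def\<close>)
qed

lemma mat_analytic_imp_has_mat_deriv:
  assumes "mat_analytic F D" "z \<in> D"
  shows "has_mat_deriv F (mat_deriv F z) z"
  unfolding has_mat_deriv_def mat_deriv_def
proof (intro allI)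
  fix i j
  have "(\<lambda>w. F w $ i $ j) analytic_on {z}"
    using assms analytic_on_subset[of _ D "{z}"] by (simp add: mat_analytic_def)
  then show "((\<lambda>w. F w $ i $ j) has_field_derivative (\<chi> i j. deriv (\<lambda>w. F w $ i $ j) z) $ i $ j) (at z)"
    by (simp add: analytic_at_imp_isCont analytic_on_imp_differentiable_at field_differentiable_derivI)
qed

lemma mat_analytic_if_has_mat_deriv:
  assumes "open D" "\<And>z. z \<in> D \<Longrightarrow> has_mat_deriv F (F' z) z"
  shows "mat_analytic F D"
  unfolding mat_analytic_def analytic_on_open[OF assms(1)] holomorphic_on_open[OF assms(1)]
  using assms(2) unfolding has_mat_deriv_def by blast

text \<open>Differentiating F^{-1} F = 1 determines the derivative of the inverse once it is known
  to exist; existence comes from Cramer's rule, hence the analyticity of F on a whole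
  neighbourhood.\<close>

lemma has_mat_deriv_inv:
  assumes "open D" "z \<in> D" "mat_analytic F D" "\<And>w. w \<in> D \<Longrightarrow> invertible (F w)"
    and F': "has_mat_deriv F F' z"
  shows "has_mat_deriv (\<lambda>w. matrix_inv (F w)) (- (matrix_inv (F z) ** F' ** matrix_inv (F z))) z"
proof -
  define G where "G = mat_deriv (\<lambda>w. matrix_inv (F w)) z"
  have inv: "invertible (F z)" using assms by blast
  have G: "has_mat_deriv (\<lambda>w. matrix_inv (F w)) G z"
    unfolding G_def using assms by (intro mat_analytic_imp_has_mat_deriv[OF mat_analytic_inv])
  have "has_mat_deriv (\<lambda>w. mat 1) (G ** F z + matrix_inv (F z) ** F') z"
    by (rule has_mat_deriv_transform[OF has_mat_deriv_mult[OF G F'] \<open>open D\<close> \<open>z \<in> D\<close>])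
       (use assms matrix_inv_left in blast)
  then have "G ** F z + matrix_inv (F z) ** F' = 0"
    using has_mat_deriv_unique has_mat_deriv_const by blast
  then have "(G ** F z + matrix_inv (F z) ** F') ** matrix_inv (F z) = 0"
    by (simp add: matrix_mult_zero)
  then have "G + matrix_inv (F z) ** F' ** matrix_inv (F z) = 0"
    by (simp add: matrix_mult_add matrix_cancel[OF inv])
  then show ?thesis using G by (simp add: eq_neg_iff_add_eq_0[symmetric])
qed

lemma has_mat_deriv_zero_const:
  assumes "open D" "connected D" "\<And>z. z \<in> D \<Longrightarrow> has_mat_deriv F 0 z"
  obtains C where "\<And>z. z \<in> D \<Longrightarrow> F z = C"
proof -
  have "\<exists>c. \<forall>z\<in>D. F z $ i $ j = c" for i j
  proof -
    have der: "((\<lambda>z. F z $ i $ j) has_field_derivative 0) (at z)" if "z \<in> D" for z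
      using assms(3)[OF that] by (simp add: has_mat_deriv_def)
    then have "continuous_on D (\<lambda>z. F z $ i $ j)"
      by (meson DERIV_isCont continuous_at_imp_continuous_on)
    then show ?thesis
      using DERIV_zero_connected_constant[OF assms(2,1) finite.emptyI, of "\<lambda>z. F z $ i $ j"] der
      by (metis Diff_empty)
  qed
  then obtain c where "\<And>i j z. z \<in> D \<Longrightarrow> F z $ i $ j = c i j" by metis
  then show ?thesis using that[of "\<chi> i j. c i j"] by (simp add: vec_eq_iff)
qed

section \<open>Linear systems and their pullbacks\<close>

lemma is_solution_iff_has_mat_deriv:
  assumes "open D"
  shows "is_solution A D (\<lambda>z. z) Y \<longleftrightarrow>
    (\<forall>z\<in>D. invertible (Y z) \<and> has_mat_deriv Y (A z ** Y z) z)"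
proof -
  have "((\<lambda>s. cscale (1 / (s - t)) (Y s - Y t)) \<longlongrightarrow> A t ** Y t) (at t within D)
      \<longleftrightarrow> has_mat_deriv Y (A t ** Y t) t" if "t \<in> D" for t
  proof -
    have "((\<lambda>s. cscale (1 / (s - t)) (Y s - Y t)) \<longlongrightarrow> A t ** Y t) (at t) \<longleftrightarrow>
      (\<forall>i j. ((\<lambda>s. cscale (1 / (s - t)) (Y s - Y t) $ i $ j) \<longlongrightarrow> (A t ** Y t) $ i $ j) (at t))"
      by (rule iffI; (intro allI)?) (rule tendsto_vec_nth, rule tendsto_vec_nth, assumption, rule vec_tendstoI, rule vec_tendstoI, blast)
    then show ?thesis
      using at_within_open[OF that assms]
      by (simp add: has_mat_deriv_def has_field_derivative_iff cscale_def)
  qed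
  then show ?thesis by (simp add: is_solution_def)
qed

text \<open>The map s reads a solution on a surface in a coordinate with projection h. The last
  hypothesis keeps s v different from s u for v near u, so that the punctured limit at s u may be
  composed with s.\<close>

lemma is_solution_pullback:
  assumes sol: "is_solution A T \<pi> Y" and cont: "continuous_on D s" and im: "s ` D \<subseteq> T"
    and h: "\<And>u. u \<in> D \<Longrightarrow> \<pi> (s u) = h u"
    and inj: "\<And>u. u \<in> D \<Longrightarrow> eventually (\<lambda>v. h v \<noteq> h u) (at u within D)"
  shows "is_solution A D h (\<lambda>u. Y (s u))"
  unfolding is_solution_def
proof (intro ballI conjI)
  fix u assume u: "u \<in> D"
  then have su: "s u \<in> T" using im by blast
  then show "invertible (Y (s u))" using sol by (auto simp: is_solution_def)
  have D: "eventually (\<lambda>v. v \<in> D) (at u within D)"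
    by (simp add: eventually_at_filter)
  have "eventually (\<lambda>v. s v \<in> T \<and> s v \<noteq> s u) (at u within D)"
    using inj[OF u] D by eventually_elim (use im h u in \<open>metis image_subset_iff\<close>)
  moreover have "(s \<longlongrightarrow> s u) (at u within D)"
    using cont u by (simp add: continuous_on_def)
  ultimately have "filterlim s (at (s u) within T) (at u within D)"
    by (simp add: filterlim_at)
  moreover have "((\<lambda>t. cscale (1 / (\<pi> t - \<pi> (s u))) (Y t - Y (s u))) \<longlongrightarrow> A (\<pi> (s u)) ** Y (s u))
      (at (s u) within T)"
    using sol su by (simp add: is_solution_def)
  ultimately have "((\<lambda>v. cscale (1 / (\<pi> (s v) - \<pi> (s u))) (Y (s v) - Y (s u))) \<longlongrightarrow>
      A (\<pi> (s u)) ** Y (s u)) (at u within D)"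
    by (rule filterlim_compose[rotated])
  moreover have "eventually (\<lambda>v. cscale (1 / (\<pi> (s v) - \<pi> (s u))) (Y (s v) - Y (s u)) =
      cscale (1 / (h v - h u)) (Y (s v) - Y (s u))) (at u within D)"
    using D by eventually_elim (use h u in simp)
  ultimately show "((\<lambda>v. cscale (1 / (h v - h u)) (Y (s v) - Y (s u))) \<longlongrightarrow> A (h u) ** Y (s u))
      (at u within D)"
    using h[OF u] by (simp add: tendsto_cong)
qed

section \<open>The matrix exponential\<close>

lemma has_mat_deriv_zero_UNIV:
  assumes "\<And>z. has_mat_deriv F 0 z" shows "F w = F v"
  by (rule has_mat_deriv_zero_const[of UNIV F]) (use assms in auto)

lemma matpow_cscale: "matpow (cscale w A) k = cscale (w ^ k) (matpow A k)"
proof (induction k)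
  case 0 show ?case by (simp add: cscale_def mat_def vec_eq_iff)
next
  case (Suc k) then show ?case
    by (simp add: cscale_mult) (simp add: cscale_def mult_ac)
qed

lemma matpow_commute: "matpow A k ** A = A ** matpow A k"
  by (induction k) (simp_all add: matrix_mul_assoc[symmetric])

text \<open>The base of the power is the sum of the moduli of all entries. It dominates every row
  sum, so each further factor A costs one such constant.\<close>

lemma matpow_nth_bound:
  fixes A :: "('n::finite) cmat"
  shows "cmod (matpow A k $ i $ j) \<le> (\<Sum>r\<in>UNIV. \<Sum>s\<in>UNIV. cmod (A $ r $ s)) ^ k"
proof (induction k arbitrary: i j)
  case 0 show ?case by (simp add: mat_def)
next
  case (Suc k)
  let ?b = "\<Sum>r\<in>UNIV. \<Sum>s\<in>UNIV. cmod (A $ r $ s)"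
  have "cmod (matpow A (Suc k) $ i $ j) \<le> (\<Sum>l\<in>UNIV. cmod (A $ i $ l * matpow A k $ l $ j))"
    by (simp add: matrix_matrix_mult_def norm_sum)
  also have "\<dots> \<le> (\<Sum>l\<in>UNIV. cmod (A $ i $ l)) * ?b ^ k"
    using Suc by (auto simp: norm_mult sum_distrib_right intro!: sum_mono mult_left_mono)
  also have "(\<Sum>l\<in>UNIV. cmod (A $ i $ l)) \<le> ?b"
    by (rule member_le_sum) (auto intro: sum_nonneg)
  then have "(\<Sum>l\<in>UNIV. cmod (A $ i $ l)) * ?b ^ k \<le> ?b * ?b ^ k"
    by (intro mult_right_mono zero_le_power sum_nonneg) auto
  finally show ?case by simp
qed

text \<open>Comparison with the scalar exponential series. The terms are arranged as coefficient
  times \<open>w ^ k\<close>, so that each entry of the exponential is a power series in w to which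
  termwise differentiation applies.\<close>

lemma summable_matpow:
  fixes A :: "('n::finite) cmat" and w :: complex
  shows "summable (\<lambda>k. (matpow A k $ i $ j / fact k) * w ^ k)"
proof (rule summable_comparison_test)
  let ?b = "\<Sum>r\<in>UNIV. \<Sum>s\<in>UNIV. cmod (A $ r $ s)"
  have "cmod ((matpow A k $ i $ j / fact k) * w ^ k) \<le> (?b * cmod w) ^ k /\<^sub>R fact k" for k
    using mult_right_mono[OF matpow_nth_bound[of A k i j], of "cmod w ^ k / fact k"]
    by (simp add: norm_mult norm_divide norm_power power_mult_distrib field_simps)
  then show "\<exists>N. \<forall>k\<ge>N. norm ((matpow A k $ i $ j / fact k) * w ^ k) \<le> (?b * cmod w) ^ k /\<^sub>R fact k"
    by blast
  show "summable (\<lambda>k. (?b * cmod w) ^ k /\<^sub>R fact k)"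
    by (rule summable_exp_generic)
qed

lemma mat_exp_nth:
  fixes A :: "('n::finite) cmat"
  shows "mat_exp (cscale w A) $ i $ j = (\<Sum>k. (matpow A k $ i $ j / fact k) * w ^ k)"
proof -
  have "(\<lambda>k. (1 / fact k) *\<^sub>R matpow (cscale w A) k) sums
      (\<chi> i j. \<Sum>k. (matpow A k $ i $ j / fact k) * w ^ k)"
    unfolding sums_def
  proof (intro vec_tendstoI)
    fix i j
    have "(\<lambda>n. \<Sum>k<n. (matpow A k $ i $ j / fact k) * w ^ k) \<longlonglongrightarrow>
        (\<Sum>k. (matpow A k $ i $ j / fact k) * w ^ k)"
      by (rule summable_LIMSEQ[OF summable_matpow])
    moreover have "((1 / fact k) *\<^sub>R matpow (cscale w A) k) $ i $ j = (matpow A k $ i $ j / fact k) * w ^ k" for k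
      unfolding matpow_cscale by (simp add: cscale_def) (simp add: scaleR_conv_of_real field_simps)
    ultimately show "(\<lambda>n. (\<Sum>k<n. (1 / fact k) *\<^sub>R matpow (cscale w A) k) $ i $ j) \<longlonglongrightarrow>
      (\<chi> i j. \<Sum>k. (matpow A k $ i $ j / fact k) * w ^ k) $ i $ j"
      unfolding sum_component by (simp only: vec_lambda_beta)
  qed
  then show ?thesis unfolding mat_exp_def by (simp add: sums_iff)
qed

text \<open>Termwise differentiation produces the coefficients A^{k+1}/k!. Splitting off the
  additional factor on the left or on the right gives the two forms, and uniqueness of the
  derivative then shows that A commutes with its exponential.\<close>

lemma has_mat_deriv_mat_exp:
  fixes A :: "('n::finite) cmat"
  shows "has_mat_deriv (\<lambda>w. mat_exp (cscale w A)) (A ** mat_exp (cscale w A)) w"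
    and "has_mat_deriv (\<lambda>w. mat_exp (cscale w A)) (mat_exp (cscale w A) ** A) w"
proof -
  define c where "c i j k = matpow A k $ i $ j / fact k" for i j k
  have deriv: "((\<lambda>w. mat_exp (cscale w A) $ i $ j) has_field_derivative (\<Sum>k. diffs (c i j) k * w ^ k)) (at w)"
    for i j
    unfolding mat_exp_nth c_def[symmetric]
    by (rule termdiffs_strong_converges_everywhere) (simp only: c_def summable_matpow)
  have diffs: "diffs (c i j) k = matpow A (Suc k) $ i $ j / fact k" for i j k
    by (simp add: diffs_def c_def del: matpow.simps of_nat_Suc)
  have suml: "(\<lambda>k. c i j k * w ^ k) sums (mat_exp (cscale w A) $ i $ j)" for i j
    unfolding mat_exp_nth c_def by (rule summable_sums[OF summable_matpow])
  have "(\<lambda>k. \<Sum>l\<in>UNIV. A $ i $ l * (c l j k * w ^ k)) sums (A ** mat_exp (cscale w A)) $ i $ j" for i j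
    by (auto simp: matrix_matrix_mult_def intro!: sums_sum sums_mult suml)
  moreover have "(\<Sum>l\<in>UNIV. A $ i $ l * (c l j k * w ^ k)) = diffs (c i j) k * w ^ k" for i j k
    by (simp add: diffs matrix_matrix_mult_def c_def sum_distrib_left sum_distrib_right sum_divide_distrib)
       (simp add: mult_ac)
  ultimately have "(\<Sum>k. diffs (c i j) k * w ^ k) = (A ** mat_exp (cscale w A)) $ i $ j" for i j
    by (simp add: sums_iff)
  then show "has_mat_deriv (\<lambda>w. mat_exp (cscale w A)) (A ** mat_exp (cscale w A)) w"
    using deriv by (simp add: has_mat_deriv_def)
  have "(\<lambda>k. \<Sum>l\<in>UNIV. (c i l k * w ^ k) * A $ l $ j) sums (mat_exp (cscale w A) ** A) $ i $ j" for i j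
    by (auto simp: matrix_matrix_mult_def intro!: sums_sum sums_mult2 suml)
  moreover have "(\<Sum>l\<in>UNIV. (c i l k * w ^ k) * A $ l $ j) = diffs (c i j) k * w ^ k" for i j k
    by (simp add: diffs matpow_commute[symmetric])
       (simp add: matrix_matrix_mult_def c_def sum_distrib_left sum_distrib_right sum_divide_distrib,
        simp add: mult_ac)
  ultimately have "(\<Sum>k. diffs (c i j) k * w ^ k) = (mat_exp (cscale w A) ** A) $ i $ j" for i j
    by (simp add: sums_iff)
  then show "has_mat_deriv (\<lambda>w. mat_exp (cscale w A)) (mat_exp (cscale w A) ** A) w"
    using deriv by (simp add: has_mat_deriv_def)
qed

lemma mat_exp_commute: "A ** mat_exp (cscale w A) = mat_exp (cscale w A) ** A"
  using has_mat_deriv_unique has_mat_deriv_mat_exp by blast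

lemma has_mat_deriv_mat_exp_minus:
  "has_mat_deriv (\<lambda>w. mat_exp (cscale (- w) A)) (- (A ** mat_exp (cscale (- w) A))) w"
  unfolding has_mat_deriv_def
proof (intro allI)
  fix i j
  have "((\<lambda>w. mat_exp (cscale w A) $ i $ j) has_field_derivative (A ** mat_exp (cscale (- w) A)) $ i $ j) (at (- w))"
    using has_mat_deriv_mat_exp(1)[of A "- w"] by (simp add: has_mat_deriv_def)
  from DERIV_chain'[OF DERIV_minus[OF DERIV_ident] this]
  show "((\<lambda>w. mat_exp (cscale (- w) A) $ i $ j) has_field_derivative (- (A ** mat_exp (cscale (- w) A))) $ i $ j) (at w)"
    by simp
qed

lemma mat_exp_zero: "mat_exp (cscale 0 A) = mat 1"
  unfolding vec_eq_iff mat_exp_nth by (simp only: powser_zero) simp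

section \<open>Conjugation by the exponential\<close>

definition exp_conj :: "('n::finite) cmat \<Rightarrow> 'n cmat \<Rightarrow> complex \<Rightarrow> 'n cmat" where
  "exp_conj E D w = mat_exp (cscale w E) ** D ** mat_exp (cscale (- w) E)"

text \<open>This is the operator ad E, and \<open>exp_conj E D w\<close> is exp(w ad E) applied to
  D; with w = ln (z - a) it reads (z - a)^E D (z - a)^{-E}. The next lemmas solve X' = ad E X for
  special initial values D.\<close>

definition comm :: "('n::finite) cmat \<Rightarrow> 'n cmat \<Rightarrow> 'n cmat" where
  "comm E D = E ** D - D ** E"

lemma has_mat_deriv_exp_conj: "has_mat_deriv (exp_conj E D) (exp_conj E (comm E D) w) w"
proof -
  have "has_mat_deriv (exp_conj E D)
     ((mat_exp (cscale w E) ** E ** D + mat_exp (cscale w E) ** 0) ** mat_exp (cscale (- w) E) +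
      (mat_exp (cscale w E) ** D) ** (- (E ** mat_exp (cscale (- w) E)))) w"
    unfolding exp_conj_def
    by (intro has_mat_deriv_mult has_mat_deriv_mat_exp has_mat_deriv_mat_exp_minus has_mat_deriv_const)
  then show ?thesis
    by (simp add: exp_conj_def comm_def matrix_mult_zero matrix_mult_minus matrix_mult_diff matrix_mul_assoc)
qed

lemma exp_conj_0: "exp_conj E D 0 = D"
  by (simp add: exp_conj_def mat_exp_zero)

lemma exp_conj_fixed:
  assumes "comm E D = 0" shows "exp_conj E D w = D"
proof -
  have "has_mat_deriv (exp_conj E D) 0 z" for z
    using has_mat_deriv_exp_conj[of E D z] assms by (simp add: exp_conj_def matrix_mult_zero)
  then have "exp_conj E D w = exp_conj E D 0" by (rule has_mat_deriv_zero_UNIV)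
  then show ?thesis by (simp add: exp_conj_0)
qed

text \<open>The identity matrix commutes with E, so its conjugate by the exponential does not change
  with w; this replaces an addition theorem for the exponential.\<close>

lemma mat_exp_inverse: "mat_exp (cscale w E) ** mat_exp (cscale (- w) E) = mat 1"
  using exp_conj_fixed[of E "mat 1" w] by (simp add: exp_conj_def comm_def)

lemma comm_exp_conj: "comm E (exp_conj E D w) = exp_conj E (comm E D) w"
proof -
  let ?X = "mat_exp (cscale w E)" and ?Y = "mat_exp (cscale (- w) E)"
  have "E ** (?X ** D ** ?Y) = ?X ** (E ** D) ** ?Y"
    by (metis matrix_mul_assoc mat_exp_commute)
  moreover have "?X ** D ** ?Y ** E = ?X ** (D ** E) ** ?Y"
    by (metis matrix_mul_assoc mat_exp_commute)
  ultimately show ?thesis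
    by (simp add: comm_def exp_conj_def matrix_mult_diff)
qed

text \<open>Multiplication by the integrating factor exp(-\<mu> w) gives a function with zero
  derivative, and its value at w = 0 is D.\<close>

lemma exp_conj_eigen:
  assumes "comm E D = cscale \<mu> D" shows "exp_conj E D w = cscale (exp (\<mu> * w)) D"
proof -
  have comm: "exp_conj E (cscale c D) z = cscale c (exp_conj E D z)" for c z
    by (simp add: exp_conj_def cscale_mult)
  have "has_mat_deriv (\<lambda>w. cscale (exp (- \<mu> * w)) (exp_conj E D w)) 0 z" for z
    unfolding has_mat_deriv_def
  proof (intro allI)
    fix i j
    have "((\<lambda>w. exp_conj E D w $ i $ j) has_field_derivative \<mu> * exp_conj E D z $ i $ j) (at z)"
      using has_mat_deriv_exp_conj[of E D z] unfolding assms comm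
      by (simp add: has_mat_deriv_def cscale_def)
    then have "((\<lambda>w. exp (- \<mu> * w) * exp_conj E D w $ i $ j) has_field_derivative 0) (at z)"
      by (auto intro!: derivative_eq_intros)
    then show "((\<lambda>w. cscale (exp (- \<mu> * w)) (exp_conj E D w) $ i $ j) has_field_derivative 0 $ i $ j) (at z)"
      by (simp add: cscale_def)
  qed
  then have "cscale (exp (- \<mu> * w)) (exp_conj E D w) = cscale (exp (- \<mu> * 0)) (exp_conj E D 0)"
    by (rule has_mat_deriv_zero_UNIV)
  then have C: "cscale (exp (- \<mu> * w)) (exp_conj E D w) = D"
    by (simp add: exp_conj_0 cscale_def vec_eq_iff)
  then have "cscale (exp (\<mu> * w)) (cscale (exp (- \<mu> * w)) (exp_conj E D w)) = cscale (exp (\<mu> * w)) D"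
    using C by simp
  then show ?thesis
    by (simp add: cscale_def vec_eq_iff mult.assoc[symmetric] exp_add[symmetric])
qed

text \<open>By \<open>exp_conj_fixed\<close> the derivative is the constant ad E D, so the solution
  is affine in w.\<close>

lemma exp_conj_nilpotent:
  assumes "comm E (comm E D) = 0" shows "exp_conj E D w = D + cscale w (comm E D)"
proof -
  have "has_mat_deriv (\<lambda>w. exp_conj E D w - cscale w (comm E D)) 0 z" for z
    unfolding has_mat_deriv_def
  proof (intro allI)
    fix i j
    have "((\<lambda>w. exp_conj E D w $ i $ j) has_field_derivative comm E D $ i $ j) (at z)"
      using has_mat_deriv_exp_conj[of E D z] unfolding exp_conj_fixed[OF assms]
      by (simp add: has_mat_deriv_def)
    then have "((\<lambda>w. exp_conj E D w $ i $ j - w * comm E D $ i $ j) has_field_derivative 0) (at z)"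
      by (auto intro!: derivative_eq_intros)
    then show "((\<lambda>w. (exp_conj E D w - cscale w (comm E D)) $ i $ j) has_field_derivative 0 $ i $ j) (at z)"
      by (simp add: cscale_def)
  qed
  then have "exp_conj E D w - cscale w (comm E D) = exp_conj E D 0 - cscale 0 (comm E D)"
    by (rule has_mat_deriv_zero_UNIV)
  then show ?thesis
    by (simp add: exp_conj_0 cscale_def vec_eq_iff algebra_simps)
qed

section \<open>Non-resonance\<close>

text \<open>The number of iterates exceeds the dimension by one. If they are distinct, they form a
  dependent set; if two coincide, the set has fewer elements, and the relation takes the
  coefficients 1 and -1 instead.\<close>

lemma iterates_dependent:
  fixes f :: "'a::euclidean_space \<Rightarrow> 'a"
  shows "\<exists>q n. (\<exists>k\<le>n. q k \<noteq> (0::real)) \<and> (\<Sum>k\<le>n. q k *\<^sub>R (f ^^ k) v) = 0"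
proof -
  define n where "n = DIM('a)"
  let ?g = "\<lambda>k. (f ^^ k) v"
  show ?thesis
  proof (cases "inj_on ?g {..n}")
    case True
    then have "card (?g ` {..n}) = Suc n" by (simp add: card_image)
    then have "dependent (?g ` {..n})"
      using independent_bound[of "?g ` {..n}"] unfolding n_def by auto
    then obtain u where u: "\<exists>x\<in>?g ` {..n}. u x \<noteq> 0" "(\<Sum>x\<in>?g ` {..n}. u x *\<^sub>R x) = 0"
      by (auto simp: dependent_finite)
    then have "(\<Sum>k\<le>n. u (?g k) *\<^sub>R ?g k) = 0"
      using sum.reindex[OF True, of "\<lambda>x. u x *\<^sub>R x"] by (simp add: o_def)
    with u(1) show ?thesis by (intro exI[of _ "\<lambda>k. u (?g k)"] exI[of _ n]) auto
  next
    case False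
    then obtain i j where ij: "i \<le> n" "j \<le> n" "i \<noteq> j" "?g i = ?g j" by (auto simp: inj_on_def)
    let ?q = "\<lambda>k. if k = i then 1 else if k = j then -1 else (0::real)"
    have "(\<Sum>k\<le>n. ?q k *\<^sub>R ?g k) = (\<Sum>k\<in>{i, j}. ?q k *\<^sub>R ?g k)"
      using ij by (intro sum.mono_neutral_right) auto
    also have "\<dots> = 0" using ij by simp
    finally show ?thesis using ij by (intro exI[of _ ?q] exI[of _ n]) auto
  qed
qed

lemma complex_poly_has_root:
  fixes p :: "complex poly"
  assumes "degree p > 0" shows "\<exists>z. poly p z = 0"
proof -
  have "\<exists>i\<in>{1..degree p}. poly.coeff p i \<noteq> 0"
    using assms by (intro bexI[of _ "degree p"]) auto
  from fundamental_theorem_of_algebra[OF disjI2[OF this]] show ?thesis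
    unfolding poly_altdef by blast
qed

text \<open>A polynomial in f that annihilates v is split into linear factors by the fundamental
  theorem of algebra, and the operators f - \<mu> are applied to v one after another. The complex
  scaling \<open>cs\<close> is a parameter because the type class supplies only the real one, and
  the lemma serves both for vectors and for matrices.\<close>

lemma annihilating_list:
  fixes f :: "'a::euclidean_space \<Rightarrow> 'a" and cs :: "complex \<Rightarrow> 'a \<Rightarrow> 'a"
  assumes vs: "vector_space cs" and real: "\<And>r x. cs (of_real r) x = r *\<^sub>R x"
    and add: "\<And>x y. f (x + y) = f x + f y" and scale: "\<And>c x. f (cs c x) = cs c (f x)"
  shows "\<exists>ls. foldl (\<lambda>x \<mu>. f x - cs \<mu> x) v ls = 0"
proof -
  interpret vector_space cs by (rule vs)
  \<comment> \<open>\<open>ev p n v\<close> is p(f) v, provided that n is at least the degree of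
    p.\<close>
  define ev where "ev p n v = (\<Sum>k\<le>n. cs (poly.coeff p k) ((f ^^ k) v))" for p n v
  have iter: "(f ^^ k) (f x - cs \<mu> x) = (f ^^ Suc k) x - cs \<mu> ((f ^^ k) x)" for k x \<mu>
  proof (induction k)
    case (Suc k)
    have diff: "f (x - y) = f x - f y" for x y using add[of "x - y" y] by simp
    show ?case using Suc by (simp add: diff scale)
  qed simp
  have main: "\<exists>ls. foldl (\<lambda>x \<mu>. f x - cs \<mu> x) v ls = 0" if "p \<noteq> 0" "degree p = n" "ev p n v = 0" for p n v
    using that
  proof (induction n arbitrary: p v)
    case 0
    then have "poly.coeff p 0 \<noteq> 0" by (metis leading_coeff_0_iff)
    with 0 have "v = 0" by (simp add: ev_def scale_eq_0_iff)
    then show ?case by (intro exI[of _ "[]"]) simp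
  next
    case (Suc n)
    then obtain \<mu> where "poly p \<mu> = 0" using complex_poly_has_root[of p] by auto
    then obtain q where q: "p = [:- \<mu>, 1:] * q" by (metis poly_eq_0_iff_dvd dvdE)
    with Suc.prems have q0: "q \<noteq> 0" by auto
    have "degree p = Suc (degree q)" unfolding q using q0 by (subst degree_mult_eq) auto
    then have deg: "degree q = n" using Suc.prems by simp
    then have qn: "poly.coeff q (Suc n) = 0" by (simp add: coeff_eq_0)
    have "p = pCons 0 q - Polynomial.smult \<mu> q" unfolding q by simp
    then have co: "poly.coeff p k = (case k of 0 \<Rightarrow> 0 | Suc k \<Rightarrow> poly.coeff q k) - \<mu> * poly.coeff q k" for k
      by (simp add: coeff_pCons)
    \<comment> \<open>With p = (x - \<mu>) q, shifting the index turns multiplication by x into one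
      more application of f; the top term of the second sum vanishes because q has degree n.\<close>
    have "ev p (Suc n) v = (\<Sum>k\<le>Suc n. cs (case k of 0 \<Rightarrow> 0 | Suc k \<Rightarrow> poly.coeff q k) ((f ^^ k) v))
        - (\<Sum>k\<le>Suc n. cs (poly.coeff q k) (cs \<mu> ((f ^^ k) v)))"
      by (simp add: ev_def co scale_left_diff_distrib sum_subtractf mult.commute del: sum.atMost_Suc)
    also have "\<dots> = (\<Sum>k\<le>n. cs (poly.coeff q k) ((f ^^ Suc k) v))
        - (\<Sum>k\<le>n. cs (poly.coeff q k) (cs \<mu> ((f ^^ k) v)))"
      unfolding sum.atMost_Suc_shift[of "\<lambda>k. cs (case k of 0 \<Rightarrow> 0 | Suc k \<Rightarrow> poly.coeff q k) ((f ^^ k) v)"]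
        sum.atMost_Suc[of "\<lambda>k. cs (poly.coeff q k) (cs \<mu> ((f ^^ k) v))"]
      by (simp add: qn)
    also have "\<dots> = ev q n (f v - cs \<mu> v)"
      by (simp only: ev_def iter scale_right_diff_distrib sum_subtractf)
    finally have "ev q n (f v - cs \<mu> v) = 0" using Suc.prems by simp
    from Suc.IH[OF q0 deg this] obtain ls where
      "foldl (\<lambda>x \<mu>. f x - cs \<mu> x) (f v - cs \<mu> v) ls = 0" by blast
    then show ?case by (intro exI[of _ "\<mu> # ls"]) simp
  qed
  obtain q n where q: "\<exists>k\<le>n. q k \<noteq> (0::real)" "(\<Sum>k\<le>n. q k *\<^sub>R (f ^^ k) v) = 0"
    using iterates_dependent[of f v] by blast
  define p where "p = (\<Sum>k\<le>n. monom (complex_of_real (q k)) k)"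
  have co: "poly.coeff p k = (if k \<le> n then of_real (q k) else 0)" for k
    by (simp add: p_def coeff_sum)
  have "p \<noteq> 0" using q(1) co by (metis coeff_0 of_real_eq_0_iff)
  have deg: "degree p \<le> n" by (rule degree_le) (simp add: co)
  have "ev p (degree p) v = (\<Sum>k\<le>n. cs (poly.coeff p k) ((f ^^ k) v))"
    unfolding ev_def using deg by (intro sum.mono_neutral_left) (auto simp: coeff_eq_0)
  also have "\<dots> = (\<Sum>k\<le>n. q k *\<^sub>R (f ^^ k) v)"
    by (intro sum.cong) (auto simp: co real)
  finally have "ev p (degree p) v = 0" using q(2) by simp
  from main[OF \<open>p \<noteq> 0\<close> refl this] show ?thesis .
qed

text \<open>From E D = D (E + k) the matrix D maps the generalised eigenspace of E for \<mu> into
  that for \<mu> + k, which is zero by non-resonance. The generalised eigenvectors appear as vectors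
  killed by a list of factors E - \<mu>.\<close>

lemma nonresonant_comm_eq_zero:
  fixes E D :: "('n::finite) cmat"
  assumes nr: "nonresonant E" and ED: "comm E D = cscale (of_int k) D" and k: "k \<noteq> 0"
  shows "D = 0"
proof -
  let ?g = "\<lambda>x \<mu>. E *v x - \<mu> *s x"
  have diff: "E *v (x - y) = E *v x - E *v y" "E *v (c *s x) = c *s (E *v x)" for x y c
    by (simp_all add: matrix_vector_mult_diff_distrib vec.scale)
  \<comment> \<open>The factors commute, so the first one may be moved to the end.\<close>
  have commute: "foldl ?g (?g x \<mu>) ls = ?g (foldl ?g x ls) \<mu>" for x \<mu> ls
  proof (induction ls arbitrary: x)
    case (Cons \<nu> ls)
    have "?g (?g x \<mu>) \<nu> = ?g (?g x \<nu>) \<mu>"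
      by (simp add: diff vec_eq_iff algebra_simps)
    then show ?case using Cons[of "?g x \<nu>"] by simp
  qed simp
  have ED': "E ** D = D ** E + cscale (of_int k) D"
    using ED by (simp add: comm_def algebra_simps)
  have Dv: "D *v v = 0" if "foldl ?g v ls = 0" for v ls
    using that
  proof (induction ls arbitrary: v)
    case Nil then show ?case by simp
  next
    case (Cons \<mu> ls)
    show ?case
    proof (cases "eigenvalue_of E \<mu>")
      case True
      \<comment> \<open>By induction D already kills E v - \<mu> v, so D v is an eigenvector for
        \<mu> + k unless it is zero.\<close>
      have "D *v ?g v \<mu> = 0" using Cons by simp
      then have DE: "D *v (E *v v) = \<mu> *s (D *v v)"
        by (simp add: matrix_vector_mult_diff_distrib vec.scale)
      have "E *v (D *v v) = (D ** E + cscale (of_int k) D) *v v"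
        by (simp add: matrix_vector_mul_assoc ED')
      also have "\<dots> = (\<mu> + of_int k) *s (D *v v)"
        using DE by (simp add: matrix_vector_mult_add_rdistrib matrix_vector_mul_assoc[symmetric] vec.scale_left_distrib)
          (simp add: cscale_def matrix_vector_mult_def vec_eq_iff sum_distrib_left mult.assoc)
      finally have "D *v v \<noteq> 0 \<Longrightarrow> eigenvalue_of E (\<mu> + of_int k)"
        unfolding eigenvalue_of_def by blast
      moreover have "\<not> eigenvalue_of E (\<mu> + of_int k)"
        using nr True k unfolding nonresonant_def by (metis add_diff_cancel_left')
      ultimately show ?thesis by blast
    next
      case False
      have "?g (foldl ?g v ls) \<mu> = 0" using Cons.prems commute by simp
      then have "foldl ?g v ls = 0" using False unfolding eigenvalue_of_def by auto
      then show ?thesis by (rule Cons.IH)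
    qed
  qed
  have "\<exists>ls. foldl ?g v ls = 0" for v
  proof (rule annihilating_list)
    show "of_real r *s x = r *\<^sub>R x" for r and x :: "(complex, 'n) vec"
      by (simp add: vec_eq_iff) (simp add: scaleR_conv_of_real)
  qed (simp_all add: vec.vector_space_axioms matrix_vector_right_distrib diff)
  then have "D *v v = 0" for v using Dv by blast
  then show ?thesis by (metis matrix_eq matrix_vector_mult_0)
qed

lemma exp_conj_diff: "exp_conj E (C - D) w = exp_conj E C w - exp_conj E D w"
  and exp_conj_cscale: "exp_conj E (cscale c D) w = cscale c (exp_conj E D w)"
  by (simp_all add: exp_conj_def cscale_mult matrix_mult_diff)

text \<open>The induction peels off one factor of a product of operators \<open>ad E - \<mu>\<close> that annihilates
  \<open>C\<close>; periodicity forces \<open>\<mu>\<close> to be an integer and rules out nilpotent parts.\<close>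

lemma nonresonant_periodic_imp_commute:
  fixes E C :: "('n::finite) cmat"
  assumes nr: "nonresonant E"
    and per: "\<And>w. w \<in> H \<Longrightarrow> exp_conj E C (w + 2 * of_real pi * \<i>) = exp_conj E C w"
    and "H \<noteq> {}"
  shows "comm E C = 0"
proof -
  let ?g = "\<lambda>X \<mu>. comm E X - cscale \<mu> X"
  have add: "comm E (X + Y) = comm E X + comm E Y" and diff: "comm E (X - Y) = comm E X - comm E Y"
    and scale: "comm E (cscale c X) = cscale c (comm E X)" for X Y c
    by (simp_all add: comm_def matrix_mult_add matrix_mult_diff cscale_mult,
        simp add: cscale_def vec_eq_iff algebra_simps)
  obtain w where w: "w \<in> H" using \<open>H \<noteq> {}\<close> by blast
  have "\<exists>ls. foldl ?g C ls = 0"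
  proof (rule annihilating_list)
    show "vector_space (cscale :: complex \<Rightarrow> 'n cmat \<Rightarrow> 'n cmat)"
      by unfold_locales (simp_all add: cscale_def vec_eq_iff algebra_simps)
    show "cscale (of_real r) X = r *\<^sub>R X" for r and X :: "'n cmat"
      by (simp add: cscale_def vec_eq_iff) (simp add: scaleR_conv_of_real)
  qed (rule add scale)+
  then obtain ls where "foldl ?g C ls = 0" ..
  then show ?thesis using per
  proof (induction ls arbitrary: C)
    case Nil then show ?case by (simp add: comm_def matrix_mult_zero)
  next
    case (Cons \<mu> ls)
    define D where "D = comm E C"
    \<comment> \<open>ad E commutes with the conjugation, so D inherits the periodicity of
      C.\<close>
    have perD: "exp_conj E D (w + 2 * of_real pi * \<i>) = exp_conj E D w" if "w \<in> H" for w
      unfolding D_def comm_exp_conj[symmetric] Cons.prems(2)[OF that] ..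
    \<comment> \<open>The induction applies to ad E C - \<mu> C, which the shorter list annihilates
      and which is again periodic. The result makes D an eigenvector of ad E for \<mu>, or
      zero.\<close>
    have "comm E (?g C \<mu>) = 0"
      by (rule Cons.IH) (use Cons.prems perD in \<open>simp_all add: exp_conj_diff exp_conj_cscale D_def\<close>)
    then have D: "comm E D = cscale \<mu> D" by (simp add: diff scale D_def)
    show ?case
    proof (cases "\<mu> = 0")
      case True
      \<comment> \<open>Now the conjugate is C + w D, and over one period it changes by 2 pi i
        D.\<close>
      then have "comm E (comm E C) = 0" using D by (simp add: D_def cscale_def vec_eq_iff)
      from exp_conj_nilpotent[OF this] Cons.prems(2)[OF w]
      have "cscale (w + 2 * of_real pi * \<i>) D = cscale w D" by (simp add: D_def)
      then show ?thesis by (simp add: D_def[symmetric] cscale_def vec_eq_iff)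
    next
      case False
      have "D = 0"
      proof (rule ccontr)
        assume "D \<noteq> 0"
        have "cscale (exp (\<mu> * (w + 2 * of_real pi * \<i>))) D = cscale (exp (\<mu> * w)) D"
          using perD[OF w] unfolding exp_conj_eigen[OF D] .
        then have "exp (\<mu> * (w + 2 * of_real pi * \<i>)) = exp (\<mu> * w)"
          using \<open>D \<noteq> 0\<close> by (auto simp: cscale_def vec_eq_iff)
        then have "exp (\<mu> * (2 * of_real pi * \<i>)) = 1"
          by (simp add: distrib_left exp_add)
        then obtain n :: int where "Re (\<mu> * (2 * of_real pi * \<i>)) = 0" "Im (\<mu> * (2 * of_real pi * \<i>)) = of_int (2 * n) * pi"
          unfolding exp_eq_1 by blast
        then have "\<mu> = of_int n" by (auto simp: complex_eq_iff)
        then show False using nonresonant_comm_eq_zero[OF nr, of D n] D False \<open>D \<noteq> 0\<close> by auto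
      qed
      then show ?thesis by (simp add: D_def)
    qed
  qed
qed

section \<open>Local behaviour and growth\<close>

lemma removable_at_nonresonant:
  fixes E C1 C2 :: "('n::finite) cmat"
  assumes nr: "nonresonant E" and r: "r > 0"
    and Z1: "mat_analytic Z1 (ball a r)" "\<And>z. z \<in> ball a r \<Longrightarrow> invertible (Z1 z)"
    and Z2: "mat_analytic Z2 (ball a r)" "\<And>z. z \<in> ball a r \<Longrightarrow> invertible (Z2 z)"
    and C: "invertible C1" "invertible C2"
    and eq: "\<And>w. Re w < ln r \<Longrightarrow> U (a + exp w) ** (Z1 (a + exp w) ** mat_exp (cscale w E) ** C1)
      = Z2 (a + exp w) ** mat_exp (cscale w E) ** C2"
  obtains G where "mat_analytic G (ball a r)" "\<And>z. z \<in> ball a r \<Longrightarrow> invertible (G z)"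
    "\<And>z. z \<in> ball a r - {a} \<Longrightarrow> U z = G z"
proof -
  define C where "C = C2 ** matrix_inv C1"
  have invC: "invertible C"
    unfolding C_def using C by (simp add: invertible_mat_mult invertible_mat_inv)
  have ball: "a + exp w \<in> ball a r" if "Re w < ln r" for w
    using that r by (simp add: dist_norm) (metis exp_less_cancel_iff exp_ln)
  \<comment> \<open>The right-hand side depends on w only through z = a + exp w, so the conjugate of
    C has period 2 pi i.\<close>
  have conj: "exp_conj E C w = matrix_inv (Z2 (a + exp w)) ** U (a + exp w) ** Z1 (a + exp w)"
    if "Re w < ln r" for w
  proof -
    let ?X = "mat_exp (cscale w E)" and ?Y = "mat_exp (cscale (- w) E)" and ?z = "a + exp w"
    have inv: "invertible (Z1 ?z)" "invertible (Z2 ?z)" using Z1 Z2 ball that by auto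
    have "?X ** C2 = matrix_inv (Z2 ?z) ** (Z2 ?z ** ?X ** C2)"
      by (simp add: matrix_cancel(1)[OF inv(2)] matrix_mul_assoc[symmetric])
    also have "\<dots> = matrix_inv (Z2 ?z) ** (U ?z ** (Z1 ?z ** ?X ** C1))"
      by (simp add: eq[OF that])
    finally have "?X ** C2 ** matrix_inv C1 ** ?Y
        = matrix_inv (Z2 ?z) ** U ?z ** Z1 ?z ** ?X ** C1 ** matrix_inv C1 ** ?Y"
      by (simp add: matrix_mul_assoc)
    also have "\<dots> = matrix_inv (Z2 ?z) ** U ?z ** Z1 ?z ** (?X ** ?Y)"
      by (simp only: matrix_cancel(3)[OF C(1)] matrix_mul_assoc)
    finally show ?thesis
      by (simp add: exp_conj_def C_def matrix_mul_assoc mat_exp_inverse)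
  qed
  have "comm E C = 0"
  proof (rule nonresonant_periodic_imp_commute[OF nr, of "{w. Re w < ln r}"])
    fix w assume w: "w \<in> {w. Re w < ln r}"
    have "exp (w + 2 * of_real pi * \<i>) = exp w" by (simp add: exp_add)
    then show "exp_conj E C (w + 2 * of_real pi * \<i>) = exp_conj E C w"
      using w conj[of w] conj[of "w + 2 * of_real pi * \<i>"] by simp
  next
    have "of_real (ln r - 1) \<in> {w. Re w < ln r}" by simp
    then show "{w. Re w < ln r} \<noteq> {}" by blast
  qed
  then have C_eq: "exp_conj E C w = C" for w by (rule exp_conj_fixed)
  \<comment> \<open>With C commuting with E the factors (z - a)^E cancel; what is left is analytic
    at a itself.\<close>
  let ?G = "\<lambda>z. Z2 z ** C ** matrix_inv (Z1 z)"
  show ?thesis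
  proof (rule that[of ?G])
    show "mat_analytic ?G (ball a r)"
      using Z1 Z2 by (intro mat_analytic_mult mat_analytic_inv mat_analytic_const) auto
    show "invertible (?G z)" if "z \<in> ball a r" for z
      using Z1 Z2 invC that by (intro invertible_mat_mult invertible_mat_inv) auto
    fix z assume z: "z \<in> ball a r - {a}"
    define w where "w = Ln (z - a)"
    have zw: "z = a + exp w" using z by (simp add: w_def)
    have "ln (cmod (z - a)) < ln r" using z r by (subst ln_less_cancel_iff) (auto simp: dist_norm norm_minus_commute)
    then have "Re w < ln r" using z by (simp add: w_def)
    note conj[OF this, folded zw, unfolded C_eq]
    moreover have inv: "invertible (Z1 z)" "invertible (Z2 z)" using Z1 Z2 z by auto
    ultimately have "?G z = Z2 z ** (matrix_inv (Z2 z) ** (U z ** (Z1 z ** matrix_inv (Z1 z))))"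
      by (simp add: matrix_mul_assoc)
    then show "U z = ?G z"
      by (simp add: matrix_cancel(2)[OF inv(2)] matrix_inv_right[OF inv(1)])
  qed
qed

section \<open>Growth at infinity and polynomial entries\<close>

lemma diag_powers_mult_nth:
  fixes H :: "('n::finite) cmat"
  shows "(diag_powers \<kappa> z ** H) $ i $ j = z powi \<kappa> i * H $ i $ j"
    and "(H ** diag_powers \<kappa> z) $ i $ j = H $ i $ j * z powi \<kappa> j"
  by (simp_all add: diag_powers_def matrix_matrix_mult_def if_distrib[of "\<lambda>x. x * _"] if_distrib[of "\<lambda>x. _ * x"]
      cong: if_cong)

text \<open>The matrix H gathers all factors between the two diagonal matrices. It is bounded on the
  closed disc of half the radius, whence B and R = 2/\<delta>.\<close>

lemma growth_at_infinity:
  fixes W1 W2 :: "complex \<Rightarrow> ('n::finite) cmat" and C1 C2 :: "'n cmat"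
  assumes "\<delta> > 0"
    and W1: "mat_analytic W1 (ball 0 \<delta>)" "\<And>u. u \<in> ball 0 \<delta> \<Longrightarrow> invertible (W1 u)"
    and W2: "mat_analytic W2 (ball 0 \<delta>)"
    and C: "invertible C1"
    and eq: "\<And>z. cmod z > 1 / \<delta> \<Longrightarrow> U z ** (diag_powers \<kappa>1 z ** W1 (1 / z) ** C1)
      = diag_powers \<kappa>2 z ** W2 (1 / z) ** C2"
  shows "\<exists>B R. R > 0 \<and> (\<forall>z. cmod z \<ge> R \<longrightarrow> cmod (U z $ i $ j) \<le> B * cmod z powi (\<kappa>2 i - \<kappa>1 j))"
proof -
  define H where "H u = W2 u ** C2 ** matrix_inv C1 ** matrix_inv (W1 u)" for u
  have "mat_analytic H (ball 0 \<delta>)"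
    unfolding H_def using W1 W2 by (intro mat_analytic_mult mat_analytic_inv mat_analytic_const) auto
  then have "continuous_on (ball 0 \<delta>) (\<lambda>u. H u $ i $ j)"
    by (simp add: mat_analytic_nth analytic_imp_holomorphic holomorphic_on_imp_continuous_on)
  then have "continuous_on (cball 0 (\<delta> / 2)) (\<lambda>u. H u $ i $ j)"
    by (rule continuous_on_subset) (use \<open>\<delta> > 0\<close> in auto)
  then have "bounded ((\<lambda>u. H u $ i $ j) ` cball 0 (\<delta> / 2))"
    by (intro compact_imp_bounded compact_continuous_image) auto
  then obtain B where B: "\<And>u. u \<in> cball 0 (\<delta> / 2) \<Longrightarrow> cmod (H u $ i $ j) \<le> B"
    unfolding bounded_iff by (metis imageI)
  have "cmod (U z $ i $ j) \<le> B * cmod z powi (\<kappa>2 i - \<kappa>1 j)" if z: "cmod z \<ge> 2 / \<delta>" for z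
  proof -
    have z0: "z \<noteq> 0" using z \<open>\<delta> > 0\<close> by (metis divide_pos_pos norm_zero not_le zero_less_numeral)
    have "1 / \<delta> < 2 / \<delta>" using \<open>\<delta> > 0\<close> by (simp add: divide_strict_right_mono)
    then have z1: "cmod z > 1 / \<delta>" using z by linarith
    have u: "1 / z \<in> cball 0 (\<delta> / 2)"
      using z z0 \<open>\<delta> > 0\<close> by (simp add: norm_divide field_simps)
    then have u': "1 / z \<in> ball 0 \<delta>" using \<open>\<delta> > 0\<close> by auto
    note inv = W1(2)[OF u']
    have "U z ** diag_powers \<kappa>1 z
        = U z ** (diag_powers \<kappa>1 z ** W1 (1 / z) ** C1) ** matrix_inv C1 ** matrix_inv (W1 (1 / z))"
      by (simp add: matrix_mul_assoc matrix_cancel[OF inv] matrix_cancel[OF C])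
    also have "\<dots> = diag_powers \<kappa>2 z ** H (1 / z)"
      unfolding eq[OF z1] by (simp add: H_def matrix_mul_assoc)
    finally have "(U z ** diag_powers \<kappa>1 z) $ i $ j = (diag_powers \<kappa>2 z ** H (1 / z)) $ i $ j"
      by simp
    then have "U z $ i $ j * z powi \<kappa>1 j = z powi \<kappa>2 i * H (1 / z) $ i $ j"
      by (simp add: diag_powers_mult_nth)
    then have "U z $ i $ j = z powi (\<kappa>2 i - \<kappa>1 j) * H (1 / z) $ i $ j"
      using z0 by (simp add: power_int_diff field_simps)
    then have "cmod (U z $ i $ j) = cmod z powi (\<kappa>2 i - \<kappa>1 j) * cmod (H (1 / z) $ i $ j)"
      by (simp add: norm_mult norm_power_int)
    also have "\<dots> \<le> cmod z powi (\<kappa>2 i - \<kappa>1 j) * B"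
      by (intro mult_left_mono B u) auto
    finally show ?thesis by (simp add: mult.commute)
  qed
  then show ?thesis using \<open>\<delta> > 0\<close> by (intro exI[of _ B] exI[of _ "2 / \<delta>"]) simp
qed

lemma entire_growth_powi:
  assumes f: "f holomorphic_on UNIV"
    and growth: "\<And>z. cmod z \<ge> R \<Longrightarrow> cmod (f z) \<le> B * cmod z powi k"
  shows "k < 0 \<Longrightarrow> f z = 0"
    and "k \<ge> 0 \<Longrightarrow> f z = (\<Sum>r\<le>nat k. (deriv ^^ r) f 0 / fact r * z ^ r)"
proof -
  assume "k < 0"
  have "(f \<longlongrightarrow> 0) at_infinity"
  proof (rule Lim_null_comparison)
    \<comment> \<open>For |z| >= 1 every negative power of |z| is at most its power -1. The modulus
      of B guards against a negative constant.\<close>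
    have "eventually (\<lambda>z::complex. cmod z \<ge> max R 1) at_infinity"
      unfolding eventually_at_infinity by blast
    then show "eventually (\<lambda>z. norm (f z) \<le> \<bar>B\<bar> * norm (inverse z)) at_infinity"
    proof eventually_elim
      fix z :: complex assume z: "max R 1 \<le> cmod z"
      have "cmod (f z) \<le> B * cmod z powi k" using growth z by simp
      also have "\<dots> \<le> \<bar>B\<bar> * cmod z powi k" by (intro mult_right_mono) auto
      also have "\<dots> \<le> \<bar>B\<bar> * cmod z powi (-1)"
        using z \<open>k < 0\<close> by (intro mult_left_mono power_int_increasing) auto
      finally show "norm (f z) \<le> \<bar>B\<bar> * norm (inverse z)" by (simp add: norm_inverse)
    qed
    show "((\<lambda>z::complex. \<bar>B\<bar> * norm (inverse z)) \<longlongrightarrow> 0) at_infinity"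
      using tendsto_mult_right_zero[OF tendsto_norm_zero[OF tendsto_inverse_0]] by blast
  qed
  then show "f z = 0" by (rule Liouville_weak_0[OF f])
next
  assume "k \<ge> 0"
  show "f z = (\<Sum>r\<le>nat k. (deriv ^^ r) f 0 / fact r * z ^ r)"
  proof (rule Liouville_polynomial[OF f])
    fix z assume "R \<le> cmod z"
    from growth[OF this] show "cmod (f z) \<le> B * cmod z ^ nat k"
      using \<open>k \<ge> 0\<close> by (simp add: power_int_def)
  qed
qed

text \<open>Pigeonhole: a permutation cannot map the rows from p on into the columns beyond p, of
  which there is one fewer. Hence every term of the Leibniz formula contains a vanishing
  factor.\<close>

lemma det_zero_block:
  fixes V :: "('n::{finite,linorder}) cmat"
  assumes "\<And>i j. p \<le> i \<Longrightarrow> j \<le> p \<Longrightarrow> V $ i $ j = 0"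
  shows "det V = 0"
  unfolding det_def
proof (rule sum.neutral, safe)
  fix \<pi> :: "'n \<Rightarrow> 'n" assume "\<pi> permutes UNIV"
  then have bij: "bij \<pi>" by (rule permutes_bij)
  have "\<exists>i. p \<le> i \<and> \<pi> i \<le> p"
  proof (rule ccontr)
    assume "\<not> ?thesis"
    then have "\<pi> ` {p..} \<subseteq> {p<..}" by force
    then have "card (\<pi> ` {p..}) \<le> card {p<..}" by (intro card_mono) auto
    moreover have "card (\<pi> ` {p..}) = card {p..}"
      using bij by (intro card_image) (auto simp: bij_def inj_on_def)
    moreover have "card {p<..} < card {p..}" by (intro psubset_card_mono) auto
    ultimately show False by simp
  qed
  then obtain i where "V $ i $ \<pi> i = 0" using assms by blast
  then have "prod (\<lambda>i. V $ i $ \<pi> i) UNIV = 0" by (intro prod_zero) auto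
  then show "of_int (sign \<pi>) * prod (\<lambda>i. V $ i $ \<pi> i) UNIV = 0" by simp
qed

lemma indices_le:
  fixes V :: "('n::{finite,linorder}) cmat" and \<kappa>1 \<kappa>2 :: "'n \<Rightarrow> int"
  assumes "antimono \<kappa>1" "antimono \<kappa>2" "invertible V"
    and zero: "\<And>i j. \<kappa>2 i < \<kappa>1 j \<Longrightarrow> V $ i $ j = 0"
  shows "\<kappa>1 p \<le> \<kappa>2 p"
proof (rule ccontr)
  assume less: "\<not> \<kappa>1 p \<le> \<kappa>2 p"
  \<comment> \<open>The two monotonicities give \<kappa>2 i <= \<kappa>2 p < \<kappa>1 p <=
    \<kappa>1 j.\<close>
  have "V $ i $ j = 0" if "p \<le> i" "j \<le> p" for i j
    using antimonoD[OF assms(2) that(1)] antimonoD[OF assms(1) that(2)] less by (intro zero) simp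
  then have "det V = 0" by (rule det_zero_block)
  then show False using assms(3) by (simp add: invertible_det_nz)
qed

text \<open>Degree 0 makes the diagonal blocks constant. Since U and its inverse both vanish below
  the block diagonal, the diagonal blocks of the inverse invert those of U.\<close>

lemma block_form_if_growth:
  fixes U :: "complex \<Rightarrow> ('n::finite) cmat" and \<kappa> :: "'n \<Rightarrow> int"
  assumes hol: "mat_analytic U UNIV" and inv: "\<And>z. invertible (U z)"
    and gU: "\<And>i j. \<exists>B R. \<forall>z. cmod z \<ge> R \<longrightarrow> cmod (U z $ i $ j) \<le> B * cmod z powi (\<kappa> i - \<kappa> j)"
    and zV: "\<And>z i j. \<kappa> i < \<kappa> j \<Longrightarrow> matrix_inv (U z) $ i $ j = 0"
    and blocks: "index_blocks \<kappa> K \<kappa>b l"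
  shows "block_form \<kappa> K \<kappa>b U"
proof -
  have hol': "(\<lambda>z. U z $ i $ j) holomorphic_on UNIV" for i j
    using mat_analytic_nth[OF hol] by (rule analytic_imp_holomorphic)
  have zero: "U z $ i $ j = 0" if "\<kappa> i < \<kappa> j" for z i j
    using gU[of i j] entire_growth_powi(1)[OF hol', of _ i j _ "\<kappa> i - \<kappa> j" z] that
    by auto
  \<comment> \<open>The Taylor coefficients of U at 0; one family serves all blocks.\<close>
  define Q where "Q r = (\<chi> i j. (deriv ^^ r) (\<lambda>z. U z $ i $ j) 0 / fact r)" for r
  have poly: "U z $ i $ j = (\<Sum>r\<le>nat (\<kappa> i - \<kappa> j). Q r $ i $ j * z ^ r)"
    if "\<kappa> j \<le> \<kappa> i" for z i j
  proof -
    obtain B R where "\<And>z. cmod z \<ge> R \<Longrightarrow> cmod (U z $ i $ j) \<le> B * cmod z powi (\<kappa> i - \<kappa> j)"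
      using gU[of i j] by blast
    from entire_growth_powi(2)[OF hol' this] that show ?thesis by (simp add: Q_def)
  qed
  have dec: "\<kappa>b i > \<kappa>b j" if "i \<in> {1..K}" "j \<in> {1..K}" "i < j" for i j
    using blocks that by (auto simp: index_blocks_def)
  show ?thesis
    unfolding block_form_def
  proof (intro conjI exI[of _ "U 0"] exI[of _ Q] allI ballI impI)
    show "invertible (U z)" for z by (rule inv)
    show "block_invertible {p. \<kappa> p = \<kappa>b j} (U 0)" for j
      unfolding block_invertible_def
    proof (intro exI[of _ "matrix_inv (U 0)"] ballI conjI)
      fix p q assume pq: "p \<in> {p. \<kappa> p = \<kappa>b j}" "q \<in> {p. \<kappa> p = \<kappa>b j}"
      \<comment> \<open>A term with s outside the block has a zero factor: \<open>U 0\<close> at (p,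
        s) if \<kappa> s > \<kappa> p, the inverse at (s, q) if \<kappa> s < \<kappa> q.\<close>
      have "(\<Sum>s\<in>{p. \<kappa> p = \<kappa>b j}. U 0 $ p $ s * matrix_inv (U 0) $ s $ q) = (U 0 ** matrix_inv (U 0)) $ p $ q"
        unfolding matrix_matrix_mult_def vec_lambda_beta
        by (rule sum.mono_neutral_left) (use pq in \<open>auto simp: linorder_neq_iff zero zV\<close>)
      then show "(\<Sum>s\<in>{p. \<kappa> p = \<kappa>b j}. U 0 $ p $ s * matrix_inv (U 0) $ s $ q) = (if p = q then 1 else 0)"
        by (simp add: matrix_inv_right[OF inv] mat_def)
      have "(\<Sum>s\<in>{p. \<kappa> p = \<kappa>b j}. matrix_inv (U 0) $ p $ s * U 0 $ s $ q) = (matrix_inv (U 0) ** U 0) $ p $ q"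
        unfolding matrix_matrix_mult_def vec_lambda_beta
        by (rule sum.mono_neutral_left) (use pq in \<open>auto simp: linorder_neq_iff zero zV\<close>)
      then show "(\<Sum>s\<in>{p. \<kappa> p = \<kappa>b j}. matrix_inv (U 0) $ p $ s * U 0 $ s $ q) = (if p = q then 1 else 0)"
        by (simp add: matrix_inv_left[OF inv] mat_def)
    qed
    fix z i j p q assume ij: "i \<in> {1..K}" "j \<in> {1..K}" and pq: "\<kappa> p = \<kappa>b i" "\<kappa> q = \<kappa>b j"
    consider "i = j" | "i < j" | "j < i" by linarith
    then show "U z $ p $ q = (if i = j then U 0 $ p $ q
      else if i < j then (\<Sum>r=0..nat (\<kappa>b i - \<kappa>b j). Q r $ p $ q * z ^ r) else 0)"
    proof cases
      case 1
      then show ?thesis using poly[of q p z] poly[of q p 0] pq by simp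
    next
      case 2
      then show ?thesis using poly[of q p z] pq dec[OF ij] by (simp add: atMost_atLeast0)
    next
      case 3
      then show ?thesis using zero[of p q z] pq dec[OF ij(2,1)] by simp
    qed
  qed
qed

text \<open>The blocks are disjoint and their sizes add up to the number of all indices, so that the
  block formulas reach every entry of V.\<close>

lemma block_form_analytic:
  fixes \<kappa> :: "'a::finite \<Rightarrow> int"
  assumes blocks: "index_blocks \<kappa> K \<kappa>b l" and V: "block_form \<kappa> K \<kappa>b V"
  shows "mat_analytic V UNIV"
proof -
  obtain D Q where VQ: "\<And>z i j p q. i \<in> {1..K} \<Longrightarrow> j \<in> {1..K} \<Longrightarrow> \<kappa> p = \<kappa>b i \<Longrightarrow> \<kappa> q = \<kappa>b j \<Longrightarrow>
           V z $ p $ q =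
             (if i = j then D $ p $ q
              else if i < j then (\<Sum>r=0..nat (\<kappa>b i - \<kappa>b j). Q r $ p $ q * z ^ r)
              else 0)"
    using V unfolding block_form_def by blast
  have ne: "\<kappa>b i \<noteq> \<kappa>b j" if "i \<in> {1..K}" "j \<in> {1..K}" "i \<noteq> j" for i j
    using blocks that unfolding index_blocks_def by (metis linorder_neq_iff less_irrefl)
  have "card (\<Union>j\<in>{1..K}. {p. \<kappa> p = \<kappa>b j}) = (\<Sum>j=1..K. card {p. \<kappa> p = \<kappa>b j})"
    by (rule card_UN_disjoint) (use ne in auto)
  also have "\<dots> = CARD('a)" using blocks by (simp add: index_blocks_def)
  finally have cover: "(\<Union>j\<in>{1..K}. {p. \<kappa> p = \<kappa>b j}) = UNIV"
    by (intro card_subset_eq) auto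
  show ?thesis
    unfolding mat_analytic_def
  proof (intro allI)
    fix p q
    obtain i j where ij: "i \<in> {1..K}" "j \<in> {1..K}" "\<kappa> p = \<kappa>b i" "\<kappa> q = \<kappa>b j"
      using cover by blast
    show "(\<lambda>z. V z $ p $ q) analytic_on UNIV"
      unfolding VQ[OF ij] by (cases "i = j"; cases "i < j") (auto intro!: analytic_intros)
  qed
qed

section \<open>Charts of the Riemann sphere\<close>

lemma sphere_prod_iff: "x \<in> sphere 0 1 \<longleftrightarrow> (cmod (fst x))\<^sup>2 + (snd x)\<^sup>2 = 1" for x :: "complex \<times> real"
  by (cases x) (simp add: dist_norm norm_Pair)

lemma norm_sq_plus1: "(cmod z)\<^sup>2 + 1 > 0" "(cmod z)\<^sup>2 + 1 \<noteq> 0"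
  by (simp_all add: add_nonneg_pos) (metis add_nonneg_pos less_irrefl zero_le_power2 zero_less_one)

lemma to_sphere_in_sphere: "to_sphere z \<in> sphere 0 1"
proof -
  have "(cmod (fst (to_sphere z)))\<^sup>2 + (snd (to_sphere z))\<^sup>2
      = (4 * (cmod z)\<^sup>2 + ((cmod z)\<^sup>2 - 1)\<^sup>2) / ((cmod z)\<^sup>2 + 1)\<^sup>2"
    by (simp add: to_sphere_def norm_mult power_mult_distrib power_divide add_divide_distrib
        del: of_real_divide of_real_add of_real_power)
  also have "4 * (cmod z)\<^sup>2 + ((cmod z)\<^sup>2 - 1)\<^sup>2 = ((cmod z)\<^sup>2 + 1)\<^sup>2"
    by (simp add: power2_eq_square algebra_simps)
  finally show ?thesis unfolding sphere_prod_iff using norm_sq_plus1[of z] by simp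
qed

lemma snd_to_sphere: "1 - snd (to_sphere z) = 2 / ((cmod z)\<^sup>2 + 1)"
  using norm_sq_plus1[of z] by (simp add: to_sphere_def field_simps)

lemma from_to_sphere: "from_sphere (to_sphere z) = z"
proof -
  have "from_sphere (to_sphere z) = of_real (2 / ((cmod z)\<^sup>2 + 1)) * z / of_real (2 / ((cmod z)\<^sup>2 + 1))"
    unfolding from_sphere_def snd_to_sphere by (simp add: to_sphere_def)
  moreover have "complex_of_real (2 / ((cmod z)\<^sup>2 + 1)) \<noteq> 0"
    using norm_sq_plus1[of z] by (simp only: of_real_eq_0_iff) simp
  ultimately show ?thesis by (simp del: of_real_divide)
qed

lemma to_sphere_eq_iff: "to_sphere z = to_sphere w \<longleftrightarrow> z = w"
  by (metis from_to_sphere)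

lemma to_sphere_neq_inf: "to_sphere z \<noteq> sphere_inf"
  using snd_to_sphere[of z] norm_sq_plus1[of z] by (auto simp: sphere_inf_def)

lemma sphere_snd_eq_1: "x \<in> sphere 0 1 \<Longrightarrow> snd x = 1 \<longleftrightarrow> x = sphere_inf"
  unfolding sphere_prod_iff sphere_inf_def by (cases x) auto

lemma sphere_inf_in_sphere: "sphere_inf \<in> sphere 0 1"
  unfolding sphere_prod_iff sphere_inf_def by simp

lemma to_from_sphere:
  assumes "x \<in> sphere 0 1" "x \<noteq> sphere_inf"
  shows "to_sphere (from_sphere x) = x"
proof -
  obtain f h where x: "x = (f, h)" by force
  have h1: "h \<noteq> 1" using sphere_snd_eq_1[OF assms(1)] assms(2) x by simp
  have fh: "(cmod f)\<^sup>2 = (1 - h) * (1 + h)"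
    using assms(1) unfolding sphere_prod_iff x by (simp add: power2_eq_square algebra_simps)
  have "(cmod (from_sphere x))\<^sup>2 = (cmod f)\<^sup>2 / (1 - h)\<^sup>2"
    by (simp add: from_sphere_def x norm_divide power_divide del: of_real_diff)
  also have "\<dots> = (1 + h) / (1 - h)"
    unfolding fh using h1 by (simp add: power2_eq_square)
  finally have n: "(cmod (from_sphere x))\<^sup>2 = (1 + h) / (1 - h)" .
  have n1: "(cmod (from_sphere x))\<^sup>2 + 1 = 2 / (1 - h)" and n2: "(cmod (from_sphere x))\<^sup>2 - 1 = 2 * h / (1 - h)"
    unfolding n using h1 by (simp_all add: field_simps)
  have "complex_of_real (1 - h) \<noteq> 0" using h1 by (metis of_real_eq_0_iff right_minus_eq)
  moreover have "to_sphere (from_sphere x) = (of_real (1 - h) * (f / of_real (1 - h)), h)"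
    unfolding to_sphere_def n1 n2 using h1 by (simp add: from_sphere_def x)
  ultimately show ?thesis using x by simp
qed

lemma continuous_on_to_sphere: "continuous_on A to_sphere"
  unfolding to_sphere_def using norm_sq_plus1 by (intro continuous_intros) auto

lemma continuous_on_from_sphere: "(\<And>x. x \<in> A \<Longrightarrow> snd x \<noteq> 1) \<Longrightarrow> continuous_on A from_sphere"
  unfolding from_sphere_def by (intro continuous_intros) (auto simp: of_real_eq_1_iff[symmetric])

text \<open>The coordinate \<open>u = 1/(z - c)\<close> on the sphere without \<open>c\<close>.\<close>

definition chart :: "complex \<Rightarrow> complex \<Rightarrow> complex \<times> real" where
  "chart c u = (if u = 0 then sphere_inf else to_sphere (c + 1 / u))"

definition chart_inv :: "complex \<Rightarrow> complex \<times> real \<Rightarrow> complex" where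
  "chart_inv c x = (if x = sphere_inf then 0 else 1 / (from_sphere x - c))"

lemma chart_inv_chart: "chart_inv c (chart c u) = u"
  by (simp add: chart_def chart_inv_def to_sphere_neq_inf from_to_sphere)

lemma chart_chart_inv: "x \<in> sphere 0 1 - {to_sphere c} \<Longrightarrow> chart c (chart_inv c x) = x"
  using to_from_sphere[of x] by (auto simp: chart_def chart_inv_def)

lemma chart_in: "chart c u \<in> sphere 0 1 - {to_sphere c}"
  using to_sphere_in_sphere sphere_inf_in_sphere to_sphere_neq_inf[of c]
  by (auto simp: chart_def to_sphere_eq_iff simp del: mem_sphere)

text \<open>Inversion z = 1/v acts on the sphere by conjugating the horizontal part and changing the
  sign of the height. The right-hand side still makes sense at v = 0 and gives the north pole there,
  which yields continuity of the chart at infinity.\<close>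

lemma to_sphere_inverse:
  assumes "v \<noteq> 0"
  shows "to_sphere (1 / v) = (of_real (2 / ((cmod v)\<^sup>2 + 1)) * cnj v, (1 - (cmod v)\<^sup>2) / ((cmod v)\<^sup>2 + 1))"
proof -
  define n where "n = (cmod v)\<^sup>2"
  have n: "n > 0" using assms by (simp add: n_def)
  have nv: "of_real n = v * cnj v" unfolding n_def by (rule complex_norm_square)
  have "(cmod (1 / v))\<^sup>2 = 1 / n" by (simp add: n_def norm_divide power_divide)
  moreover have "of_real (2 / (1 / n + 1)) * (1 / v) = of_real (2 / (n + 1)) * cnj v"
  proof -
    have "2 / (1 / n + 1) = 2 / (n + 1) * n" using n by (simp add: field_simps)
    then have "of_real (2 / (1 / n + 1)) * (1 / v) = of_real (2 / (n + 1)) * (of_real n * (1 / v))"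
      by (metis mult.assoc of_real_mult)
    then show ?thesis using assms by (simp add: nv)
  qed
  moreover have "(1 / n - 1) / (1 / n + 1) = (1 - n) / (n + 1)"
  proof -
    have "1 / n - 1 = (1 - n) / n" "1 / n + 1 = (n + 1) / n" using n by (simp_all add: field_simps)
    then show ?thesis using n by simp
  qed
  ultimately show ?thesis by (simp add: to_sphere_def flip: n_def)
qed

lemma continuous_on_chart: "continuous_on A (chart c)"
proof -
  have 1: "continuous_on {u. u \<noteq> 0} (chart c)"
  proof (rule continuous_on_eq)
    show "continuous_on {u. u \<noteq> 0} (\<lambda>u. to_sphere (c + 1 / u))"
      by (intro continuous_on_compose2[OF continuous_on_to_sphere[of UNIV]] continuous_intros) auto
  qed (simp add: chart_def)
  \<comment> \<open>Near u = 0 one has c + 1/u = 1/v with v = u/(1 + c u), and the formula of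
    \<open>to_sphere_inverse\<close> has no singularity there. The two open sets cover the
    plane.\<close>
  have 2: "continuous_on {u. 1 + c * u \<noteq> 0} (chart c)"
  proof (rule continuous_on_eq)
    let ?f = "\<lambda>v. (of_real (2 / ((cmod v)\<^sup>2 + 1)) * cnj v, (1 - (cmod v)\<^sup>2) / ((cmod v)\<^sup>2 + 1))"
    have "continuous_on UNIV ?f"
      using norm_sq_plus1 by (intro continuous_intros) auto
    then show "continuous_on {u. 1 + c * u \<noteq> 0} (\<lambda>u. ?f (u / (1 + c * u)))"
      by (rule continuous_on_compose2) (auto intro!: continuous_intros)
    fix u assume u: "u \<in> {u. 1 + c * u \<noteq> 0}"
    show "?f (u / (1 + c * u)) = chart c u"
    proof (cases "u = 0")
      case False
      then have "u / (1 + c * u) \<noteq> 0" using u by simp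
      note to_sphere_inverse[OF this, symmetric]
      moreover have "c + 1 / u = 1 / (u / (1 + c * u))" using False u by (simp add: field_simps)
      ultimately show ?thesis using False by (simp only: chart_def if_False)
    qed (simp add: chart_def sphere_inf_def)
  qed
  have "open {u. u \<noteq> (0::complex)}" "open {u. 1 + c * u \<noteq> 0}"
    by (intro open_Collect_neq continuous_intros)+
  then have "continuous_on ({u. u \<noteq> 0} \<union> {u. 1 + c * u \<noteq> 0}) (chart c)"
    using 1 2 by (intro continuous_on_open_Un)
  then show ?thesis by (rule continuous_on_subset) auto
qed

text \<open>Two overlapping regions: away from the north pole z itself is continuous, and away from
  the south pole 1/z is, with 1/(z - c) = v/(1 - c v) for v = 1/z.\<close>

lemma continuous_on_chart_inv: "continuous_on (sphere 0 1 - {to_sphere c}) (chart_inv c)"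
proof -
  let ?S = "sphere 0 1 - {to_sphere c}"
  let ?A = "?S \<inter> {x. snd x \<noteq> 1}" and ?B = "?S \<inter> {x. snd x \<noteq> -1}"
  have neq: "from_sphere x \<noteq> c" if "x \<in> ?S" "x \<noteq> sphere_inf" for x
    using that to_from_sphere[of x] by auto
  have A: "x \<noteq> sphere_inf" "snd x \<noteq> 1" "from_sphere x - c \<noteq> 0" if "x \<in> ?A" for x
  proof -
    show "x \<noteq> sphere_inf" "snd x \<noteq> 1" using that by (auto simp: sphere_inf_def)
    then show "from_sphere x - c \<noteq> 0" using neq[of x] that by (metis IntD1 right_minus_eq)
  qed
  have 1: "continuous_on ?A (chart_inv c)"
  proof (rule continuous_on_eq)
    show "continuous_on ?A (\<lambda>x. 1 / (from_sphere x - c))"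
      by (intro continuous_on_divide continuous_on_diff continuous_on_const continuous_on_from_sphere ballI A)
  qed (simp add: chart_inv_def A(1) del: Int_iff Diff_iff mem_sphere)
  have 2: "continuous_on ?B (chart_inv c)"
  proof (rule continuous_on_eq)
    \<comment> \<open>The conjugate of the projection from the south pole; it equals 1/z and takes
      the value 0 at infinity.\<close>
    let ?v = "\<lambda>x. cnj (fst x) / of_real (1 + snd x)"
    have inv: "x = sphere_inf \<and> ?v x = 0 \<or> x \<noteq> sphere_inf \<and> from_sphere x \<noteq> 0 \<and> ?v x = 1 / from_sphere x"
      if x: "x \<in> ?B" for x
    proof (cases "x = sphere_inf")
      case False
      obtain f h where fh: "x = (f, h)" by force
      have h: "h \<noteq> 1" "h \<noteq> -1" using False x sphere_snd_eq_1[of x] fh by auto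
      have "(cmod f)\<^sup>2 = (1 - h) * (1 + h)"
        using x sphere_prod_iff[of x] unfolding fh by (simp add: power2_eq_square algebra_simps del: mem_sphere)
      then have f: "f * cnj f = of_real (1 - h) * of_real (1 + h)"
        by (metis complex_norm_square of_real_mult)
      have "1 - h \<noteq> 0" "1 + h \<noteq> 0" using h by linarith+
      then have ne: "complex_of_real (1 - h) \<noteq> 0" "complex_of_real (1 + h) \<noteq> 0"
        unfolding of_real_eq_0_iff .
      then have "f \<noteq> 0" using f by auto
      then have "cnj f / of_real (1 + h) = 1 / (f / of_real (1 - h))"
        using ne f by (simp add: divide_simps mult.commute del: of_real_add of_real_diff)
      then show ?thesis using False ne \<open>f \<noteq> 0\<close> by (simp add: from_sphere_def fh del: of_real_add of_real_diff)
    qed (simp add: sphere_inf_def)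
    have ne: "1 - c * ?v x \<noteq> 0" if x: "x \<in> ?B" for x
      using inv[OF x]
    proof
      assume "x \<noteq> sphere_inf \<and> from_sphere x \<noteq> 0 \<and> ?v x = 1 / from_sphere x"
      then have *: "x \<noteq> sphere_inf" "from_sphere x \<noteq> 0" "?v x = 1 / from_sphere x" by auto
      moreover have "from_sphere x - c \<noteq> 0" using neq[OF IntD1[OF x] *(1)] by simp
      ultimately show ?thesis unfolding *(3) by (simp add: divide_simps)
    next
      assume "x = sphere_inf \<and> ?v x = 0"
      then have "?v x = 0" ..
      then show ?thesis by (simp only:) simp
    qed
    have ne1: "complex_of_real (1 + snd x) \<noteq> 0" if "x \<in> ?B" for x
    proof -
      have "1 + snd x \<noteq> 0" using that by auto
      then show ?thesis unfolding of_real_eq_0_iff .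
    qed
    show "continuous_on ?B (\<lambda>x. ?v x / (1 - c * ?v x))"
      by (intro continuous_on_divide continuous_intros ballI ne1 ne)
    show "?v x / (1 - c * ?v x) = chart_inv c x" if x: "x \<in> ?B" for x
      using inv[OF x]
    proof
      assume "x \<noteq> sphere_inf \<and> from_sphere x \<noteq> 0 \<and> ?v x = 1 / from_sphere x"
      then have *: "x \<noteq> sphere_inf" "from_sphere x \<noteq> 0" "?v x = 1 / from_sphere x" by auto
      moreover have "from_sphere x - c \<noteq> 0" using neq[OF IntD1[OF x] *(1)] by simp
      ultimately show ?thesis unfolding *(3) by (simp add: chart_inv_def divide_simps)
    qed (auto simp: chart_inv_def sphere_inf_def)
  qed
  have "openin (top_of_set ?S) ?A" "openin (top_of_set ?S) ?B"
    by (auto intro!: openin_open_Int open_Collect_neq continuous_intros)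
  moreover have "?A \<union> ?B = ?S" by auto
  ultimately show ?thesis
    using continuous_on_Un_local_open[of ?A ?B] 1 2 by metis
qed

text \<open>Only T is connected by hypothesis, while h matters on F alone. The points of T near
  which h equals h x on F, and those near which it never does, form two open sets covering T;
  density of F makes them disjoint.\<close>

lemma constant_on_dense:
  assumes "connected T" "F \<subseteq> T"
    and dense: "\<And>N. openin (top_of_set T) N \<Longrightarrow> N \<noteq> {} \<Longrightarrow> N \<inter> F \<noteq> {}"
    and loc: "\<And>t. t \<in> T \<Longrightarrow> \<exists>N. openin (top_of_set T) N \<and> t \<in> N \<and> (\<forall>x\<in>N \<inter> F. \<forall>y\<in>N \<inter> F. h x = h y)"
    and xy: "x \<in> F" "y \<in> F"
  shows "h x = h y"
proof -
  let ?op = "\<lambda>P. {t. \<exists>N. openin (top_of_set T) N \<and> t \<in> N \<and> (\<forall>t'\<in>N \<inter> F. P t')}"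
  let ?A = "?op (\<lambda>t. h t = h x)" and ?B = "?op (\<lambda>t. h t \<noteq> h x)"
  have op: "openin (top_of_set T) (?op P)" for P
  proof -
    have "?op P = \<Union>{N. openin (top_of_set T) N \<and> (\<forall>t'\<in>N \<inter> F. P t')}" by blast
    then show ?thesis by (auto intro!: openin_Union simp only:)
  qed
  have "T \<subseteq> ?A \<union> ?B"
  proof
    fix t assume "t \<in> T"
    then obtain N where N: "openin (top_of_set T) N" "t \<in> N" "\<forall>x\<in>N \<inter> F. \<forall>y\<in>N \<inter> F. h x = h y"
      using loc by blast
    show "t \<in> ?A \<union> ?B"
    proof (cases "\<exists>t'\<in>N \<inter> F. h t' = h x")
      case True
      then obtain t' where "t' \<in> N \<inter> F" "h t' = h x" by blast
      then have "\<forall>t'\<in>N \<inter> F. h t' = h x" using N(3) by metis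
      then show ?thesis using N by blast
    qed (use N in blast)
  qed
  moreover have "?A \<inter> ?B = {}"
  proof (rule ccontr)
    assume "?A \<inter> ?B \<noteq> {}"
    then obtain t N1 N2 where N: "openin (top_of_set T) N1" "t \<in> N1" "\<forall>t'\<in>N1 \<inter> F. h t' = h x"
      "openin (top_of_set T) N2" "t \<in> N2" "\<forall>t'\<in>N2 \<inter> F. h t' \<noteq> h x" by blast
    then have "N1 \<inter> N2 \<inter> F \<noteq> {}" by (intro dense openin_Int) auto
    then show False using N by blast
  qed
  moreover have "A = {} \<or> B = {}" if "T \<subseteq> A \<union> B" "A \<inter> B = {}"
    "openin (top_of_set T) A" "openin (top_of_set T) B" for A B
    using \<open>connected T\<close> that unfolding connected_openin by blast
  ultimately have "?A = {} \<or> ?B = {}"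
    using op[of "\<lambda>t. h t = h x"] op[of "\<lambda>t. h t \<noteq> h x"] by presburger
  moreover have "x \<in> ?A"
  proof -
    obtain N where N: "openin (top_of_set T) N" "x \<in> N" "\<forall>s\<in>N \<inter> F. \<forall>t\<in>N \<inter> F. h s = h t"
      using loc[of x] xy(1) \<open>F \<subseteq> T\<close> by blast
    then have "\<forall>t\<in>N \<inter> F. h t = h x" using xy(1) by blast
    then show ?thesis using N by blast
  qed
  ultimately have B: "?B = {}" by (metis (no_types, lifting) empty_iff)
  have "y \<in> T" using xy(2) \<open>F \<subseteq> T\<close> by blast
  with \<open>T \<subseteq> ?A \<union> ?B\<close> have "y \<in> ?A \<union> ?B" by (rule subsetD)
  then have "y \<in> ?A" unfolding B by (simp only: Un_empty_right)
  then obtain N where "y \<in> N" "\<forall>t\<in>N \<inter> F. h t = h x" by blast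
  then show ?thesis using xy(2) by force
qed

section \<open>Solutions on the covering space\<close>

locale punctured_sphere_cover =
  fixes m :: nat and a :: "nat \<Rightarrow> complex" and T :: "'u::real_normed_vector set"
    and \<rho> :: "'u \<Rightarrow> complex \<times> real"
  assumes m: "m \<ge> 1" and cov: "universal_covering T \<rho> (punctured_sphere m a)"
begin

abbreviation "S \<equiv> punctured_sphere m a"
abbreviation "sing \<equiv> a ` {1..m}"
abbreviation "F \<equiv> finite_part T \<rho>"
abbreviation "base t \<equiv> from_sphere (\<rho> t)"

text \<open>The centre is a puncture, which the chart sends to infinity, so that all of
  \<open>S\<close> lies in the plane of one chart; \<open>m \<ge> 1\<close> provides it.\<close>

definition "ctr = a 1"

lemma covering: "covering_space T \<rho> S" and simply_connected_T: "simply_connected T"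
  using cov by (auto simp: universal_covering_def)

lemma connected_T: "connected T"
  using simply_connected_T by (simp add: simply_connected_imp_connected)

lemma \<rho>_in: "t \<in> T \<Longrightarrow> \<rho> t \<in> S"
  using covering covering_space_imp_surjective by blast

lemma continuous_on_\<rho>: "continuous_on T \<rho>"
  using covering by (simp add: covering_space_imp_continuous)

lemma S_subset: "S \<subseteq> sphere 0 1 - {to_sphere (ctr)}"
  using m by (auto simp: punctured_sphere_def ctr_def)

lemma to_sphere_in_S_iff: "to_sphere z \<in> S \<longleftrightarrow> z \<notin> sing"
  using to_sphere_in_sphere[of z] by (auto simp: punctured_sphere_def to_sphere_eq_iff simp del: mem_sphere)

lemma sphere_inf_in_S: "sphere_inf \<in> S"
  using sphere_inf_in_sphere to_sphere_neq_inf unfolding punctured_sphere_def by (metis DiffI imageE)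

lemma F_subset: "F \<subseteq> T" by (auto simp: finite_part_def)

lemma F_iff: "t \<in> F \<longleftrightarrow> t \<in> T \<and> \<rho> t \<noteq> sphere_inf" by (simp add: finite_part_def)

lemma \<rho>_eq_to_sphere:
  assumes "t \<in> F" shows "\<rho> t = to_sphere (base t)"
proof -
  have "\<rho> t \<in> sphere 0 1" "\<rho> t \<noteq> sphere_inf"
    using assms \<rho>_in[of t] S_subset F_iff by blast+
  then show ?thesis by (simp add: to_from_sphere del: mem_sphere)
qed

lemma base_notin_sing: "t \<in> F \<Longrightarrow> base t \<notin> sing"
  using \<rho>_eq_to_sphere[of t] \<rho>_in[of t] to_sphere_in_S_iff[of "base t"] F_subset by auto

section \<open>Sections of the covering over plane domains\<close>

definition is_section :: "complex set \<Rightarrow> (complex \<Rightarrow> 'u) \<Rightarrow> bool" where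
  "is_section D s \<longleftrightarrow> continuous_on D s \<and> (\<forall>z\<in>D. s z \<in> T \<and> \<rho> (s z) = to_sphere z)"

lemma is_section_in_F: "is_section D s \<Longrightarrow> z \<in> D \<Longrightarrow> s z \<in> F"
  by (simp add: is_section_def F_iff to_sphere_neq_inf)

lemma is_section_base: "is_section D s \<Longrightarrow> z \<in> D \<Longrightarrow> base (s z) = z"
  by (simp add: is_section_def from_to_sphere)

text \<open>Passing from u to z drops the parameter u = 0, that is infinity. Deleting one point from
  a connected open plane set leaves it connected, so a punctured neighbourhood of infinity is still
  one connected domain.\<close>

lemma section_from_chart:
  assumes W: "open W" "connected W" and s: "continuous_on W s" "\<And>u. u \<in> W \<Longrightarrow> s u \<in> T"
    "\<And>u. u \<in> W \<Longrightarrow> \<rho> (s u) = chart c u"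
  defines "D \<equiv> (\<lambda>u. c + 1 / u) ` (W - {0})"
  shows "open D" "connected D" "is_section D (\<lambda>z. s (1 / (z - c)))"
proof -
  have D: "D = {z \<in> - {c}. 1 / (z - c) \<in> W}"
  proof
    show "{z \<in> - {c}. 1 / (z - c) \<in> W} \<subseteq> D"
    proof
      fix z assume "z \<in> {z \<in> - {c}. 1 / (z - c) \<in> W}"
      then have "1 / (z - c) \<in> W - {0}" "z = c + 1 / (1 / (z - c))" by auto
      then show "z \<in> D" unfolding D_def by blast
    qed
  qed (auto simp: D_def)
  have cont: "continuous_on (- {c}) (\<lambda>z. 1 / (z - c))"
    by (intro continuous_intros) auto
  have "D = - {c} \<inter> (\<lambda>z. 1 / (z - c)) -` W" unfolding D by auto
  moreover have "open (- {c} \<inter> (\<lambda>z. 1 / (z - c)) -` W)"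
    by (rule continuous_open_preimage[OF cont _ W(1)]) auto
  ultimately show "open D" by simp
  show "connected D"
    unfolding D_def using W
    by (intro connected_continuous_image connected_open_delete continuous_intros) auto
  have "continuous_on D (\<lambda>z. s (1 / (z - c)))"
    by (rule continuous_on_compose2[OF s(1) continuous_on_subset[OF cont]]) (auto simp: D)
  then show "is_section D (\<lambda>z. s (1 / (z - c)))"
    using s by (auto simp: is_section_def D chart_def)
qed

text \<open>An inverse branch over an evenly covered set, cut down to a disc in the u-coordinate.
  That coordinate rather than z is used so that points above infinity are included.\<close>

lemma sheet:
  assumes t: "t \<in> T"
  defines "c \<equiv> ctr" and "u0 \<equiv> chart_inv ctr (\<rho> t)"
  shows "\<exists>e s. e > 0 \<and> continuous_on (ball u0 e) s \<and> (\<forall>u\<in>ball u0 e. s u \<in> T \<and> \<rho> (s u) = chart c u) \<and>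
    s u0 = t \<and> openin (top_of_set T) (s ` ball u0 e)"
proof -
  obtain N v where N: "\<rho> t \<in> N" "openin (top_of_set S) N" "\<Union>v = T \<inter> \<rho> -` N"
    "\<forall>u\<in>v. openin (top_of_set T) u" "\<forall>u\<in>v. \<exists>q. homeomorphism u N \<rho> q"
    using covering \<rho>_in[OF t] unfolding covering_space_def by metis
  obtain sh where sh: "sh \<in> v" "t \<in> sh" using N t by blast
  then obtain q where q: "homeomorphism sh N \<rho> q" using N by blast
  have opsh: "openin (top_of_set T) sh" using N sh by blast
  have shT: "sh \<subseteq> T" using opsh openin_imp_subset by blast
  obtain O' where O': "open O'" "N = S \<inter> O'" using N(2) by (auto simp: openin_open)
  have inv: "chart c (chart_inv c (\<rho> t)) = \<rho> t" if "t \<in> T" for t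
    using chart_chart_inv S_subset \<rho>_in[OF that] unfolding c_def by blast
  have "closed (chart c -` (to_sphere ` sing))"
    by (intro closed_vimage continuous_on_chart finite_imp_closed) auto
  moreover have "{u. chart c u \<in> N} = (- (chart c -` (to_sphere ` sing))) \<inter> chart c -` O'"
    using chart_in O'(2) unfolding punctured_sphere_def by blast
  ultimately have "open {u. chart c u \<in> N}"
    using open_vimage[OF O'(1) continuous_on_chart] by (simp add: open_Int open_Compl)
  moreover have "u0 \<in> {u. chart c u \<in> N}" using inv[OF t] N(1) by (simp add: u0_def c_def)
  ultimately obtain e where e: "e > 0" "ball u0 e \<subseteq> {u. chart c u \<in> N}"
    by (metis openE)
  define s where "s = q \<circ> chart c"
  have qN: "q x \<in> sh" "\<rho> (q x) = x" if "x \<in> N" for x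
    using q that by (auto simp: homeomorphism_def)
  \<comment> \<open>The image is the part of one slice whose chart coordinate lies in the disc,
    which shows that it is open.\<close>
  have "s ` ball u0 e = sh \<inter> (T \<inter> (\<lambda>t. chart_inv c (\<rho> t)) -` ball u0 e)"
  proof (intro equalityI subsetI)
    fix x assume "x \<in> s ` ball u0 e"
    then obtain u where u: "u \<in> ball u0 e" "x = q (chart c u)" by (auto simp: s_def)
    then have "chart c u \<in> N" using e by blast
    note q_chart = qN[OF this, folded u(2)]
    then have "chart_inv c (\<rho> x) = u" by (simp add: chart_inv_chart)
    then show "x \<in> sh \<inter> (T \<inter> (\<lambda>t. chart_inv c (\<rho> t)) -` ball u0 e)"
      using u(1) q_chart(1) shT by auto
  next
    fix x assume x: "x \<in> sh \<inter> (T \<inter> (\<lambda>t. chart_inv c (\<rho> t)) -` ball u0 e)"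
    then have "s (chart_inv c (\<rho> x)) = x" using inv q by (auto simp: s_def homeomorphism_def)
    then show "x \<in> s ` ball u0 e" using x by force
  qed
  moreover have "continuous_on T (\<lambda>t. chart_inv c (\<rho> t))"
  proof (rule continuous_on_compose2[OF _ continuous_on_\<rho>])
    show "continuous_on (sphere 0 1 - {to_sphere c}) (chart_inv c)" by (rule continuous_on_chart_inv)
    show "\<rho> ` T \<subseteq> sphere 0 1 - {to_sphere c}"
      unfolding c_def by (intro image_subsetI subsetD[OF S_subset] \<rho>_in)
  qed
  then have "openin (top_of_set T) (T \<inter> (\<lambda>t. chart_inv c (\<rho> t)) -` ball u0 e)"
    by (rule continuous_openin_preimage_gen) simp
  ultimately have "openin (top_of_set T) (s ` ball u0 e)" using opsh by auto
  moreover have "continuous_on (ball u0 e) s"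
    unfolding s_def
  proof (rule continuous_on_compose[OF continuous_on_chart])
    show "continuous_on (chart c ` ball u0 e) q"
      using e(2) by (intro continuous_on_subset[OF homeomorphism_cont2[OF q]]) auto
  qed
  moreover have "s u0 = t"
  proof -
    have "q (\<rho> t) = t" using q sh(2) by (rule homeomorphism_apply1)
    then show ?thesis using inv[OF t] by (simp add: s_def u0_def c_def)
  qed
  moreover have "s u \<in> T" "\<rho> (s u) = chart c u" if "u \<in> ball u0 e" for u
  proof -
    have "chart c u \<in> N" using e that by blast
    then show "s u \<in> T" "\<rho> (s u) = chart c u" using qN[of "chart c u"] shT by (auto simp: s_def)
  qed
  ultimately show ?thesis using e(1) by (intro exI[of _ e] exI[of _ s]) simp
qed

lemma local_section:
  assumes t: "t \<in> F"
  obtains D s where "open D" "connected D" "is_section D s" "base t \<in> D" "s (base t) = t"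
proof -
  let ?u = "chart_inv ctr (\<rho> t)"
  obtain e s where s: "e > 0" "continuous_on (ball ?u e) s" "\<forall>u\<in>ball ?u e. s u \<in> T \<and> \<rho> (s u) = chart ctr u"
    "s ?u = t" "openin (top_of_set T) (s ` ball ?u e)"
    using sheet[OF subsetD[OF F_subset t]] by (elim exE conjE)
  then have s_in: "\<And>u. u \<in> ball ?u e \<Longrightarrow> s u \<in> T" and s_chart: "\<And>u. u \<in> ball ?u e \<Longrightarrow> \<rho> (s u) = chart ctr u" by blast+
  have ne: "base t \<noteq> ctr" using base_notin_sing[OF t] m by (auto simp: ctr_def)
  have u: "?u = 1 / (base t - ctr)" using t by (simp add: chart_inv_def F_iff)
  have in_D: "base t \<in> (\<lambda>u. ctr + 1 / u) ` (ball ?u e - {0})"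
    unfolding u using ne \<open>e > 0\<close> by (intro image_eqI[of _ _ "1 / (base t - ctr)"]) auto
  note D = section_from_chart[OF open_ball connected_ball s(2) s_in s_chart]
  show ?thesis
    by (rule that[OF D in_D]) (use s(4) u in simp_all)
qed

text \<open>The sections over connected punctured neighbourhoods of \<open>\<infinity>\<close> carry constancy across the
  points above \<open>\<infinity>\<close>.\<close>

lemma constant_along_sections:
  assumes h: "\<And>D s z w. open D \<Longrightarrow> connected D \<Longrightarrow> is_section D s \<Longrightarrow> z \<in> D \<Longrightarrow> w \<in> D \<Longrightarrow> h (s z) = h (s w)"
    and xy: "x \<in> F" "y \<in> F"
  shows "h x = h y"
proof (rule constant_on_dense[OF connected_T F_subset _ _ xy])
  fix N assume N: "openin (top_of_set T) N" "N \<noteq> {}"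
  then obtain t where t: "t \<in> N" "t \<in> T" using openin_imp_subset by blast
  let ?u = "chart_inv ctr (\<rho> t)"
  obtain e s where s: "e > 0" "continuous_on (ball ?u e) s" "\<forall>u\<in>ball ?u e. s u \<in> T \<and> \<rho> (s u) = chart ctr u"
    "s ?u = t" "openin (top_of_set T) (s ` ball ?u e)"
    using sheet[OF t(2)] by (elim exE conjE)
  then have s_in: "\<And>u. u \<in> ball ?u e \<Longrightarrow> s u \<in> T" and s_chart: "\<And>u. u \<in> ball ?u e \<Longrightarrow> \<rho> (s u) = chart ctr u" by blast+
  obtain O' where O': "open O'" "N = T \<inter> O'" using N(1) by (auto simp: openin_open)
  have "open (ball ?u e \<inter> s -` O')" using s(2) O'(1) by (intro continuous_open_preimage) auto
  moreover have "?u \<in> ball ?u e \<inter> s -` O'" using s t O' by auto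
  ultimately obtain r where r: "r > 0" "ball ?u r \<subseteq> ball ?u e \<inter> s -` O'" by (metis openE)
  \<comment> \<open>On the sheet only u = 0 lies above infinity; if the centre is that point, a
    small nonzero parameter takes its place.\<close>
  define u where "u = (if ?u = 0 then of_real (r / 2) else ?u)"
  have u: "u \<noteq> 0" "u \<in> ball ?u r" using r(1) by (auto simp: u_def)
  then have "u \<in> ball ?u e" "s u \<in> O'" using r(2) by auto
  moreover from this have "\<rho> (s u) \<noteq> sphere_inf"
    using s_chart[of u] u(1) by (simp add: chart_def to_sphere_neq_inf)
  ultimately have "s u \<in> N \<inter> F"
    using s_in[of u] O'(2) by (simp add: F_iff)
  then show "N \<inter> F \<noteq> {}" by blast
next
  fix t assume t: "t \<in> T"
  let ?u = "chart_inv ctr (\<rho> t)"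
  obtain e s where s: "e > 0" "continuous_on (ball ?u e) s" "\<forall>u\<in>ball ?u e. s u \<in> T \<and> \<rho> (s u) = chart ctr u"
    "s ?u = t" "openin (top_of_set T) (s ` ball ?u e)"
    using sheet[OF t] by (elim exE conjE)
  then have s_in: "\<And>u. u \<in> ball ?u e \<Longrightarrow> s u \<in> T" and s_chart: "\<And>u. u \<in> ball ?u e \<Longrightarrow> \<rho> (s u) = chart ctr u" by blast+
  note D = section_from_chart[OF open_ball connected_ball s(2) s_in s_chart]
  have "\<exists>z\<in>(\<lambda>u. ctr + 1 / u) ` (ball ?u e - {0}). x = s (1 / (z - ctr))"
    if x: "x \<in> s ` ball ?u e \<inter> F" for x
  proof -
    obtain u where u: "x = s u" "u \<in> ball ?u e" using IntD1[OF x] by (rule imageE)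
    have "\<rho> (s u) \<noteq> sphere_inf" using IntD2[OF x] u(1) F_iff by blast
    then have "u \<noteq> 0" unfolding s_chart[OF u(2)] chart_def by auto
    then have "ctr + 1 / u \<in> (\<lambda>u. ctr + 1 / u) ` (ball ?u e - {0})" using u(2) by blast
    moreover have "x = s (1 / (ctr + 1 / u - ctr))" using u(1) by simp
    ultimately show ?thesis by (rule bexI[rotated])
  qed
  note ex = this
  have "h x = h y" if x: "x \<in> s ` ball ?u e \<inter> F" and y: "y \<in> s ` ball ?u e \<inter> F" for x y
  proof -
    obtain z where z: "z \<in> (\<lambda>u. ctr + 1 / u) ` (ball ?u e - {0})" "x = s (1 / (z - ctr))"
      using ex[OF x] by (rule bexE)
    obtain w where w: "w \<in> (\<lambda>u. ctr + 1 / u) ` (ball ?u e - {0})" "y = s (1 / (w - ctr))"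
      using ex[OF y] by (rule bexE)
    show ?thesis unfolding z(2) w(2) by (rule h[OF D z(1) w(1)])
  qed
  then have "\<forall>x\<in>s ` ball ?u e \<inter> F. \<forall>y\<in>s ` ball ?u e \<inter> F. h x = h y"
    by (intro ballI)
  moreover have "t \<in> s ` ball ?u e" using s(1,4) by (metis centre_in_ball imageI)
  ultimately show "\<exists>N. openin (top_of_set T) N \<and> t \<in> N \<and> (\<forall>x\<in>N \<inter> F. \<forall>y\<in>N \<inter> F. h x = h y)"
    using s(5) by (intro exI conjI)
qed

section \<open>Solutions along sections and lifts\<close>

lemma section_solution:
  assumes Y: "is_global_solution T \<rho> A Y" and D: "open D" "is_section D s" "z \<in> D"
  shows "invertible (Y (s z))" "has_mat_deriv (\<lambda>z. Y (s z)) (A z ** Y (s z)) z"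
proof -
  have "is_solution A D (\<lambda>z. z) (\<lambda>z. Y (s z))"
  proof (rule is_solution_pullback[OF Y[unfolded is_global_solution_def]])
    show "continuous_on D s" using D by (simp add: is_section_def)
    show "s ` D \<subseteq> F" using is_section_in_F[OF D(2)] by blast
    show "base (s u) = u" if "u \<in> D" for u by (rule is_section_base[OF D(2) that])
    show "eventually (\<lambda>v. v \<noteq> u) (at u within D)" for u by (simp add: eventually_at_filter)
  qed
  then show "invertible (Y (s z))" "has_mat_deriv (\<lambda>z. Y (s z)) (A z ** Y (s z)) z"
    using D by (simp_all add: is_solution_iff_has_mat_deriv)
qed

lemma section_analytic:
  assumes "is_global_solution T \<rho> A Y" "open D" "is_section D s"
  shows "mat_analytic (\<lambda>z. Y (s z)) D"
  by (rule mat_analytic_if_has_mat_deriv[OF assms(2) section_solution(2)[OF assms]])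

lemma lift:
  fixes W :: "complex set"
  assumes "open W" "simply_connected W" "continuous_on W g" "\<And>u. u \<in> W \<Longrightarrow> g u \<in> S"
    and "u0 \<in> W" "t0 \<in> T" "\<rho> t0 = g u0"
  obtains s where "continuous_on W s" "\<And>u. u \<in> W \<Longrightarrow> s u \<in> T" "\<And>u. u \<in> W \<Longrightarrow> \<rho> (s u) = g u" "s u0 = t0"
  using covering_space_lift_strong[OF covering assms(6,5,2) open_imp_locally_path_connected[OF assms(1)] assms(3)]
    assms(4,7) by (metis Pi_I funcset_mem)

text \<open>The equation for V says that V Y1 solves the second system. Two solutions differ by a
  right factor with zero derivative along each section, and \<open>constant_along_sections\<close>
  makes it one matrix on all of \<open>F\<close>.\<close>

lemma gauge_transformation:
  assumes Y1: "is_global_solution T \<rho> A1 Y1" and Y2: "is_global_solution T \<rho> A2 Y2"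
    and V: "\<And>z. z \<notin> sing \<Longrightarrow> invertible (V z)"
    and dV: "\<And>z. z \<notin> sing \<Longrightarrow> has_mat_deriv V (A2 z ** V z - V z ** A1 z) z"
    and t0: "t0 \<in> F"
  shows "\<exists>C. invertible C \<and> (\<forall>t\<in>F. Y2 t = V (base t) ** Y1 t ** C)"
proof -
  define h where "h t = matrix_inv (V (base t) ** Y1 t) ** Y2 t" for t
  have inv: "invertible (Y1 t)" "invertible (Y2 t)" "invertible (V (base t))" if "t \<in> F" for t
    using Y1 Y2 that V base_notin_sing[OF that] by (auto simp: is_global_solution_def is_solution_def)
  have const: "h t = h t0" if "t \<in> F" for t
  proof (rule constant_along_sections[OF _ that t0])
    fix D s z w assume D: "open D" "connected D" "is_section D s" and zw: "z \<in> D" "w \<in> D"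
    let ?G = "\<lambda>z. V z ** Y1 (s z)"
    have D_sing: "z \<notin> sing" if "z \<in> D" for z
      using base_notin_sing[OF is_section_in_F[OF D(3) that]] is_section_base[OF D(3) that] by simp
    have invs: "invertible (?G z)" "invertible (Y1 (s z))" "invertible (V z)" if "z \<in> D" for z
      using section_solution(1)[OF Y1 D(1,3) that] V[OF D_sing[OF that]] by (auto intro: invertible_mat_mult)
    have dG: "has_mat_deriv ?G (A2 z ** ?G z) z" if "z \<in> D" for z
      using has_mat_deriv_mult[OF dV[OF D_sing[OF that]] section_solution(2)[OF Y1 D(1,3) that]]
      by (simp add: matrix_mult_diff matrix_mul_assoc)
    have "mat_analytic ?G D" by (rule mat_analytic_if_has_mat_deriv[OF D(1) dG])
    then have dI: "has_mat_deriv (\<lambda>w. matrix_inv (?G w)) (- (matrix_inv (?G z) ** (A2 z ** ?G z) ** matrix_inv (?G z))) z"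
      if "z \<in> D" for z using has_mat_deriv_inv[OF D(1) that _ invs(1) dG[OF that]] by blast
    have "has_mat_deriv (\<lambda>z. matrix_inv (?G z) ** Y2 (s z)) 0 z" if "z \<in> D" for z
      using has_mat_deriv_mult[OF dI[OF that] section_solution(2)[OF Y2 D(1,3) that]]
      by (simp add: matrix_mult_minus matrix_mul_assoc matrix_cancel(4)[OF invs(1)[OF that]]
          matrix_cancel(3)[OF invs(1)[OF that]])
         (simp add: matrix_cancel[OF invs(2)[OF that]] matrix_cancel[OF invs(3)[OF that]]
           matrix_inv_mult[OF invs(3)[OF that] invs(2)[OF that]] matrix_mul_assoc)
    then obtain C where "\<And>z. z \<in> D \<Longrightarrow> matrix_inv (?G z) ** Y2 (s z) = C"
      using has_mat_deriv_zero_const[OF D(1,2)] by blast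
    then show "h (s z) = h (s w)"
      using zw is_section_base[OF D(3)] by (simp add: h_def)
  qed
  show ?thesis
  proof (intro exI[of _ "h t0"] conjI ballI)
    show "invertible (h t0)"
      unfolding h_def using inv[OF t0] by (intro invertible_mat_mult invertible_mat_inv)
    fix t assume t: "t \<in> F"
    have "V (base t) ** Y1 t ** h t = Y2 t"
      unfolding h_def by (rule matrix_cancel(2)) (use inv[OF t] in \<open>auto intro: invertible_mat_mult\<close>)
    then show "Y2 t = V (base t) ** Y1 t ** h t0" using const[OF t] by simp
  qed
qed

end

section \<open>Arcs of the curve\<close>

text \<open>A connected open plane set is simply connected if its complement has no bounded
  component. The chart sends c to infinity, and from each point of the arc one can follow the arc
  towards c, that is off to infinity within one component.\<close>

lemma simply_connected_arc_complement:
  fixes K :: "complex set"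
  assumes K: "c \<in> K" "K = {c} \<or> (\<exists>g. arc g \<and> path_image g = K)"
  defines "W \<equiv> {u. u = 0 \<or> c + 1 / u \<notin> K}"
  shows "open W" "simply_connected W"
proof -
  have compact: "compact K" using K(2) compact_arc_image by auto
  have connected_compl: "connected (- K)"
    using K(2)
  proof (elim disjE exE conjE)
    assume "K = {c}"
    then show ?thesis using connected_punctured_universe[of c] by (simp add: Compl_eq_Diff_UNIV)
  next
    fix g assume "arc g" "path_image g = K"
    then show ?thesis using connected_arc_complement[of g] by simp
  qed
  have "W = - (chart c -` (to_sphere ` K))"
    using to_sphere_neq_inf[symmetric] by (auto simp: W_def chart_def to_sphere_eq_iff split: if_splits)
  moreover have "closed (chart c -` (to_sphere ` K))"
    using compact by (intro closed_vimage continuous_on_chart compact_imp_closed compact_continuous_image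
        continuous_on_to_sphere) auto
  ultimately show openW: "open W" by (simp add: open_Compl)
  have W_minus: "W - {0} = (\<lambda>z. 1 / (z - c)) ` (- K)"
  proof
    show "W - {0} \<subseteq> (\<lambda>z. 1 / (z - c)) ` (- K)"
    proof
      fix u assume "u \<in> W - {0}"
      then have "c + 1 / u \<in> - K" "u = 1 / (c + 1 / u - c)" by (auto simp: W_def)
      then show "u \<in> (\<lambda>z. 1 / (z - c)) ` (- K)" by blast
    qed
  qed (use K(1) in \<open>auto simp: W_def\<close>)
  have "connected (W - {0})"
    unfolding W_minus using K(1)
    by (intro connected_continuous_image connected_compl continuous_intros) auto
  \<comment> \<open>Infinity, the point u = 0, is added back as a limit point; the rest is the image
    of the connected complement of K.\<close>
  moreover have "W \<subseteq> closure (W - {0})"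
  proof -
    have "0 \<in> W" by (simp add: W_def)
    then have "0 islimpt W" using openW by (simp add: interior_limit_point interior_open)
    then have "0 \<in> closure (W - {0})" by (simp add: islimpt_in_closure)
    then show ?thesis using closure_subset[of "W - {0}"] by blast
  qed
  ultimately have connW: "connected W" using connected_intermediate_closure[of "W - {0}" W] by blast
  have "\<not> bounded C" if C: "C \<in> components (- W)" for C
  proof
    assume bdd: "bounded C"
    obtain x where x: "x \<in> C" using C in_components_nonempty by blast
    then have "x \<notin> W" using C in_components_subset by blast
    then have xz: "x \<noteq> 0" "c + 1 / x \<in> K" "c + 1 / x \<noteq> c" by (auto simp: W_def)
    \<comment> \<open>A point of the complement of W comes from a point of K other than c, which
      excludes the one-point case.\<close>
    then obtain g where g: "arc g" "path_image g = K" using K(2) by auto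
    obtain t1 where t1: "t1 \<in> {0..1}" "g t1 = c + 1 / x" using xz(2) g(2) by (auto simp: path_image_def)
    obtain t0 where t0: "t0 \<in> {0..1}" "g t0 = c" using K(1) g(2) by (auto simp: path_image_def)
    have inj: "inj_on g {0..1}" and contg: "continuous_on {0..1} g"
      using g(1) by (auto simp: arc_def path_def)
    have ne: "t0 \<noteq> t1" using t0 t1 xz by auto
    \<comment> \<open>The parameters from the given point up to that of c, exclusive.\<close>
    define J where "J = closed_segment t1 t0 - {t0}"
    have seg: "closed_segment t1 t0 \<subseteq> {0..1}"
      using t0 t1 by (intro closed_segment_subset) auto
    have J: "J \<subseteq> {0..1}" "t0 \<notin> J" "t1 \<in> J" using seg ne by (auto simp: J_def)
    have gJ: "g t \<noteq> c" if "t \<in> J" for t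
      using inj t0 J that by (metis inj_onD subsetD)
    have "J = {t1..<t0} \<or> J = {t0<..t1}"
      by (cases "t1 \<le> t0") (auto simp: J_def closed_segment_eq_real_ivl)
    then have connJ: "connected J" and clJ: "t0 \<in> closure J" "closure J \<subseteq> closed_segment t1 t0"
      using ne J(3) by (auto simp: closed_segment_eq_real_ivl)
    let ?f = "\<lambda>t. 1 / (g t - c)"
    have "continuous_on J ?f"
      using gJ by (intro continuous_intros continuous_on_subset[OF contg J(1)]) auto
    then have "connected (?f ` J)" using connJ by (rule connected_continuous_image)
    moreover have "?f ` J \<subseteq> - W"
      using gJ J(1) g(2) by (auto simp: W_def path_image_def)
    moreover have "x \<in> ?f ` J" using t1 J(3) by (intro image_eqI[of _ _ t1]) auto
    ultimately have "?f ` J \<subseteq> C" using components_maximal[OF C] x by blast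
    then have "bounded (?f ` J)" using bdd bounded_subset by blast
    then obtain B where B: "B > 0" "\<And>t. t \<in> J \<Longrightarrow> cmod (?f t) \<le> B"
      unfolding bounded_pos by blast
    \<comment> \<open>A bound B for 1/(g - c) keeps g at distance at least 1/B from c on J, and by
      continuity also at t0, where g = c.\<close>
    have "1 / B \<le> cmod (g t0 - c)"
    proof (rule continuous_ge_on_closure[of J "\<lambda>t. cmod (g t - c)"])
      show "continuous_on (closure J) (\<lambda>t. cmod (g t - c))"
        using clJ(2) seg by (intro continuous_intros continuous_on_subset[OF contg]) auto
      show "t0 \<in> closure J" by (rule clJ)
      fix t assume "t \<in> J"
      then show "1 / B \<le> cmod (g t - c)"
        using B(2)[of t] gJ[of t] \<open>B > 0\<close> by (simp add: norm_divide field_simps)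
    qed
    then show False using t0 \<open>B > 0\<close> by simp
  qed
  then show "simply_connected W"
    using connW by (simp add: simply_connected_eq_unbounded_complement_components[OF openW])
qed

locale singular_curve =
  fixes m :: nat and a :: "nat \<Rightarrow> complex" and \<gamma> :: "real \<Rightarrow> complex" and \<tau> :: "nat \<Rightarrow> real"
  assumes m: "m \<ge> 1" and simple: "simple_path \<gamma>" and closed: "pathfinish \<gamma> = pathstart \<gamma>"
    and order: "in_order_on_curve m a \<gamma> \<tau>"
begin

abbreviation "\<Gamma> \<equiv> path_image \<gamma>"

text \<open>Used for k < m, with k = 0 for the arc from \<open>a m\<close> to \<open>a 1\<close>.
  Taking the singularities out of the removed set keeps all of them in; for m = 1 only the point
  \<open>a 1\<close> is left.\<close>

definition rest :: "nat \<Rightarrow> complex set" where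
  "rest k = \<Gamma> - (subarc m \<gamma> \<tau> k - a ` {1..m})"

lemma \<gamma>_inj: "s \<in> {0..1} \<Longrightarrow> t \<in> {0..1} \<Longrightarrow> \<gamma> s = \<gamma> t \<Longrightarrow> s = t \<or> s = 0 \<and> t = 1 \<or> s = 1 \<and> t = 0"
  using simple by (auto simp: simple_path_def loop_free_def)

lemma \<gamma>_1: "\<gamma> 1 = \<gamma> 0"
  using closed by (simp add: pathfinish_def pathstart_def)

lemma a_eq: "k \<in> {1..m} \<Longrightarrow> a k = \<gamma> (\<tau> k)" and \<tau>_range: "k \<in> {1..m} \<Longrightarrow> 0 \<le> \<tau> k \<and> \<tau> k < 1"
  using order by (auto simp: in_order_on_curve_def)

lemma \<tau>_less: "j \<in> {1..m} \<Longrightarrow> k \<in> {1..m} \<Longrightarrow> j < k \<Longrightarrow> \<tau> j < \<tau> k"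
  using order by (auto simp: in_order_on_curve_def strict_mono_on_def)

lemma \<tau>_le: "j \<in> {1..m} \<Longrightarrow> k \<in> {1..m} \<Longrightarrow> j \<le> k \<Longrightarrow> \<tau> j \<le> \<tau> k"
  using \<tau>_less[of j k] by (cases "j = k") auto

lemma sing_iff: "x \<in> a ` {1..m} \<longleftrightarrow> (\<exists>j\<in>{1..m}. x = \<gamma> (\<tau> j))"
  using a_eq by (auto intro: image_eqI)

lemma sing_subset: "a ` {1..m} \<subseteq> \<Gamma>"
  using a_eq \<tau>_range by (force simp: path_image_def)

lemma ctr_in_rest: "a 1 \<in> rest k"
  using sing_subset m by (auto simp: rest_def)

text \<open>The parameters of the open arc; for k = 0 it passes through the common start and end
  point of the curve, which splits it into two intervals.\<close>

definition params :: "nat \<Rightarrow> real set" where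
  "params k = (if k = 0 then {\<tau> m<..1} \<union> {0..<\<tau> 1} else {\<tau> k<..<\<tau> (Suc k)})"

lemma params_range: "k < m \<Longrightarrow> params k \<subseteq> {0..1}"
  using \<tau>_range[of k] \<tau>_range[of "Suc k"] \<tau>_range[of 1] \<tau>_range[of m] m
  by (auto simp: params_def)

lemma subarc_minus_sing:
  assumes k: "k < m" and x: "x \<in> subarc m \<gamma> \<tau> k - a ` {1..m}"
  obtains t where "t \<in> params k" "x = \<gamma> t"
proof -
  have nt: "x \<noteq> \<gamma> (\<tau> j)" if "j \<in> {1..m}" for j
    using x that sing_iff by blast
  show ?thesis
  proof (cases "k = 0")
    case True
    then obtain t where t: "x = \<gamma> t" "t \<in> {\<tau> m..1} \<union> {0..\<tau> 1}" using x by (auto simp: subarc_def)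
    then have "t \<noteq> \<tau> m" "t \<noteq> \<tau> 1" using nt m by auto
    then show ?thesis using that[of t] t True by (auto simp: params_def)
  next
    case False
    then obtain t where t: "x = \<gamma> t" "t \<in> {\<tau> k..\<tau> (Suc k)}" using x k by (auto simp: subarc_def)
    then have "t \<noteq> \<tau> k" "t \<noteq> \<tau> (Suc k)" using nt[of k] nt[of "Suc k"] k False by auto
    then show ?thesis using that[of t] t False by (auto simp: params_def)
  qed
qed

lemma params_disjoint:
  assumes k: "k < m" "l < m" "k < l" and s: "s \<in> params k" and t: "t \<in> params l"
  shows "\<gamma> s \<noteq> \<gamma> t"
proof
  assume eq: "\<gamma> s = \<gamma> t"
  have l: "l \<in> {1..m}" "Suc l \<in> {1..m}" using k by auto
  have t': "\<tau> l < t" "t < \<tau> (Suc l)" using t k by (auto simp: params_def)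
  \<comment> \<open>As l > 0, the parameter t is interior, so the identification of 0 and 1 cannot
    interfere with injectivity.\<close>
  have t01: "0 < t" "t < 1" using t' \<tau>_range[OF l(1)] \<tau>_range[OF l(2)] by auto
  have "s \<in> {0..1}" using params_range[OF k(1)] s by blast
  then have "s = t" using \<gamma>_inj[of s t] eq t01 by auto
  show False
  proof (cases "k = 0")
    case True
    have "\<tau> (Suc l) \<le> \<tau> m" "\<tau> 1 \<le> \<tau> l" using l m by (auto intro!: \<tau>_le)
    then show ?thesis using s t' \<open>s = t\<close> True by (auto simp: params_def)
  next
    case False
    have "\<tau> (Suc k) \<le> \<tau> l" using l k by (intro \<tau>_le) auto
    then show ?thesis using s t' \<open>s = t\<close> False by (auto simp: params_def)
  qed
qed

text \<open>Different open arcs are disjoint. This serves in contrapositive form: where two sheets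
  with different slits are both defined, the point lies off the curve.\<close>

lemma rest_cover:
  assumes "k < m" "l < m" "k \<noteq> l"
  shows "\<Gamma> \<subseteq> rest k \<union> rest l"
proof
  fix x assume x: "x \<in> \<Gamma>"
  show "x \<in> rest k \<union> rest l"
  proof (rule ccontr)
    assume "x \<notin> rest k \<union> rest l"
    then have "x \<in> subarc m \<gamma> \<tau> k - a ` {1..m}" "x \<in> subarc m \<gamma> \<tau> l - a ` {1..m}"
      using x by (auto simp: rest_def)
    then obtain s t where "s \<in> params k" "x = \<gamma> s" "t \<in> params l" "x = \<gamma> t"
      using subarc_minus_sing assms by metis
    then show False using params_disjoint[of k l s t] params_disjoint[of l k t s] assms
      by (metis linorder_neq_iff)
  qed
qed

lemma subarcs_cover:
  assumes "x \<in> \<Gamma>" obtains k where "k < m" "x \<in> subarc m \<gamma> \<tau> k"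
proof -
  obtain t where t: "t \<in> {0..1}" "x = \<gamma> t" using assms by (auto simp: path_image_def)
  show ?thesis
  proof (cases "\<tau> 1 \<le> t \<and> t < \<tau> m")
    case False
    then have "t \<in> {\<tau> m..1} \<union> {0..\<tau> 1}" using t by auto
    then have "x \<in> subarc m \<gamma> \<tau> 0" unfolding subarc_def using t by simp
    then show ?thesis using that[of 0] m by simp
  next
    case True
    define k where "k = Max {j \<in> {1..m}. \<tau> j \<le> t}"
    have fin: "finite {j \<in> {1..m}. \<tau> j \<le> t}" "{j \<in> {1..m}. \<tau> j \<le> t} \<noteq> {}" using True m by auto
    have k: "k \<in> {1..m}" "\<tau> k \<le> t" using Max_in[OF fin] by (auto simp: k_def)
    have "k \<noteq> m" using k True by auto
    then have km: "k < m" using k by auto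
    have "t < \<tau> (Suc k)"
    proof (rule ccontr)
      assume "\<not> t < \<tau> (Suc k)"
      then have "Suc k \<le> k" unfolding k_def[symmetric] using km
        by (subst k_def, intro Max_ge fin) auto
      then show False by simp
    qed
    then have "x \<in> subarc m \<gamma> \<tau> k" using k km t by (auto simp: subarc_def)
    then show ?thesis using that km by blast
  qed
qed

text \<open>For k = 0 this is the piece of the curve from \<open>a 1\<close> to \<open>a m\<close>,
  a point if m = 1. Otherwise it leads from \<open>a (k + 1)\<close> through the start point of the
  curve to \<open>a k\<close>, and is put together from two subpaths.\<close>

lemma rest_arc:
  assumes k: "k < m"
  shows "rest k = {a 1} \<or> (\<exists>g. arc g \<and> path_image g = rest k)"
proof (cases "k = 0")
  case True
  have m1: "1 \<in> {1..m}" "m \<in> {1..m}" using m by auto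
  have rest: "rest k = \<gamma> ` {\<tau> 1..\<tau> m}"
  proof (intro equalityI subsetI)
    fix x assume x: "x \<in> rest k"
    then obtain t where t: "t \<in> {0..1}" "x = \<gamma> t" by (auto simp: rest_def path_image_def)
    show "x \<in> \<gamma> ` {\<tau> 1..\<tau> m}"
    proof (cases "x \<in> a ` {1..m}")
      case True
      then obtain j where "j \<in> {1..m}" "x = \<gamma> (\<tau> j)" using sing_iff by blast
      then show ?thesis using \<tau>_le[of 1 j] \<tau>_le[of j m] m by auto
    next
      case False
      then have "x \<notin> subarc m \<gamma> \<tau> 0" using x \<open>k = 0\<close> by (auto simp: rest_def)
      then have "t \<notin> {\<tau> m..1} \<union> {0..\<tau> 1}" using t by (auto simp: subarc_def)
      then show ?thesis using t by auto
    qed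
  next
    fix x assume "x \<in> \<gamma> ` {\<tau> 1..\<tau> m}"
    then obtain t where t: "t \<in> {\<tau> 1..\<tau> m}" "x = \<gamma> t" by blast
    then have t01: "t \<in> {0..1}" "t < 1" using \<tau>_range[OF m1(1)] \<tau>_range[OF m1(2)] by auto
    show "x \<in> rest k"
    proof (rule ccontr)
      assume "x \<notin> rest k"
      then have "x \<in> subarc m \<gamma> \<tau> k - a ` {1..m}"
        using t t01 by (auto simp: rest_def path_image_def)
      then obtain s where s: "s \<in> params k" "x = \<gamma> s" using subarc_minus_sing[OF k] by blast
      have "s \<in> {0..1}" using params_range[OF k] s by blast
      then have "s = t \<or> s = 1 \<and> t = 0" using \<gamma>_inj[of s t] s t t01 by auto
      then show False
      proof
        assume "s = t"
        then show False using s t \<open>k = 0\<close> by (auto simp: params_def)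
      next
        assume "s = 1 \<and> t = 0"
        then have "\<tau> 1 = t" using t \<tau>_range[OF m1(1)] by auto
        then have "x \<in> a ` {1..m}" using t sing_iff m1 by blast
        with \<open>x \<in> subarc m \<gamma> \<tau> k - a ` {1..m}\<close> show False by blast
      qed
    qed
  qed
  show ?thesis
  proof (cases "m = 1")
    case True
    then show ?thesis using rest a_eq[OF m1(1)] by simp
  next
    case False
    have less: "\<tau> 1 < \<tau> m" using m False by (intro \<tau>_less) auto
    have r: "\<tau> 1 \<in> {0..1}" "\<tau> m \<in> {0..1}" using \<tau>_range[OF m1(1)] \<tau>_range[OF m1(2)] by auto
    have "\<gamma> (\<tau> 1) \<noteq> \<gamma> (\<tau> m)"
      using \<gamma>_inj[OF r] less \<tau>_range[OF m1(1)] \<tau>_range[OF m1(2)] by auto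
    then have "arc (subpath (\<tau> 1) (\<tau> m) \<gamma>)" using simple r by (intro arc_simple_path_subpath)
    moreover have "path_image (subpath (\<tau> 1) (\<tau> m) \<gamma>) = rest k"
      using less by (simp add: rest path_image_subpath)
    ultimately show ?thesis by blast
  qed
next
  case False
  let ?l = "Suc k"
  have kl: "k \<in> {1..m}" "?l \<in> {1..m}" using k False by auto
  have less: "0 \<le> \<tau> k" "\<tau> k < \<tau> ?l" "\<tau> ?l < 1" using kl \<tau>_range \<tau>_less by auto
  have rest: "rest k = \<gamma> ` {\<tau> ?l..1} \<union> \<gamma> ` {0..\<tau> k}"
  proof (intro equalityI subsetI)
    fix x assume x: "x \<in> rest k"
    then obtain t where t: "t \<in> {0..1}" "x = \<gamma> t" by (auto simp: rest_def path_image_def)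
    show "x \<in> \<gamma> ` {\<tau> ?l..1} \<union> \<gamma> ` {0..\<tau> k}"
    proof (cases "x \<in> a ` {1..m}")
      case True
      then obtain j where j: "j \<in> {1..m}" "x = \<gamma> (\<tau> j)" using sing_iff by blast
      have "\<tau> j \<in> {\<tau> ?l..1} \<union> {0..\<tau> k}"
        using \<tau>_le[of j k] \<tau>_le[of ?l j] j kl \<tau>_range[OF j(1)] by (cases "j \<le> k") auto
      then show ?thesis using j by blast
    next
      case False
      then have "x \<notin> subarc m \<gamma> \<tau> k" using x by (auto simp: rest_def)
      then have "t \<notin> {\<tau> k..\<tau> ?l}" using t kl k by (auto simp: subarc_def)
      then show ?thesis using t by auto
    qed
  next
    fix x assume "x \<in> \<gamma> ` {\<tau> ?l..1} \<union> \<gamma> ` {0..\<tau> k}"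
    then obtain t where t: "t \<in> {\<tau> ?l..1} \<union> {0..\<tau> k}" "x = \<gamma> t" by blast
    then have t01: "t \<in> {0..1}" using less by auto
    show "x \<in> rest k"
    proof (rule ccontr)
      assume "x \<notin> rest k"
      then have "x \<in> subarc m \<gamma> \<tau> k - a ` {1..m}"
        using t t01 by (auto simp: rest_def path_image_def)
      then obtain s where s: "s \<in> params k" "x = \<gamma> s" using subarc_minus_sing[OF k] by blast
      have "s \<in> {0..1}" using params_range[OF k] s by blast
      moreover have "0 < s" "s < 1" "\<tau> k < s" "s < \<tau> ?l" using s less False by (auto simp: params_def)
      ultimately have "s = t" using \<gamma>_inj[of s t] s t t01 by auto
      then show False using t \<open>\<tau> k < s\<close> \<open>s < \<tau> ?l\<close> by auto
    qed
  qed
  have r: "\<tau> ?l \<in> {0..1}" "1 \<in> {0..1::real}" "0 \<in> {0..1::real}" "\<tau> k \<in> {0..1}" using less by auto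
  have "\<gamma> (\<tau> ?l) \<noteq> \<gamma> 1" using \<gamma>_inj[OF r(1,2)] less by auto
  then have arc1: "arc (subpath (\<tau> ?l) 1 \<gamma>)" using simple r by (intro arc_simple_path_subpath)
  have im1: "path_image (subpath (\<tau> ?l) 1 \<gamma>) = \<gamma> ` {\<tau> ?l..1}" using less by (simp add: path_image_subpath)
  show ?thesis
  \<comment> \<open>If \<open>a k\<close> is the start point of the curve, the second piece shrinks
    to the end point of the first, and a constant path would be no arc.\<close>
  proof (cases "\<tau> k = 0")
    case True
    have "\<gamma> 0 \<in> \<gamma> ` {\<tau> ?l..1}" using less \<gamma>_1 by (intro image_eqI[of _ _ 1]) auto
    then have "path_image (subpath (\<tau> ?l) 1 \<gamma>) = rest k" using rest im1 True by auto
    then show ?thesis using arc1 by blast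
  next
    case False
    have "\<gamma> 0 \<noteq> \<gamma> (\<tau> k)" using \<gamma>_inj[OF r(3,4)] less False by auto
    then have arc2: "arc (subpath 0 (\<tau> k) \<gamma>)" using simple r by (intro arc_simple_path_subpath)
    have im2: "path_image (subpath 0 (\<tau> k) \<gamma>) = \<gamma> ` {0..\<tau> k}" using less by (simp add: path_image_subpath)
    have "arc (subpath (\<tau> ?l) 1 \<gamma> +++ subpath 0 (\<tau> k) \<gamma>)"
    proof (rule arc_join[OF arc1 arc2])
      show "pathfinish (subpath (\<tau> ?l) 1 \<gamma>) = pathstart (subpath 0 (\<tau> k) \<gamma>)" using \<gamma>_1 by simp
      show "path_image (subpath (\<tau> ?l) 1 \<gamma>) \<inter> path_image (subpath 0 (\<tau> k) \<gamma>) \<subseteq> {pathstart (subpath 0 (\<tau> k) \<gamma>)}"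
        unfolding im1 im2
      proof
        fix x assume "x \<in> \<gamma> ` {\<tau> ?l..1} \<inter> \<gamma> ` {0..\<tau> k}"
        then obtain s t where st: "s \<in> {\<tau> ?l..1}" "x = \<gamma> s" "t \<in> {0..\<tau> k}" "x = \<gamma> t" by blast
        then have "s \<in> {0..1}" "t \<in> {0..1}" using less by auto
        then have "s = t \<or> s = 1 \<and> t = 0" using \<gamma>_inj[of s t] st less by auto
        then show "x \<in> {pathstart (subpath 0 (\<tau> k) \<gamma>)}" using st less by auto
      qed
    qed
    moreover have "path_image (subpath (\<tau> ?l) 1 \<gamma> +++ subpath 0 (\<tau> k) \<gamma>) = rest k"
      using \<gamma>_1 by (subst path_image_join) (simp_all add: im1 im2 rest)
    ultimately show ?thesis by blast
  qed
qed

end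

section \<open>Descent to the punctured plane\<close>

lemma (in punctured_sphere_cover) lift_unique:
  assumes "connected X" "x0 \<in> X" "f x0 = g x0"
    and f: "continuous_on X f" "\<And>x. x \<in> X \<Longrightarrow> f x \<in> T"
    and g: "continuous_on X g" "\<And>x. x \<in> X \<Longrightarrow> g x \<in> T"
    and fg: "\<And>x. x \<in> X \<Longrightarrow> \<rho> (f x) = \<rho> (g x)"
    and x: "x \<in> X"
  shows "f x = g x"
proof (rule covering_space_lift_unique[OF covering assms(3) _ _ f(1) _ _ g(1) _ _ assms(1,2) x])
  show "continuous_on X (\<lambda>x. \<rho> (f x))"
    by (rule continuous_on_compose2[OF continuous_on_\<rho> f(1)]) (use f(2) in blast)
  show "(\<lambda>x. \<rho> (f x)) \<in> X \<rightarrow> S" using f(2) \<rho>_in by simp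
qed (use f g fg in auto)

locale marked_cover =
  punctured_sphere_cover m a T \<rho> + singular_curve m a \<gamma> \<tau>
  for m a and T :: "'u::real_normed_vector set" and \<rho> \<gamma> \<tau> +
  fixes t\<^sub>0 :: 'u and p :: "nat \<Rightarrow> real \<Rightarrow> 'u" and \<sigma> :: "nat \<Rightarrow> 'u \<Rightarrow> 'u"
  assumes t0: "t\<^sub>0 \<in> T" "\<rho> t\<^sub>0 \<in> to_sphere ` inside (path_image \<gamma>)"
    and around: "\<And>k. k \<in> {1..m} \<Longrightarrow> path_around T \<rho> m \<gamma> \<tau> t\<^sub>0 k (p k)"
    and deck: "\<And>k. k \<in> {1..m} \<Longrightarrow> deck_transformation T \<rho> (\<sigma> k) \<and> \<sigma> k t\<^sub>0 = pathfinish (p k)"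
begin

text \<open>The sphere without \<open>rest k\<close> in the coordinate \<open>u = 1/(z - ctr)\<close>, with \<open>\<infinity>\<close> at \<open>u = 0\<close>.\<close>

definition dom :: "nat \<Rightarrow> complex set" where
  "dom k = {u. u = 0 \<or> ctr + 1 / u \<notin> rest k}"

definition recip :: "complex \<Rightarrow> complex" where "recip z = 1 / (z - ctr)"

definition "u\<^sub>0 = chart_inv ctr (\<rho> t\<^sub>0)"

definition V_in :: "complex set" where "V_in = recip ` inside \<Gamma>"
text \<open>The parameter 0 is included because the path \<open>p k\<close> may cross a point above
  infinity while it is outside the curve.\<close>

definition V_out :: "complex set" where "V_out = insert 0 (recip ` outside \<Gamma>)"

section \<open>The sheets over the slit sphere\<close>

lemma \<sigma>: assumes "k \<in> {1..m}"
  shows "continuous_on T (\<sigma> k)" "t \<in> T \<Longrightarrow> \<sigma> k t \<in> T" "t \<in> T \<Longrightarrow> \<rho> (\<sigma> k t) = \<rho> t" "\<sigma> k t\<^sub>0 = p k 1"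
  using deck[OF assms] by (auto simp: deck_transformation_def homeomorphism_def pathfinish_def)

lemma ctr_\<Gamma>: "ctr \<in> \<Gamma>"
  using ctr_in_rest[of 0] by (auto simp: rest_def ctr_def)

lemma dom: assumes "k < m" shows "open (dom k)" "simply_connected (dom k)"
  using simply_connected_arc_complement[of ctr "rest k"] ctr_in_rest rest_arc[OF assms]
  by (auto simp: dom_def ctr_def)

lemma sing_rest: "sing \<subseteq> rest k"
  using sing_subset by (auto simp: rest_def)

lemma rest_subset: "rest k \<subseteq> \<Gamma>" by (auto simp: rest_def)

lemma chart_dom: "u \<in> dom k \<Longrightarrow> chart ctr u \<in> S"
  using sing_rest[of k] sphere_inf_in_S to_sphere_in_S_iff by (auto simp: dom_def chart_def)

lemma recip_nonzero: "z \<noteq> ctr \<Longrightarrow> recip z \<noteq> 0 \<and> ctr + 1 / recip z = z"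
  by (simp add: recip_def)

lemma dom_if_notin_\<Gamma>: "z \<notin> \<Gamma> \<Longrightarrow> recip z \<in> dom k"
proof -
  assume z: "z \<notin> \<Gamma>"
  then have "z \<noteq> ctr" using ctr_\<Gamma> by blast
  moreover have "z \<notin> rest k" using z rest_subset by blast
  ultimately show "recip z \<in> dom k" using recip_nonzero[of z] by (simp add: dom_def)
qed

lemma off_\<Gamma>: "z \<in> inside \<Gamma> \<Longrightarrow> z \<notin> \<Gamma>" "z \<in> outside \<Gamma> \<Longrightarrow> z \<notin> \<Gamma>"
  using inside_no_overlap[of \<Gamma>] outside_no_overlap[of \<Gamma>] by blast+

lemma V_dom: "V_in \<subseteq> dom k" "V_out \<subseteq> dom k"
proof -
  show "V_in \<subseteq> dom k"
    unfolding V_in_def by (intro image_subsetI dom_if_notin_\<Gamma> off_\<Gamma>)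
  have "0 \<in> dom k" by (simp add: dom_def)
  moreover have "recip ` outside \<Gamma> \<subseteq> dom k" by (intro image_subsetI dom_if_notin_\<Gamma> off_\<Gamma>)
  ultimately show "V_out \<subseteq> dom k" unfolding V_out_def by blast
qed

lemma Jordan: "connected (inside \<Gamma>)" "connected (outside \<Gamma>)" "\<not> bounded (outside \<Gamma>)"
  using Jordan_inside_outside[OF simple closed] by blast+

lemma continuous_on_recip: "ctr \<notin> X \<Longrightarrow> continuous_on X recip"
  unfolding recip_def by (intro continuous_intros) auto

lemma connected_V_in: "connected V_in"
  unfolding V_in_def using off_\<Gamma>(1) ctr_\<Gamma>
  by (intro connected_continuous_image Jordan continuous_on_recip) blast

text \<open>The exterior is unbounded, so its reciprocal image accumulates at 0, and adjoining a
  closure point preserves connectedness.\<close>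

lemma connected_V_out: "connected V_out"
proof -
  have conn: "connected (recip ` outside \<Gamma>)"
    using off_\<Gamma>(2) ctr_\<Gamma>
    by (intro connected_continuous_image Jordan continuous_on_recip) blast
  have "0 \<in> closure (recip ` outside \<Gamma>)"
    unfolding closure_approachable
  proof (intro allI impI)
    fix e :: real assume "e > 0"
    obtain z where z: "z \<in> outside \<Gamma>" "cmod z > 1 / e + cmod ctr"
      using Jordan(3) unfolding bounded_iff by (meson not_le)
    have "cmod (z - ctr) > 1 / e" using z(2) norm_triangle_ineq2[of z ctr] by linarith
    then have "dist (recip z) 0 < e"
      using \<open>e > 0\<close> by (simp add: recip_def norm_divide field_simps)
        (metis divide_less_eq less_trans norm_not_less_zero not_less_iff_gr_or_eq zero_less_divide_1_iff)
    then show "\<exists>y\<in>recip ` outside \<Gamma>. dist y 0 < e" using z(1) by blast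
  qed
  then show ?thesis
    unfolding V_out_def using connected_intermediate_closure[OF conn] closure_subset by (metis insert_subset subset_insertI)
qed

lemma u0: "u\<^sub>0 \<in> V_in" "\<rho> t\<^sub>0 = chart ctr u\<^sub>0"
proof -
  obtain z where z: "z \<in> inside \<Gamma>" "\<rho> t\<^sub>0 = to_sphere z" using t0 by blast
  then have "u\<^sub>0 = recip z" by (simp add: u\<^sub>0_def chart_inv_def recip_def to_sphere_neq_inf from_to_sphere)
  then show "u\<^sub>0 \<in> V_in" using z by (simp add: V_in_def)
  have "\<rho> t\<^sub>0 \<in> sphere 0 1 - {to_sphere ctr}" using \<rho>_in[OF t0(1)] S_subset by blast
  then show "\<rho> t\<^sub>0 = chart ctr u\<^sub>0" unfolding u\<^sub>0_def by (rule chart_chart_inv[symmetric])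
qed

text \<open>Up to its second crossing the path \<open>p k\<close> runs in the sheet \<open>g\<close>, after its first crossing in
  the sheet \<open>\<sigma> k \<circ> h\<close>, and between the crossings it is outside the curve.\<close>

lemma monodromy_step:
  assumes k: "k \<in> {1..<m}"
    and g: "continuous_on (dom (k - 1)) g" "\<And>u. u \<in> dom (k - 1) \<Longrightarrow> g u \<in> T \<and> \<rho> (g u) = chart ctr u" "g u\<^sub>0 = t\<^sub>0"
    and h: "continuous_on (dom k) h" "\<And>u. u \<in> dom k \<Longrightarrow> h u \<in> T \<and> \<rho> (h u) = chart ctr u" "h u\<^sub>0 = t\<^sub>0"
    and u: "u \<in> V_out"
  shows "g u = \<sigma> k (h u)"
proof -
  have k': "k \<in> {1..m}" using k by auto
  obtain s1 s2 where path: "simple_path (p k)" "path_image (p k) \<subseteq> T" "p k 0 = t\<^sub>0" "\<rho> (p k 1) = \<rho> t\<^sub>0"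
    and s: "s1 < s2" "{s \<in> {0..1}. \<rho> (p k s) \<in> to_sphere ` \<Gamma>} = {s1, s2}"
      "\<rho> (p k s1) \<in> to_sphere ` subarc m \<gamma> \<tau> (k - 1)" "\<rho> (p k s2) \<in> to_sphere ` subarc m \<gamma> \<tau> k"
      "\<forall>s\<in>{s1<..<s2}. \<rho> (p k s) \<notin> to_sphere ` inside \<Gamma>"
    using around[OF k'] unfolding path_around_def pathstart_def pathfinish_def by blast
  have s01: "0 \<le> s1" "s2 \<le> 1" using s(2) by auto
  have pT: "p k x \<in> T" if "x \<in> {0..1}" for x using path(2) that by (auto simp: path_image_def)
  define r where "r x = chart_inv ctr (\<rho> (p k x))" for x
  have \<rho>p: "\<rho> (p k x) \<in> sphere 0 1 - {to_sphere ctr}" if "x \<in> {0..1}" for x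
    using \<rho>_in[OF pT[OF that]] S_subset by blast
  have contp: "continuous_on {0..1} (p k)" using path(1) by (simp add: simple_path_def path_def)
  have contr: "continuous_on {0..1} r"
    unfolding r_def
  proof (rule continuous_on_compose2[OF continuous_on_chart_inv])
    show "continuous_on {0..1} (\<lambda>x. \<rho> (p k x))"
      by (rule continuous_on_compose2[OF continuous_on_\<rho> contp]) (use pT in blast)
    show "(\<lambda>x. \<rho> (p k x)) ` {0..1} \<subseteq> sphere 0 1 - {to_sphere ctr}" using \<rho>p by (intro image_subsetI)
  qed
  have chart_r: "chart ctr (r x) = \<rho> (p k x)" if "x \<in> {0..1}" for x
    unfolding r_def by (rule chart_chart_inv[OF \<rho>p[OF that]])
  have r_dom: "r x \<in> dom j" if x: "x \<in> {0..1}" and "\<And>z. \<rho> (p k x) = to_sphere z \<Longrightarrow> z \<notin> rest j" for x j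
    using chart_r[OF x] that(2) unfolding dom_def by (auto simp: chart_def split: if_splits)
  have off: "r x \<in> dom j" if "x \<in> {0..1}" "x \<noteq> s1" "x \<noteq> s2" for x j
  proof (rule r_dom[OF that(1)])
    fix z assume "\<rho> (p k x) = to_sphere z"
    moreover have "\<rho> (p k x) \<notin> to_sphere ` \<Gamma>" using s(2) that by blast
    ultimately show "z \<notin> rest j" using rest_subset by blast
  qed
  \<comment> \<open>Points of \<open>T\<close> never lie above singularities, so on the j-th subarc
    the path is in the open arc that \<open>rest j\<close> omits.\<close>
  have on: "r x \<in> dom j" if x: "x \<in> {0..1}" and sub: "\<rho> (p k x) \<in> to_sphere ` subarc m \<gamma> \<tau> j" for x j
  proof (rule r_dom[OF x])
    fix z assume z: "\<rho> (p k x) = to_sphere z"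
    then have "z \<notin> sing" using \<rho>_in[OF pT[OF x]] to_sphere_in_S_iff by simp
    moreover have "z \<in> subarc m \<gamma> \<tau> j" using sub z to_sphere_eq_iff by auto
    ultimately show "z \<notin> rest j" by (simp add: rest_def)
  qed
  have r0: "r 0 = u\<^sub>0" "r 1 = u\<^sub>0" using path by (simp_all add: r_def u\<^sub>0_def)
  have s_mem: "s1 \<in> {0..1}" "s2 \<in> {0..1}" using s01 s(1) by auto
  have s2_pos: "0 < s2" "s1 < 1" using s(1) s01 by auto
  \<comment> \<open>Before s2 the curve is met only at s1, on the arc left open in
    \<open>dom (k - 1)\<close>; the path and the lifted sheet start at the same point.\<close>
  have first: "p k x = g (r x)" if "x \<in> {0..<s2}" for x
  proof (rule lift_unique[of "{0..<s2}" 0 "p k" "\<lambda>x. g (r x)"])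
    have sub: "{0..<s2} \<subseteq> {0..1}" using s01 by auto
    have dom: "r x \<in> dom (k - 1)" if "x \<in> {0..<s2}" for x
      using off[of x "k - 1"] on[of x "k - 1"] s(3) that sub by (cases "x = s1") auto
    show "continuous_on {0..<s2} (p k)" by (rule continuous_on_subset[OF contp sub])
    show "continuous_on {0..<s2} (\<lambda>x. g (r x))"
      by (rule continuous_on_compose2[OF g(1) continuous_on_subset[OF contr sub]]) (use dom in blast)
    fix x assume x: "x \<in> {0..<s2}"
    then have x': "x \<in> {0..1}" using sub by blast
    show "p k x \<in> T" by (rule pT[OF x'])
    show "g (r x) \<in> T" "\<rho> (p k x) = \<rho> (g (r x))" using g(2)[OF dom[OF x]] chart_r[OF x'] by auto
  qed (use that r0 g(3) path(3) s2_pos in auto)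
  \<comment> \<open>After s1 the curve is met only at s2, on the k-th arc; the two lifts are
    compared at the end point of the path, which is \<open>\<sigma> k t\<^sub>0\<close>.\<close>
  have second: "p k x = \<sigma> k (h (r x))" if "x \<in> {s1<..1}" for x
  proof (rule lift_unique[of "{s1<..1}" 1 "p k" "\<lambda>x. \<sigma> k (h (r x))"])
    have sub: "{s1<..1} \<subseteq> {0..1}" using s01 by auto
    have dom: "r x \<in> dom k" if "x \<in> {s1<..1}" for x
      using off[of x k] on[of x k] s(4) that sub by (cases "x = s2") auto
    show "continuous_on {s1<..1} (p k)" by (rule continuous_on_subset[OF contp sub])
    have "continuous_on {s1<..1} (\<lambda>x. h (r x))"
      by (rule continuous_on_compose2[OF h(1) continuous_on_subset[OF contr sub]]) (use dom in blast)
    then show "continuous_on {s1<..1} (\<lambda>x. \<sigma> k (h (r x)))"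
      by (rule continuous_on_compose2[OF \<sigma>(1)[OF k']]) (use dom h(2) in blast)
    fix x assume x: "x \<in> {s1<..1}"
    then have x': "x \<in> {0..1}" using sub by blast
    show "p k x \<in> T" by (rule pT[OF x'])
    show "\<sigma> k (h (r x)) \<in> T" "\<rho> (p k x) = \<rho> (\<sigma> k (h (r x)))"
      using h(2)[OF dom[OF x]] chart_r[OF x'] \<sigma>(2,3)[OF k', of "h (r x)"] by auto
  qed (use that r0 h(3) \<sigma>(4)[OF k'] s2_pos in auto)
  \<comment> \<open>Any parameter between the crossings would do: both descriptions hold there, and
    one common point determines lifts on the connected exterior.\<close>
  let ?x = "(s1 + s2) / 2"
  have x: "?x \<in> {0..1}" "?x \<in> {0..<s2}" "?x \<in> {s1<..1}" "?x \<in> {s1<..<s2}" "?x \<noteq> s1" "?x \<noteq> s2"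
    using s01 s(1) by auto
  have "r ?x \<in> V_out"
  proof (cases "r ?x = 0")
    case False
    define z where "z = ctr + 1 / r ?x"
    have "\<rho> (p k ?x) = to_sphere z" using chart_r[OF x(1)] False by (simp add: chart_def z_def)
    moreover have "\<rho> (p k ?x) \<notin> to_sphere ` \<Gamma>" using s(2) x by blast
    moreover have "\<rho> (p k ?x) \<notin> to_sphere ` inside \<Gamma>" using s(5) x(4) by blast
    ultimately have "z \<notin> \<Gamma> \<union> inside \<Gamma>" by blast
    then have "z \<in> outside \<Gamma>" using inside_Un_outside[of \<Gamma>] by blast
    moreover have "r ?x = recip z" using False by (simp add: recip_def z_def)
    ultimately show ?thesis by (simp add: V_out_def)
  qed (simp add: V_out_def)
  show ?thesis
  proof (rule lift_unique[OF connected_V_out \<open>r ?x \<in> V_out\<close>])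
    show "g (r ?x) = \<sigma> k (h (r ?x))" using first[OF x(2)] second[OF x(3)] by simp
    show "continuous_on V_out g" by (rule continuous_on_subset[OF g(1) V_dom(2)])
    have "continuous_on V_out h" by (rule continuous_on_subset[OF h(1) V_dom(2)])
    then show "continuous_on V_out (\<lambda>u. \<sigma> k (h u))"
      by (rule continuous_on_compose2[OF \<sigma>(1)[OF k']]) (use h(2) V_dom(2)[of k] in blast)
    fix u assume "u \<in> V_out"
    then have u: "u \<in> dom (k - 1)" "u \<in> dom k" using V_dom(2) by blast+
    show "g u \<in> T" "\<sigma> k (h u) \<in> T" "\<rho> (g u) = \<rho> (\<sigma> k (h u))"
      using g(2)[OF u(1)] h(2)[OF u(2)] \<sigma>(2,3)[OF k', of "h u"] by auto
  qed (rule u)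
qed

text \<open>The result is stated locally, as W read along sections, because that is the form in
  which U is differentiated later.\<close>

lemma descent:
  assumes W: "\<And>k t. k \<in> {1..m} \<Longrightarrow> t \<in> F \<Longrightarrow> W (\<sigma> k t) = W t"
  shows "\<exists>U. \<forall>z0. z0 \<notin> sing \<longrightarrow>
    (\<exists>D s. open D \<and> z0 \<in> D \<and> is_section D s \<and> (\<forall>z\<in>D. U z = W (s z)))"
proof -
  have "\<exists>g. k < m \<longrightarrow> continuous_on (dom k) g \<and> (\<forall>u\<in>dom k. g u \<in> T \<and> \<rho> (g u) = chart ctr u) \<and> g u\<^sub>0 = t\<^sub>0" for k
  proof (cases "k < m")
    case True
    have "u\<^sub>0 \<in> dom k" using u0(1) V_dom(1) by blast
    show ?thesis
    proof (rule lift[OF dom[OF True] continuous_on_chart _ \<open>u\<^sub>0 \<in> dom k\<close> t0(1) u0(2)])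
      show "chart ctr u \<in> S" if "u \<in> dom k" for u by (rule chart_dom[OF that])
    next
      fix s assume "continuous_on (dom k) s" "\<And>u. u \<in> dom k \<Longrightarrow> s u \<in> T"
        "\<And>u. u \<in> dom k \<Longrightarrow> \<rho> (s u) = chart ctr u" "s u\<^sub>0 = t\<^sub>0"
      then show ?thesis by blast
    qed
  qed auto
  then obtain g where g: "\<And>k. k < m \<Longrightarrow> continuous_on (dom k) (g k)"
    "\<And>k u. k < m \<Longrightarrow> u \<in> dom k \<Longrightarrow> g k u \<in> T \<and> \<rho> (g k u) = chart ctr u" "\<And>k. k < m \<Longrightarrow> g k u\<^sub>0 = t\<^sub>0"
    by metis
  have gF: "g k u \<in> F" if "k < m" "u \<in> dom k" "u \<noteq> 0" for k u
    using g(2)[OF that(1,2)] that(3) by (simp add: F_iff chart_def to_sphere_neq_inf)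
  have g_in: "g k u = g 0 u" if k: "k < m" and u: "u \<in> V_in" for k u
  proof (rule lift_unique[OF connected_V_in u0(1)])
    have "0 < m" using k by simp
    show "continuous_on V_in (g k)" "continuous_on V_in (g 0)"
      using continuous_on_subset[OF g(1) V_dom(1)] k \<open>0 < m\<close> by blast+
    show "g k u\<^sub>0 = g 0 u\<^sub>0" using g(3)[OF k] g(3)[OF \<open>0 < m\<close>] by simp
    fix u assume "u \<in> V_in"
    then have "u \<in> dom k" "u \<in> dom 0" using V_dom(1) by blast+
    then show "g k u \<in> T" "g 0 u \<in> T" "\<rho> (g k u) = \<rho> (g 0 u)"
      using g(2)[OF k] g(2)[OF \<open>0 < m\<close>] by simp_all
  qed (rule u)
  \<comment> \<open>\<open>\<sigma> (Suc k)\<close> leads from sheet k + 1 to sheet k. The value u =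
    0 is left out, as W is invariant only on the finite part.\<close>
  have W_out: "W (g k u) = W (g 0 u)" if "k < m" "u \<in> V_out" "u \<noteq> 0" for k u
    using that
  proof (induction k)
    case (Suc k)
    have k: "Suc k \<in> {1..<m}" "k < m" using Suc.prems by auto
    have "g k u = \<sigma> (Suc k) (g (Suc k) u)"
      by (rule monodromy_step[OF k(1)]) (use g k Suc.prems in auto)
    moreover have "g (Suc k) u \<in> F" using gF[of "Suc k" u] Suc.prems V_dom(2) by blast
    ultimately have "W (g k u) = W (g (Suc k) u)" using W[of "Suc k"] k by simp
    then show ?case using Suc k by simp
  qed simp
  \<comment> \<open>Any sheet whose slit avoids z may be used; the next claim shows that the choice
    does not matter.\<close>
  define U where "U z = W (g (SOME k. k < m \<and> z \<notin> rest k) (recip z))" for z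
  have U: "U z = W (g k (recip z))" if k: "k < m" "z \<notin> rest k" for z k
  proof -
    define k' where "k' = (SOME k. k < m \<and> z \<notin> rest k)"
    have k': "k' < m" "z \<notin> rest k'"
      using someI[of "\<lambda>k. k < m \<and> z \<notin> rest k" k] k by (auto simp: k'_def)
    have "W (g k' (recip z)) = W (g k (recip z))"
    proof (cases "k = k'")
      case False
      then have "z \<notin> \<Gamma>" using rest_cover[of k k'] k k' by blast
      then consider "z \<in> inside \<Gamma>" | "z \<in> outside \<Gamma>" using inside_Un_outside[of \<Gamma>] by blast
      then show ?thesis
      proof cases
        case 1
        then have "recip z \<in> V_in" by (simp add: V_in_def)
        from g_in[OF k(1) this] g_in[OF k'(1) this] show ?thesis by simp
      next
        case 2
        then have "recip z \<in> V_out" by (simp add: V_out_def)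
        moreover have "recip z \<noteq> 0" using recip_nonzero[of z] ctr_\<Gamma> \<open>z \<notin> \<Gamma>\<close> by blast
        ultimately show ?thesis using W_out[OF k(1)] W_out[OF k'(1)] by simp
      qed
    qed simp
    then show ?thesis by (simp add: U_def k'_def)
  qed
  have "\<exists>D s. open D \<and> z0 \<in> D \<and> is_section D s \<and> (\<forall>z\<in>D. U z = W (s z))" if z0: "z0 \<notin> sing" for z0
  proof -
    obtain k where k: "k < m" "z0 \<notin> rest k"
    proof (cases "z0 \<in> \<Gamma>")
      case True
      then obtain k where "k < m" "z0 \<in> subarc m \<gamma> \<tau> k" by (rule subarcs_cover)
      then show ?thesis using that[of k] z0 by (simp add: rest_def)
    next
      case False
      then show ?thesis using that[of 0] rest_subset m by (metis One_nat_def Suc_le_lessD subsetD)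
    qed
    have "z0 \<noteq> ctr" using z0 m by (auto simp: ctr_def)
    note rz0 = recip_nonzero[OF this]
    have "recip z0 \<in> dom k" using k rz0 by (simp add: dom_def)
    then obtain e where e: "e > 0" "ball (recip z0) e \<subseteq> dom k"
      using dom(1)[OF k(1)] openE by metis
    have gk: "continuous_on (ball (recip z0) e) (g k)" "\<And>u. u \<in> ball (recip z0) e \<Longrightarrow> g k u \<in> T"
      "\<And>u. u \<in> ball (recip z0) e \<Longrightarrow> \<rho> (g k u) = chart ctr u"
      using continuous_on_subset[OF g(1)[OF k(1)] e(2)] g(2)[OF k(1)] e(2) by blast+
    let ?D = "(\<lambda>u. ctr + 1 / u) ` (ball (recip z0) e - {0})"
    note D = section_from_chart[OF open_ball connected_ball gk]
    have "z0 \<in> ?D" using rz0 e(1) by (intro image_eqI[of _ _ "recip z0"]) auto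
    moreover have "U z = W (g k (1 / (z - ctr)))" if z: "z \<in> ?D" for z
    proof -
      obtain u where u: "z = ctr + 1 / u" "u \<in> ball (recip z0) e - {0}" using z by (rule imageE)
      then have "z \<notin> rest k" using e(2) unfolding dom_def by blast
      then show ?thesis using U[OF k(1)] by (simp add: recip_def)
    qed
    ultimately show ?thesis using D(1,3) by blast
  qed
  then show ?thesis by blast
qed

end

section \<open>The gauge transformation\<close>

lemma is_solution_mult_const:
  assumes Y: "is_solution A T \<pi> Y" and C: "invertible C"
  shows "is_solution A T \<pi> (\<lambda>t. Y t ** C)"
  unfolding is_solution_def
proof (intro ballI conjI)
  fix t assume t: "t \<in> T"
  then show "invertible (Y t ** C)" using Y C by (auto simp: is_solution_def intro: invertible_mat_mult)
  let ?q = "\<lambda>s. cscale (1 / (\<pi> s - \<pi> t)) (Y s - Y t)"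
  have lim: "((\<lambda>s. ?q s $ i $ j) \<longlongrightarrow> (A (\<pi> t) ** Y t) $ i $ j) (at t within T)" for i j
    using Y t by (intro tendsto_vec_nth) (simp add: is_solution_def)
  have "((\<lambda>s. ?q s ** C) \<longlongrightarrow> A (\<pi> t) ** Y t ** C) (at t within T)"
  proof (intro vec_tendstoI)
    fix i j
    have "((\<lambda>s. \<Sum>k\<in>UNIV. ?q s $ i $ k * C $ k $ j) \<longlongrightarrow> (\<Sum>k\<in>UNIV. (A (\<pi> t) ** Y t) $ i $ k * C $ k $ j))
      (at t within T)"
      by (intro tendsto_sum tendsto_mult lim tendsto_const)
    then show "((\<lambda>s. (?q s ** C) $ i $ j) \<longlongrightarrow> (A (\<pi> t) ** Y t ** C) $ i $ j) (at t within T)"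
      by (simp add: matrix_matrix_mult_def[of _ C])
  qed
  then show "((\<lambda>s. cscale (1 / (\<pi> s - \<pi> t)) (Y s ** C - Y t ** C)) \<longlongrightarrow> A (\<pi> t) ** (Y t ** C)) (at t within T)"
    by (simp add: cscale_mult matrix_mult_diff[symmetric] matrix_mul_assoc)
qed

lemma gauge_equation_iff:
  fixes V V' A1 A2 :: "('n::finite) cmat"
  assumes V: "invertible V"
  shows "A2 = V' ** matrix_inv V + V ** A1 ** matrix_inv V \<longleftrightarrow> V' = A2 ** V - V ** A1"
proof
  assume "A2 = V' ** matrix_inv V + V ** A1 ** matrix_inv V"
  then show "V' = A2 ** V - V ** A1" by (simp add: matrix_mult_add matrix_cancel[OF V])
next
  assume "V' = A2 ** V - V ** A1"
  then show "A2 = V' ** matrix_inv V + V ** A1 ** matrix_inv V"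
    by (simp add: matrix_mult_diff matrix_cancel[OF V])
qed

text \<open>Exponentials coincide only for differences that are multiples of 2 pi i, and below the
  distance 2 pi only zero is left. This supplies the local injectivity required for pulling back to
  the logarithmic coordinate.\<close>

lemma eventually_exp_neq: "eventually (\<lambda>v. c + exp v \<noteq> c + exp u) (at u within D)" for u c :: complex
  unfolding eventually_at
proof (intro exI[of _ "2 * pi"] conjI ballI impI)
  fix v assume v: "v \<in> D" "v \<noteq> u \<and> dist v u < 2 * pi"
  have "\<bar>Im v - Im u\<bar> < 2 * pi"
    using v abs_Im_le_cmod[of "v - u"] by (simp add: dist_norm)
  then show "c + exp v \<noteq> c + exp u" using v exp_complex_eqI[of v u] by auto
qed simp

section \<open>Local forms compared through lifts\<close>

lemma (in punctured_sphere_cover) pullback: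
  assumes Y: "is_global_solution T \<rho> A Y" and s: "continuous_on D s" "\<And>u. u \<in> D \<Longrightarrow> s u \<in> T"
    "\<And>u. u \<in> D \<Longrightarrow> \<rho> (s u) = to_sphere (h u)"
    and inj: "\<And>u. u \<in> D \<Longrightarrow> eventually (\<lambda>v. h v \<noteq> h u) (at u within D)"
  shows "is_solution A D h (\<lambda>u. Y (s u))"
  by (rule is_solution_pullback[OF Y[unfolded is_global_solution_def] s(1) _ _ inj])
    (use s in \<open>auto simp: F_iff to_sphere_neq_inf from_to_sphere\<close>)

lemma (in punctured_sphere_cover) \<rho>_surj: "x \<in> S \<Longrightarrow> \<exists>t\<in>T. \<rho> t = x"
  using covering_space_imp_surjective[OF covering] by (metis imageE)

lemma (in punctured_sphere_cover) lift_ex: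
  fixes W :: "complex set"
  assumes "open W" "simply_connected W" "continuous_on W g" "\<And>u. u \<in> W \<Longrightarrow> g u \<in> S" "W \<noteq> {}"
  shows "\<exists>s. continuous_on W s \<and> (\<forall>u\<in>W. s u \<in> T \<and> \<rho> (s u) = g u)"
proof -
  obtain u0 where u0: "u0 \<in> W" using assms(5) by blast
  obtain t where t: "t \<in> T" "\<rho> t = g u0" using \<rho>_surj assms(4)[OF u0] by blast
  show ?thesis
    by (rule lift[OF assms(1-4) u0 t]) blast+
qed

text \<open>The two local forms come with their own radii, and each applies to solutions on the full
  half plane of its radius. So the logarithmic coordinate is lifted over the half plane for the
  larger radius, and the forms are compared on the disc of the smaller one.\<close>

lemma (in punctured_sphere_cover) extend_at_singularity:
  fixes E :: "nat \<Rightarrow> ('n::finite) cmat"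
  assumes k: "k \<in> {1..m}" and nr: "nonresonant (E k)"
    and lf: "local_form_at m a E A1 k" "local_form_at m a E A2 k"
    and Y: "is_global_solution T \<rho> A1 Y1" "is_global_solution T \<rho> A2 Y2"
    and C: "invertible C" and eq: "\<And>t. t \<in> F \<Longrightarrow> Y2 t = U (base t) ** Y1 t ** C"
  shows "\<exists>G r. r > 0 \<and> mat_analytic G (ball (a k) r) \<and> (\<forall>z\<in>ball (a k) r. invertible (G z)) \<and>
    (\<forall>z\<in>ball (a k) r - {a k}. z \<notin> sing \<and> U z = G z)"
proof -
  obtain d1 where d1: "d1 > 0" "\<And>j. j \<in> {1..m} \<Longrightarrow> j \<noteq> k \<Longrightarrow> d1 \<le> dist (a j) (a k)"
    and f1: "\<And>Y. is_solution A1 {w. Re w < ln d1} (\<lambda>w. a k + exp w) Y \<Longrightarrow>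
         (\<exists>Z C. mat_analytic Z (ball (a k) d1) \<and> (\<forall>z\<in>ball (a k) d1. invertible (Z z)) \<and>
            invertible C \<and>
            (\<forall>w. Re w < ln d1 \<longrightarrow> Y w = Z (a k + exp w) ** mat_exp (cscale w (E k)) ** C))"
    using lf(1) unfolding local_form_at_def by blast
  obtain d2 where d2: "d2 > 0" "\<And>j. j \<in> {1..m} \<Longrightarrow> j \<noteq> k \<Longrightarrow> d2 \<le> dist (a j) (a k)"
    and f2: "\<And>Y. is_solution A2 {w. Re w < ln d2} (\<lambda>w. a k + exp w) Y \<Longrightarrow>
         (\<exists>Z C. mat_analytic Z (ball (a k) d2) \<and> (\<forall>z\<in>ball (a k) d2. invertible (Z z)) \<and>
            invertible C \<and>
            (\<forall>w. Re w < ln d2 \<longrightarrow> Y w = Z (a k + exp w) ** mat_exp (cscale w (E k)) ** C))"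
    using lf(2) unfolding local_form_at_def by blast
  define d where "d = max d1 d2"
  have d: "d > 0" "\<And>j. j \<in> {1..m} \<Longrightarrow> j \<noteq> k \<Longrightarrow> d \<le> dist (a j) (a k)"
    using d1 d2 by (auto simp: d_def)
  have nsing: "z \<notin> sing" if "z \<noteq> a k" "dist z (a k) < d" for z
    using d(2) that by force
  define H where "H = {w. Re w < ln d}"
  have H_sing: "a k + exp w \<notin> sing" if "w \<in> H" for w
  proof (rule nsing)
    have "exp (Re w) < exp (ln d)" using that by (simp add: H_def)
    then have "exp (Re w) < d" using d(1) by simp
    then show "dist (a k + exp w) (a k) < d" by (simp add: dist_norm)
  qed simp
  have H: "open H" "simply_connected H"
    unfolding H_def by (simp add: open_halfspace_Re_lt) (intro convex_imp_simply_connected convex_halfspace_Re_lt)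
  have w0: "of_real (ln d - 1) \<in> H" by (simp add: H_def)
  have "\<exists>s. continuous_on H s \<and> (\<forall>w\<in>H. s w \<in> T \<and> \<rho> (s w) = to_sphere (a k + exp w))"
  proof (rule lift_ex[OF H])
    show "continuous_on H (\<lambda>w. to_sphere (a k + exp w))"
      by (intro continuous_on_compose2[OF continuous_on_to_sphere[of UNIV]] continuous_intros) auto
    show "to_sphere (a k + exp w) \<in> S" if "w \<in> H" for w using H_sing[OF that] to_sphere_in_S_iff by blast
    show "H \<noteq> {}" using w0 by blast
  qed
  then obtain s where s: "continuous_on H s" "\<And>w. w \<in> H \<Longrightarrow> s w \<in> T"
    "\<And>w. w \<in> H \<Longrightarrow> \<rho> (s w) = to_sphere (a k + exp w)" by blast
  have sub: "{w. Re w < ln d1} \<subseteq> H" "{w. Re w < ln d2} \<subseteq> H"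
    using d1(1) d2(1) by (auto simp: H_def d_def max_def intro: less_le_trans[OF _ ln_mono] order.strict_trans2)
  have "is_solution A1 {w. Re w < ln d1} (\<lambda>w. a k + exp w) (\<lambda>w. Y1 (s w))"
    by (rule pullback[OF Y(1) continuous_on_subset[OF s(1) sub(1)] s(2,3) eventually_exp_neq]) (use sub(1) in blast)+
  from f1[OF this] obtain Z1 C1 where Z1: "mat_analytic Z1 (ball (a k) d1)" "\<forall>z\<in>ball (a k) d1. invertible (Z1 z)"
    "invertible C1" "\<forall>w. Re w < ln d1 \<longrightarrow> Y1 (s w) = Z1 (a k + exp w) ** mat_exp (cscale w (E k)) ** C1" by blast
  have "is_solution A2 {w. Re w < ln d2} (\<lambda>w. a k + exp w) (\<lambda>w. Y2 (s w))"
    by (rule pullback[OF Y(2) continuous_on_subset[OF s(1) sub(2)] s(2,3) eventually_exp_neq]) (use sub(2) in blast)+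
  from f2[OF this] obtain Z2 C2 where Z2: "mat_analytic Z2 (ball (a k) d2)" "\<forall>z\<in>ball (a k) d2. invertible (Z2 z)"
    "invertible C2" "\<forall>w. Re w < ln d2 \<longrightarrow> Y2 (s w) = Z2 (a k + exp w) ** mat_exp (cscale w (E k)) ** C2" by blast
  define r where "r = min d1 d2"
  have r: "r > 0" "r \<le> d1" "r \<le> d2" using d1 d2 by (auto simp: r_def)
  have balls: "ball (a k) r \<subseteq> ball (a k) d1" "ball (a k) r \<subseteq> ball (a k) d2" using r by auto
  have "U (a k + exp w) ** (Z1 (a k + exp w) ** mat_exp (cscale w (E k)) ** C1)
      = Z2 (a k + exp w) ** mat_exp (cscale w (E k)) ** (C2 ** matrix_inv C)" if w: "Re w < ln r" for w
  proof -
    have "ln r \<le> ln d1" "ln r \<le> ln d2" using r d1 d2 by simp_all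
    then have w12: "Re w < ln d1" "Re w < ln d2" using w by auto
    then have wH: "w \<in> H" using sub by blast
    then have "s w \<in> F" "base (s w) = a k + exp w"
      using s by (simp_all add: F_iff to_sphere_neq_inf from_to_sphere)
    then have "Y2 (s w) ** matrix_inv C = U (a k + exp w) ** Y1 (s w)"
      using eq[of "s w"] by (simp add: matrix_cancel[OF C])
    then show ?thesis using Z1(4) Z2(4) w12 by (simp add: matrix_mul_assoc)
  qed
  from removable_at_nonresonant[OF nr r(1) mat_analytic_subset[OF Z1(1) balls(1)] _
      mat_analytic_subset[OF Z2(1) balls(2)] _ Z1(3) invertible_mat_mult[OF Z2(3) invertible_mat_inv[OF C]] this]
  obtain G where G: "mat_analytic G (ball (a k) r)" "\<And>z. z \<in> ball (a k) r \<Longrightarrow> invertible (G z)"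
    "\<And>z. z \<in> ball (a k) r - {a k} \<Longrightarrow> U z = G z"
    using Z1(2) Z2(2) balls by (metis subsetD)
  have "z \<notin> sing" if "z \<in> ball (a k) r - {a k}" for z
    using that r by (intro nsing) (auto simp: d_def dist_commute)
  then show ?thesis using G r(1) by (intro exI[of _ G] exI[of _ r]) auto
qed

text \<open>With c = 0 the chart coordinate is 1/z, and the disc around infinity lies wholly in
  \<open>S\<close>. Lifting it gives solutions that are single-valued in z near infinity, to which
  the assumed forms apply; the larger radius serves for the lift, the smaller for the
  comparison.\<close>

lemma (in punctured_sphere_cover) local_forms_at_inf:
  fixes A1 A2 :: "complex \<Rightarrow> ('n::finite) cmat" and C :: "'n cmat"
  assumes lf: "local_form_at_inf m a \<kappa>1 A1" "local_form_at_inf m a \<kappa>2 A2"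
    and Y: "is_global_solution T \<rho> A1 Y1" "is_global_solution T \<rho> A2 Y2"
    and C: "invertible C" and eq: "\<And>t. t \<in> F \<Longrightarrow> Y2 t = U (base t) ** Y1 t ** C"
  obtains \<delta> W1 W2 C1 C2 where "\<delta> > 0" "mat_analytic W1 (ball 0 \<delta>)" "\<And>u. u \<in> ball 0 \<delta> \<Longrightarrow> invertible (W1 u)"
    "mat_analytic W2 (ball 0 \<delta>)" "\<And>u. u \<in> ball 0 \<delta> \<Longrightarrow> invertible (W2 u)" "invertible (C1 :: 'n cmat)" "invertible (C2 :: 'n cmat)"
    "\<And>z. cmod z > 1 / \<delta> \<Longrightarrow> U z ** (diag_powers \<kappa>1 z ** W1 (1 / z) ** C1) = diag_powers \<kappa>2 z ** W2 (1 / z) ** C2"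
proof -
  obtain d1 where d1: "d1 > 0" "\<And>j. j \<in> {1..m} \<Longrightarrow> cmod (a j) \<le> 1 / d1"
    and f1: "\<And>Y. is_solution A1 {z. cmod z > 1 / d1} (\<lambda>z. z) Y \<Longrightarrow>
         (\<exists>W C. mat_analytic W (ball 0 d1) \<and> (\<forall>u\<in>ball 0 d1. invertible (W u)) \<and>
            invertible C \<and> (\<forall>z. cmod z > 1 / d1 \<longrightarrow> Y z = diag_powers \<kappa>1 z ** W (1 / z) ** C))"
    using lf(1) unfolding local_form_at_inf_def by blast
  obtain d2 where d2: "d2 > 0" "\<And>j. j \<in> {1..m} \<Longrightarrow> cmod (a j) \<le> 1 / d2"
    and f2: "\<And>Y. is_solution A2 {z. cmod z > 1 / d2} (\<lambda>z. z) Y \<Longrightarrow>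
         (\<exists>W C. mat_analytic W (ball 0 d2) \<and> (\<forall>u\<in>ball 0 d2. invertible (W u)) \<and>
            invertible C \<and> (\<forall>z. cmod z > 1 / d2 \<longrightarrow> Y z = diag_powers \<kappa>2 z ** W (1 / z) ** C))"
    using lf(2) unfolding local_form_at_inf_def by blast
  define d where "d = max d1 d2"
  have d: "d > 0" "\<And>j. j \<in> {1..m} \<Longrightarrow> cmod (a j) \<le> 1 / d"
    using d1 d2 by (auto simp: d_def max_def)
  have chart_S: "chart 0 u \<in> S" if u: "u \<in> ball 0 d" for u
  proof (cases "u = 0")
    case False
    then have "cmod (1 / u) > 1 / d" using u d(1) by (simp add: norm_divide divide_strict_left_mono)
    then have "1 / u \<notin> sing" using d(2) by force
    then show ?thesis using False to_sphere_in_S_iff by (simp add: chart_def)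
  qed (simp add: chart_def sphere_inf_in_S)
  have "\<exists>s. continuous_on (ball 0 d) s \<and> (\<forall>u\<in>ball 0 d. s u \<in> T \<and> \<rho> (s u) = chart 0 u)"
    by (rule lift_ex[OF open_ball _ continuous_on_chart chart_S])
      (use d(1) in \<open>auto intro: convex_imp_simply_connected\<close>)
  then obtain s where s: "continuous_on (ball 0 d) s" "\<And>u. u \<in> ball 0 d \<Longrightarrow> s u \<in> T"
    "\<And>u. u \<in> ball 0 d \<Longrightarrow> \<rho> (s u) = chart 0 u" by blast
  have inv_ball: "1 / z \<in> ball 0 d'" "z \<noteq> 0" if "cmod z > 1 / d'" "d' > 0" for z d'
  proof -
    show "z \<noteq> 0" using that by (metis less_irrefl norm_zero order.strict_trans zero_less_divide_1_iff)
    then show "1 / z \<in> ball 0 d'" using that by (simp add: norm_divide field_simps)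
  qed
  have sol: "is_solution A {z. cmod z > 1 / d'} (\<lambda>z. z) (\<lambda>z. Y (s (1 / z)))"
    if Y: "is_global_solution T \<rho> A Y" and d': "d' > 0" "d' \<le> d" for A :: "complex \<Rightarrow> 'n cmat" and Y d'
  proof (rule pullback[OF Y])
    have in_d: "1 / z \<in> ball 0 d" if "z \<in> {z. cmod z > 1 / d'}" for z
      using inv_ball(1)[of d' z] that d' by auto
    show "continuous_on {z. cmod z > 1 / d'} (\<lambda>z. s (1 / z))"
      by (rule continuous_on_compose2[OF s(1)]) (use in_d inv_ball(2) d' in \<open>auto intro!: continuous_intros\<close>)
    show "s (1 / z) \<in> T" "\<rho> (s (1 / z)) = to_sphere z" if "z \<in> {z. cmod z > 1 / d'}" for z
      using s(2,3)[OF in_d[OF that]] inv_ball(2)[of d' z] that d' by (auto simp: chart_def)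
    show "eventually (\<lambda>v. v \<noteq> u) (at u within {z. cmod z > 1 / d'})" for u
      by (simp add: eventually_at_filter)
  qed
  have dd: "d1 \<le> d" "d2 \<le> d" by (simp_all add: d_def)
  from f1[OF sol[OF Y(1) d1(1) dd(1)]]
  obtain W1 C1 where W1: "mat_analytic W1 (ball 0 d1)" "\<forall>u\<in>ball 0 d1. invertible (W1 u)" "invertible C1"
    "\<forall>z. cmod z > 1 / d1 \<longrightarrow> Y1 (s (1 / z)) = diag_powers \<kappa>1 z ** W1 (1 / z) ** C1" by blast
  from f2[OF sol[OF Y(2) d2(1) dd(2)]]
  obtain W2 C2 where W2: "mat_analytic W2 (ball 0 d2)" "\<forall>u\<in>ball 0 d2. invertible (W2 u)" "invertible C2"
    "\<forall>z. cmod z > 1 / d2 \<longrightarrow> Y2 (s (1 / z)) = diag_powers \<kappa>2 z ** W2 (1 / z) ** C2" by blast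
  define r where "r = min d1 d2"
  have r: "r > 0" "r \<le> d1" "r \<le> d2" "r \<le> d" using d1 d2 by (auto simp: r_def d_def)
  have balls: "ball 0 r \<subseteq> ball (0::complex) d1" "ball 0 r \<subseteq> ball (0::complex) d2" using r by auto
  show ?thesis
  proof (rule that[of r W1 W2 C1 "C2 ** matrix_inv C"])
    show "mat_analytic W1 (ball 0 r)" "mat_analytic W2 (ball 0 r)"
      using mat_analytic_subset W1(1) W2(1) balls by blast+
    show "invertible (W1 u)" "invertible (W2 u)" if "u \<in> ball 0 r" for u
      using W1(2) W2(2) balls that by blast+
    show "invertible (C2 ** matrix_inv C)" by (intro invertible_mat_mult W2(3) invertible_mat_inv C)
    fix z assume z: "cmod z > 1 / r"
    have "1 / d1 \<le> 1 / r" "1 / d2 \<le> 1 / r" using r d1 d2 by (simp_all add: frac_le)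
    then have z12: "cmod z > 1 / d1" "cmod z > 1 / d2" using z by auto
    note iz = inv_ball[OF z r(1)]
    then have "1 / z \<in> ball 0 d" using r by auto
    note sz = s(2,3)[OF this]
    have "\<rho> (s (1 / z)) = to_sphere z" using sz(2) iz(2) by (simp add: chart_def)
    then have "s (1 / z) \<in> F" "base (s (1 / z)) = z"
      using sz(1) by (simp_all add: F_iff to_sphere_neq_inf from_to_sphere)
    then have "Y2 (s (1 / z)) ** matrix_inv C = U z ** Y1 (s (1 / z))"
      using eq[of "s (1 / z)"] by (simp add: matrix_cancel[OF C])
    then show "U z ** (diag_powers \<kappa>1 z ** W1 (1 / z) ** C1) = diag_powers \<kappa>2 z ** W2 (1 / z) ** (C2 ** matrix_inv C)"
      using W1(4) W2(4) z12 by (simp add: matrix_mul_assoc)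
  qed (use r W1 in auto)
qed

section \<open>Construction of the gauge matrix\<close>

lemma (in marked_cover) t0F: "t\<^sub>0 \<in> F"
  using t0 to_sphere_neq_inf unfolding F_iff by (metis imageE)

text \<open>Replacing Y by Y P with the simultaneous conjugator P changes the monodromy matrices X_k
  to P^{-1} X_k P, which are the given M_k.\<close>

lemma (in marked_cover) monodromy_normalized:
  fixes M :: "nat \<Rightarrow> ('n::finite) cmat"
  assumes "has_monodromy T \<rho> \<sigma> m A M"
  obtains Y where "is_global_solution T \<rho> A Y"
    "\<And>k t. k \<in> {1..m} \<Longrightarrow> t \<in> F \<Longrightarrow> Y t = Y (\<sigma> k t) ** M k"
proof -
  obtain Y X P where Y: "is_global_solution T \<rho> A Y" and mon: "\<And>k t. k \<in> {1..m} \<Longrightarrow> t \<in> F \<Longrightarrow> Y t = Y (\<sigma> k t) ** X k"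
    and P: "invertible P" "\<And>k. k \<in> {1..m} \<Longrightarrow> M k = matrix_inv P ** X k ** P"
    using assms unfolding has_monodromy_def tuple_equiv_def by blast
  show ?thesis
  proof (rule that[of "\<lambda>t. Y t ** P"])
    show "is_global_solution T \<rho> A (\<lambda>t. Y t ** P)"
      using is_solution_mult_const[OF _ P(1)] Y by (simp add: is_global_solution_def)
    fix k t assume k: "k \<in> {1..m}" "t \<in> F"
    have "Y (\<sigma> k t) ** P ** M k = Y (\<sigma> k t) ** (P ** matrix_inv P) ** X k ** P"
      by (simp add: P(2)[OF k(1)] matrix_mul_assoc)
    then show "Y t ** P = Y (\<sigma> k t) ** P ** M k"
      using mon[OF k] by (simp add: matrix_inv_right[OF P(1)])
  qed
qed

lemma (in marked_cover) descended_gauge: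
  fixes M :: "nat \<Rightarrow> ('n::finite) cmat"
  assumes "has_monodromy T \<rho> \<sigma> m A1 M" "has_monodromy T \<rho> \<sigma> m A2 M"
  obtains U where "\<And>z. z \<notin> sing \<Longrightarrow> invertible (U z)"
    "\<And>z. z \<notin> sing \<Longrightarrow> has_mat_deriv U (A2 z ** U z - U z ** A1 z) z"
proof -
  obtain X1 where X1: "is_global_solution T \<rho> A1 X1"
    "\<And>k t. k \<in> {1..m} \<Longrightarrow> t \<in> F \<Longrightarrow> X1 t = X1 (\<sigma> k t) ** M k"
    using monodromy_normalized[OF assms(1)] by metis
  obtain X2 where X2: "is_global_solution T \<rho> A2 X2"
    "\<And>k t. k \<in> {1..m} \<Longrightarrow> t \<in> F \<Longrightarrow> X2 t = X2 (\<sigma> k t) ** M k"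
    using monodromy_normalized[OF assms(2)] by metis
  define W where "W t = X2 t ** matrix_inv (X1 t)" for t
  have W_inv: "W (\<sigma> k t) = W t" if k: "k \<in> {1..m}" and t: "t \<in> F" for k t
  proof -
    have "\<sigma> k t \<in> F" using \<sigma>(2,3)[OF k, of t] t by (simp add: F_iff)
    then have inv: "invertible (X1 (\<sigma> k t))" "invertible (X1 t)"
      using X1(1) t by (auto simp: is_global_solution_def is_solution_def)
    \<comment> \<open>Invertibility of \<open>M k\<close> is read off from the values of X1.\<close>
    have "M k = matrix_inv (X1 (\<sigma> k t)) ** X1 t"
      unfolding X1(2)[OF k t] by (simp add: matrix_cancel[OF inv(1)])
    then have M: "invertible (M k)" using inv by (simp add: invertible_mat_mult invertible_mat_inv)
    have "W t = X2 (\<sigma> k t) ** M k ** matrix_inv (X1 (\<sigma> k t) ** M k)"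
      unfolding W_def using X1(2)[OF k t] X2(2)[OF k t] by simp
    also have "\<dots> = W (\<sigma> k t)"
      by (simp add: W_def matrix_inv_mult[OF inv(1) M] matrix_mul_assoc matrix_cancel[OF M])
    finally show ?thesis by simp
  qed
  obtain U where U: "\<And>z0. z0 \<notin> sing \<Longrightarrow> \<exists>D s. open D \<and> z0 \<in> D \<and> is_section D s \<and> (\<forall>z\<in>D. U z = W (s z))"
    using descent[of W, OF W_inv] by blast
  have "invertible (U z0) \<and> has_mat_deriv U (A2 z0 ** U z0 - U z0 ** A1 z0) z0" if z0: "z0 \<notin> sing" for z0
  proof -
    obtain D s where D: "open D" "z0 \<in> D" "is_section D s" "\<And>z. z \<in> D \<Longrightarrow> U z = W (s z)"
      using U[OF z0] by blast
    note sol1 = section_solution[OF X1(1) D(1,3)] and sol2 = section_solution[OF X2(1) D(1,3)]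
    have Uz: "U z0 = X2 (s z0) ** matrix_inv (X1 (s z0))" using D by (simp add: W_def)
    note dI = has_mat_deriv_inv[OF D(1,2) section_analytic[OF X1(1) D(1,3)] sol1(1) sol1(2)[OF D(2)]]
    have "has_mat_deriv (\<lambda>z. X2 (s z) ** matrix_inv (X1 (s z))) (A2 z0 ** U z0 - U z0 ** A1 z0) z0"
      using has_mat_deriv_mult[OF sol2(2)[OF D(2)] dI]
      by (simp add: Uz matrix_mult_minus matrix_mul_assoc matrix_cancel(4)[OF sol1(1)[OF D(2)]] matrix_cancel(3)[OF sol1(1)[OF D(2)]])
    then have "has_mat_deriv U (A2 z0 ** U z0 - U z0 ** A1 z0) z0"
      by (rule has_mat_deriv_transform[OF _ D(1,2)]) (simp add: D(4) W_def)
    moreover have "invertible (U z0)"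
      unfolding Uz using sol1(1)[OF D(2)] sol2(1)[OF D(2)] by (intro invertible_mat_mult invertible_mat_inv)
    ultimately show ?thesis by blast
  qed
  then show ?thesis using that by blast
qed

text \<open>The quotient of the normalised solutions gives the gauge matrix;
  \<open>gauge_transformation\<close> then relates it to the given Y1 and Y2 through a constant. The
  bounds for the inverse come from the same equation near infinity read backwards, with \<kappa>1
  and \<kappa>2 exchanged.\<close>

lemma (in marked_cover) entire_gauge:
  fixes M E :: "nat \<Rightarrow> ('n::{finite,linorder}) cmat"
  assumes nr: "\<And>k. k \<in> {1..m} \<Longrightarrow> nonresonant (E k)"
    and sf: "standard_form T \<rho> \<sigma> m a M E \<kappa>1 A1" "standard_form T \<rho> \<sigma> m a M E \<kappa>2 A2"
    and Y: "is_global_solution T \<rho> A1 Y1" "is_global_solution T \<rho> A2 Y2"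
  shows "\<exists>G C. mat_analytic G UNIV \<and> (\<forall>z. invertible (G z)) \<and>
    (\<forall>z. z \<notin> sing \<longrightarrow> has_mat_deriv G (A2 z ** G z - G z ** A1 z) z) \<and>
    invertible C \<and> (\<forall>t\<in>F. Y2 t = G (base t) ** Y1 t ** C) \<and>
    (\<forall>i j. \<exists>B R. R > 0 \<and> (\<forall>z. cmod z \<ge> R \<longrightarrow> cmod (G z $ i $ j) \<le> B * cmod z powi (\<kappa>2 i - \<kappa>1 j))) \<and>
    (\<forall>i j. \<exists>B R. R > 0 \<and> (\<forall>z. cmod z \<ge> R \<longrightarrow> cmod (matrix_inv (G z) $ i $ j) \<le> B * cmod z powi (\<kappa>1 i - \<kappa>2 j)))"
proof -
  obtain U where U: "\<And>z. z \<notin> sing \<Longrightarrow> invertible (U z)"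
    "\<And>z. z \<notin> sing \<Longrightarrow> has_mat_deriv U (A2 z ** U z - U z ** A1 z) z"
    using descended_gauge[of A1 M A2] sf unfolding standard_form_def by blast
  obtain C where C: "invertible C" "\<And>t. t \<in> F \<Longrightarrow> Y2 t = U (base t) ** Y1 t ** C"
    using gauge_transformation[OF Y U t0F] by blast
  have "\<exists>G r. r > 0 \<and> mat_analytic G (ball x r) \<and> (\<forall>z\<in>ball x r. invertible (G z)) \<and>
    (\<forall>z\<in>ball x r - {x}. z \<notin> sing \<and> U z = G z)" if x: "x \<in> sing" for x
  proof -
    obtain k where k: "k \<in> {1..m}" "x = a k" using x by blast
    have "local_form_at m a E A1 k" "local_form_at m a E A2 k"
      using sf k(1) by (simp_all add: standard_form_def)
    from extend_at_singularity[OF k(1) nr[OF k(1)] this Y C] show ?thesis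
      unfolding k(2) by blast
  qed
  then obtain G r where G: "\<And>x. x \<in> sing \<Longrightarrow> r x > 0" "\<And>x. x \<in> sing \<Longrightarrow> mat_analytic (G x) (ball x (r x))"
    "\<And>x z. x \<in> sing \<Longrightarrow> z \<in> ball x (r x) \<Longrightarrow> invertible (G x z)"
    "\<And>x z. x \<in> sing \<Longrightarrow> z \<in> ball x (r x) - {x} \<Longrightarrow> z \<notin> sing \<and> U z = G x z"
    by metis
  \<comment> \<open>At a singularity the value is that of the local extension; around it V coincides
    with that extension by \<open>V_G\<close>.\<close>
  define V where "V z = (if z \<in> sing then G z z else U z)" for z
  have V_G: "V z = G x z" if "x \<in> sing" "z \<in> ball x (r x)" for x z
    using G(4)[OF that(1), of z] that by (cases "z = x") (auto simp: V_def)
  have open_ns: "open (- sing)" by (intro open_Compl finite_imp_closed) simp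
  have dV: "has_mat_deriv V (A2 z ** V z - V z ** A1 z) z" if z: "z \<notin> sing" for z
  proof -
    have "has_mat_deriv V (A2 z ** U z - U z ** A1 z) z"
      by (rule has_mat_deriv_transform[OF U(2)[OF z] open_ns]) (use z in \<open>auto simp: V_def\<close>)
    then show ?thesis using z by (simp add: V_def)
  qed
  have "\<exists>V'. has_mat_deriv V V' z" for z
  proof (cases "z \<in> sing")
    case True
    have z: "z \<in> ball z (r z)" using G(1)[OF True] by simp
    have "has_mat_deriv V (mat_deriv (G z) z) z"
      by (rule has_mat_deriv_transform[OF mat_analytic_imp_has_mat_deriv[OF G(2)[OF True] z] open_ball z])
        (rule V_G[OF True, symmetric])
    then show ?thesis by blast
  next
    case False
    then show ?thesis using dV by blast
  qed
  then obtain V' where "\<And>z. has_mat_deriv V (V' z) z" by metis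
  then have anV: "mat_analytic V UNIV" by (intro mat_analytic_if_has_mat_deriv) auto
  have invV: "invertible (V z)" for z
    using G(1,3)[of z] U(1)[of z] by (cases "z \<in> sing") (auto simp: V_def)
  have eqV: "Y2 t = V (base t) ** Y1 t ** C" if "t \<in> F" for t
    using C(2)[OF that] base_notin_sing[OF that] by (simp add: V_def)
  have lf_inf: "local_form_at_inf m a \<kappa>1 A1" "local_form_at_inf m a \<kappa>2 A2"
    using sf by (simp_all add: standard_form_def)
  obtain \<delta> W1 W2 C1 C2 where W: "\<delta> > 0" "mat_analytic W1 (ball 0 \<delta>)" "\<And>u. u \<in> ball 0 \<delta> \<Longrightarrow> invertible (W1 u)"
    "mat_analytic W2 (ball 0 \<delta>)" "\<And>u. u \<in> ball 0 \<delta> \<Longrightarrow> invertible (W2 u)"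
    "invertible (C1 :: 'n cmat)" "invertible (C2 :: 'n cmat)"
    "\<And>z. cmod z > 1 / \<delta> \<Longrightarrow> V z ** (diag_powers \<kappa>1 z ** W1 (1 / z) ** C1) = diag_powers \<kappa>2 z ** W2 (1 / z) ** C2"
    using local_forms_at_inf[OF lf_inf Y C(1) eqV] by blast
  have W': "matrix_inv (V z) ** (diag_powers \<kappa>2 z ** W2 (1 / z) ** C2) = diag_powers \<kappa>1 z ** W1 (1 / z) ** C1"
    if "cmod z > 1 / \<delta>" for z
    unfolding W(8)[OF that, symmetric] by (rule matrix_cancel(1)[OF invV])
  show ?thesis
    using anV invV dV C(1) eqV growth_at_infinity[OF W(1-4,6,8)] growth_at_infinity[OF W(1,4,5,2,7) W']
    by (intro exI[of _ V] exI[of _ C] conjI allI impI ballI)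
qed

text \<open>The relation is differentiated along a section through a point above z; the invertible
  factors C and Y1 then cancel on the right.\<close>

lemma (in punctured_sphere_cover) gauge_equation_of_relation:
  assumes Y: "is_global_solution T \<rho> A1 Y1" "is_global_solution T \<rho> A2 Y2"
    and V: "mat_analytic V UNIV" and C: "invertible C"
    and eq: "\<And>t. t \<in> F \<Longrightarrow> Y2 t = V (base t) ** Y1 t ** C" and z: "z \<notin> sing"
  shows "mat_deriv V z = A2 z ** V z - V z ** A1 z"
proof -
  obtain t where t: "t \<in> T" "\<rho> t = to_sphere z" using \<rho>_surj to_sphere_in_S_iff z by blast
  then have tF: "t \<in> F" and bt: "base t = z" by (simp_all add: F_iff to_sphere_neq_inf from_to_sphere)
  obtain D s where D: "open D" "is_section D s" "z \<in> D"
    using local_section[OF tF] bt by metis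
  note sol1 = section_solution[OF Y(1) D] and sol2 = section_solution[OF Y(2) D]
  have eqD: "Y2 (s w) = V w ** Y1 (s w) ** C" if "w \<in> D" for w
    using eq[OF is_section_in_F[OF D(2) that]] is_section_base[OF D(2) that] by simp
  have "has_mat_deriv (\<lambda>w. Y2 (s w))
      ((mat_deriv V z ** Y1 (s z) + V z ** (A1 z ** Y1 (s z))) ** C + (V z ** Y1 (s z)) ** 0) z"
    by (rule has_mat_deriv_transform[OF has_mat_deriv_mult[OF has_mat_deriv_mult[OF
          mat_analytic_imp_has_mat_deriv[OF V UNIV_I] sol1(2)] has_mat_deriv_const] D(1,3)])
      (simp add: eqD)
  from has_mat_deriv_unique[OF sol2(2) this]
  have "A2 z ** V z ** Y1 (s z) ** C = (mat_deriv V z + V z ** A1 z) ** Y1 (s z) ** C"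
    by (simp add: eqD[OF D(3)] matrix_mult_zero matrix_mult_add matrix_mul_assoc)
  then have "A2 z ** V z ** Y1 (s z) ** C ** matrix_inv C ** matrix_inv (Y1 (s z))
      = (mat_deriv V z + V z ** A1 z) ** Y1 (s z) ** C ** matrix_inv C ** matrix_inv (Y1 (s z))"
    by simp
  then have "A2 z ** V z = mat_deriv V z + V z ** A1 z"
    by (simp only: matrix_cancel(3)[OF C] matrix_cancel(3)[OF sol1(1)])
  then show ?thesis by simp
qed

theorem theorem3p5:
  fixes m :: nat
    and a :: "nat \<Rightarrow> complex"
    and \<gamma> :: "real \<Rightarrow> complex"
    and \<tau> :: "nat \<Rightarrow> real"
    and T :: "'u::real_normed_vector set"
    and \<rho> :: "'u \<Rightarrow> complex \<times> real"
    and t\<^sub>0 :: 'u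
    and p :: "nat \<Rightarrow> real \<Rightarrow> 'u"
    and \<sigma> :: "nat \<Rightarrow> 'u \<Rightarrow> 'u"
    and M E :: "nat \<Rightarrow> ('n::{finite,linorder}) cmat"
    and A\<^sub>1 A\<^sub>2 :: "complex \<Rightarrow> 'n cmat"
    and Y\<^sub>1 Y\<^sub>2 :: "'u \<Rightarrow> 'n cmat"
    and \<kappa>\<^sub>1 \<kappa>\<^sub>2 :: "'n \<Rightarrow> int"
  assumes "m \<ge> 1"
    and "smooth_closed_curve \<gamma>" and "positively_oriented \<gamma>"
    and "in_order_on_curve m a \<gamma> \<tau>"
    and "universal_covering T \<rho> (punctured_sphere m a)"
    and "t\<^sub>0 \<in> T" and "\<rho> t\<^sub>0 \<in> to_sphere ` inside (path_image \<gamma>)"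
    and "\<And>k. k \<in> {1..m} \<Longrightarrow> path_around T \<rho> m \<gamma> \<tau> t\<^sub>0 k (p k)"
    and "\<And>k. k \<in> {1..m} \<Longrightarrow> deck_transformation T \<rho> (\<sigma> k) \<and> \<sigma> k t\<^sub>0 = pathfinish (p k)"
    and "admissible_data m M E"
    and "standard_form T \<rho> \<sigma> m a M E \<kappa>\<^sub>1 A\<^sub>1" and "is_global_solution T \<rho> A\<^sub>1 Y\<^sub>1"
    and "standard_form T \<rho> \<sigma> m a M E \<kappa>\<^sub>2 A\<^sub>2" and "is_global_solution T \<rho> A\<^sub>2 Y\<^sub>2"
  shows "\<kappa>\<^sub>1 = \<kappa>\<^sub>2 \<and>
    (\<forall>K \<kappa>b l. index_blocks \<kappa>\<^sub>1 K \<kappa>b l \<longrightarrow>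
      (\<exists>V C. block_form \<kappa>\<^sub>1 K \<kappa>b V \<and> invertible C \<and>
        (\<forall>z\<in>- a ` {1..m}. A\<^sub>2 z =
           mat_deriv V z ** matrix_inv (V z) + V z ** A\<^sub>1 z ** matrix_inv (V z)) \<and>
        (\<forall>t\<in>finite_part T \<rho>. Y\<^sub>2 t = V (from_sphere (\<rho> t)) ** Y\<^sub>1 t ** C)) \<and>
      (\<forall>V. block_form \<kappa>\<^sub>1 K \<kappa>b V \<longrightarrow>
        ((\<forall>z\<in>- a ` {1..m}. A\<^sub>2 z =
            mat_deriv V z ** matrix_inv (V z) + V z ** A\<^sub>1 z ** matrix_inv (V z)) \<longleftrightarrow>
         (\<exists>C. invertible C \<and>
            (\<forall>t\<in>finite_part T \<rho>. Y\<^sub>2 t = V (from_sphere (\<rho> t)) ** Y\<^sub>1 t ** C)))))"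
proof -
  interpret marked_cover m a T \<rho> \<gamma> \<tau> t\<^sub>0 p \<sigma>
    using assms(1-9) by unfold_locales (simp_all add: smooth_closed_curve_def)
  have nr: "nonresonant (E k)" if "k \<in> {1..m}" for k
    using assms(10) that by (simp add: admissible_data_def)
  obtain G C where G: "mat_analytic G UNIV" "\<And>z. invertible (G z)"
    "\<And>z. z \<notin> sing \<Longrightarrow> has_mat_deriv G (A\<^sub>2 z ** G z - G z ** A\<^sub>1 z) z"
    and C: "invertible C" "\<And>t. t \<in> F \<Longrightarrow> Y\<^sub>2 t = G (base t) ** Y\<^sub>1 t ** C"
    and growth: "\<And>i j. \<exists>B R. R > 0 \<and> (\<forall>z. cmod z \<ge> R \<longrightarrow> cmod (G z $ i $ j) \<le> B * cmod z powi (\<kappa>\<^sub>2 i - \<kappa>\<^sub>1 j))"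
    "\<And>i j. \<exists>B R. R > 0 \<and> (\<forall>z. cmod z \<ge> R \<longrightarrow> cmod (matrix_inv (G z) $ i $ j) \<le> B * cmod z powi (\<kappa>\<^sub>1 i - \<kappa>\<^sub>2 j))"
    using entire_gauge[OF nr assms(11,13,12,14)] by blast
  have hol: "(\<lambda>z. G z $ i $ j) holomorphic_on UNIV" "(\<lambda>z. matrix_inv (G z) $ i $ j) holomorphic_on UNIV" for i j
    using mat_analytic_nth[OF G(1)] mat_analytic_nth[OF mat_analytic_inv[OF G(1) open_UNIV G(2)]]
    by (simp_all add: analytic_imp_holomorphic)
  have zero: "G z $ i $ j = 0" if "\<kappa>\<^sub>2 i < \<kappa>\<^sub>1 j" for z i j
    using growth(1)[of i j] entire_growth_powi(1)[OF hol(1), of _ i j _ "\<kappa>\<^sub>2 i - \<kappa>\<^sub>1 j" z] that by auto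
  have zero': "matrix_inv (G z) $ i $ j = 0" if "\<kappa>\<^sub>1 i < \<kappa>\<^sub>2 j" for z i j
    using growth(2)[of i j] entire_growth_powi(1)[OF hol(2), of _ i j _ "\<kappa>\<^sub>1 i - \<kappa>\<^sub>2 j" z] that by auto
  have mono: "antimono \<kappa>\<^sub>1" "antimono \<kappa>\<^sub>2" using assms(11,13) by (simp_all add: standard_form_def)
  have "\<kappa>\<^sub>1 q \<le> \<kappa>\<^sub>2 q" for q by (rule indices_le[OF mono G(2) zero])
  moreover have "\<kappa>\<^sub>2 q \<le> \<kappa>\<^sub>1 q" for q
    by (rule indices_le[OF mono(2,1) invertible_mat_inv[OF G(2)] zero'])
  ultimately have \<kappa>: "\<kappa>\<^sub>1 = \<kappa>\<^sub>2" by (intro ext antisym)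
  have block: "block_form \<kappa>\<^sub>1 K \<kappa>b G" if "index_blocks \<kappa>\<^sub>1 K \<kappa>b l" for K \<kappa>b l
  proof (rule block_form_if_growth[OF G(1,2) _ _ that])
    show "\<exists>B R. \<forall>z. cmod z \<ge> R \<longrightarrow> cmod (G z $ i $ j) \<le> B * cmod z powi (\<kappa>\<^sub>1 i - \<kappa>\<^sub>1 j)" for i j
      using growth(1)[of i j] unfolding \<kappa> by blast
    show "matrix_inv (G z) $ i $ j = 0" if "\<kappa>\<^sub>1 i < \<kappa>\<^sub>1 j" for z i j
      using zero'[of i j z] that unfolding \<kappa> by blast
  qed
  have "A\<^sub>2 z = mat_deriv G z ** matrix_inv (G z) + G z ** A\<^sub>1 z ** matrix_inv (G z)" if "z \<in> - sing" for z
    using has_mat_deriv_imp_mat_deriv[OF G(3)] that gauge_equation_iff[OF G(2)] by simp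
  then have ex: "\<exists>V C. block_form \<kappa>\<^sub>1 K \<kappa>b V \<and> invertible C \<and>
      (\<forall>z\<in>- sing. A\<^sub>2 z = mat_deriv V z ** matrix_inv (V z) + V z ** A\<^sub>1 z ** matrix_inv (V z)) \<and>
      (\<forall>t\<in>F. Y\<^sub>2 t = V (base t) ** Y\<^sub>1 t ** C)" if "index_blocks \<kappa>\<^sub>1 K \<kappa>b l" for K \<kappa>b l
    using block[OF that] C by blast
  \<comment> \<open>This concerns every V of block form, not only G; such V are entire, so the gauge
    equation and the relation between the solutions can be derived from each other.\<close>
  have equiv: "(\<forall>z\<in>- sing. A\<^sub>2 z = mat_deriv V z ** matrix_inv (V z) + V z ** A\<^sub>1 z ** matrix_inv (V z)) \<longleftrightarrow>
      (\<exists>C. invertible C \<and> (\<forall>t\<in>F. Y\<^sub>2 t = V (base t) ** Y\<^sub>1 t ** C))"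
    if blocks: "index_blocks \<kappa>\<^sub>1 K \<kappa>b l" and V: "block_form \<kappa>\<^sub>1 K \<kappa>b V" for K \<kappa>b l V
  proof -
    have invV: "invertible (V z)" for z using V by (simp add: block_form_def)
    have anV: "mat_analytic V UNIV" by (rule block_form_analytic[OF blocks V])
    show ?thesis
      unfolding gauge_equation_iff[OF invV]
    proof
      assume gauge: "\<forall>z\<in>- sing. mat_deriv V z = A\<^sub>2 z ** V z - V z ** A\<^sub>1 z"
      have "has_mat_deriv V (A\<^sub>2 z ** V z - V z ** A\<^sub>1 z) z" if "z \<notin> sing" for z
        using mat_analytic_imp_has_mat_deriv[OF anV UNIV_I, of z] gauge that by simp
      from gauge_transformation[OF assms(12,14) invV this t0F]
      show "\<exists>C. invertible C \<and> (\<forall>t\<in>F. Y\<^sub>2 t = V (base t) ** Y\<^sub>1 t ** C)" by blast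
    next
      assume "\<exists>C. invertible C \<and> (\<forall>t\<in>F. Y\<^sub>2 t = V (base t) ** Y\<^sub>1 t ** C)"
      then show "\<forall>z\<in>- sing. mat_deriv V z = A\<^sub>2 z ** V z - V z ** A\<^sub>1 z"
        using gauge_equation_of_relation[OF assms(12,14) anV] by blast
    qed
  qed
  show ?thesis using \<kappa> ex equiv by blast
qed

end
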